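(* Let $n$ be a positive integer, let $A$ be an abelian group, and let $f:\mathbb Z_n\times\mathbb Z_n\times\{+,-\}\to A$ be an $n$-up-down cocycle. Let $D$ and $D'$ be diagrams which represent the same virtual-knot. If $\Phi_f(D)\neq\Phi_f(D')$ as multi-sets, then any finite sequence of generalized Reidemeister moves between $D$ and $D'$ includes at least one Reidemeister move of type II (RII-move).
   Context: A virtual-knot diagram is an oriented generic closed curve in $\mathbb R^2$ (an immersed circle whose only multiple points are finitely many transverse double points), where each double point is either a real-crossing (equipped with over/under information) or a virtual-crossing (no over/under information). Generalized Reidemeister moves are the following local changes of diagrams inside a disk (in both directions, with all possible orientations of the strands), plane isotopies being allowed freely. RI: adding or removing a kink with one real-crossing (of any kind). RII: adding or removing a bigon formed by two strands with two real-crossings, one strand being over at both. RIII: moving one strand across the crossing of two others, where the three strands cross pairwise in three real-crossings, one strand being over both others, one under both others. VRI, VRII, VRIII: the analogues of the underlying planar moves with all crossings involved virtual. VRIV: moving a strand across a real-crossing of two other strands, where the moving strand meets each of the other two in a virtual-crossing. Two diagrams represent the same virtual-knot if they are related by a finite sequence of generalized Reidemeister moves. A semi-arc of $D$ is an edge obtained by cutting the curve $D$ at the real-crossings (both the over- and the under-strand are cut there; virtual-crossings are ignored): its end points are real-crossings and it has no real-crossing in its interior. If $D$ has no real-crossing, the whole curve counts as a single semi-arc. $\mathcal{SA}(D)$ denotes the set of semi-arcs. Write $\mathbb Z_n=\mathbb Z/n\mathbb Z$. An $n$-up-down coloring of $D$ is a map $C:\mathcal{SA}(D)\to\mathbb Z_n$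 such that at each real-crossing, if $u_1,u_2$ are the under-semi-arcs and $o_1,o_2$ the over-semi-arcs, with the orientation of $D$ pointing from $u_1$ to $u_2$ and from $o_1$ to $o_2$, then $C(u_2)=C(u_1)-1$ and $C(o_2)=C(o_1)+1$. An $n$-up-down cocycle is a map $f:\mathbb Z_n\times\mathbb Z_n\times\{+,-\}\to A$ ($A$ an abelian group) such that $f(a,a,\varepsilon)=0$ for all $a\in\mathbb Z_n$, $\varepsilon\in\{+,-\}$, and for all $a,b,c\in\mathbb Z_n$: (1) $f(a-1,b,-)+f(b+1,c+1,+)+f(a-1,c+2,+)=f(a-2,b-1,-)+f(b,c+2,+)+f(a,c+1,+)$; (2) $f(a-1,b,-)+f(b,c+1,-)+f(a-2,c,-)=f(a-2,b-1,-)+f(b-1,c,-)+f(a-1,c+1,-)$; (3) $f(a-1,b+1,+)+f(b+1,c+1,+)+f(a-1,c+1,-)=f(a,b,+)+f(b,c+2,+)+f(a-2,c,-)$; (4) $f(a-1,b+1,+)+f(b,c+1,-)+f(a,c+1,+)=f(a,b,+)+f(b-1,c,-)+f(a-1,c+2,+)$; (5) $f(a,b+1,+)+f(b+1,c+2,+)+f(a-1,c+1,+)=f(a-1,b,+)+f(b,c+1,+)+f(a,c+2,+)$; (6) $f(a,b+1,+)+f(b,c,-)+f(a-2,c+1,-)=f(a-1,b,+)+f(b-1,c+1,-)+f(a-1,c,-)$; (7) $f(a-2,b,-)+f(b+1,c+2,+)+f(a-1,c,-)=f(a-1,b-1,-)+f(b,c+1,+)+f(a-2,c+1,-)$; (8)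 $f(a-2,b,-)+f(b,c,-)+f(a,c+2,+)=f(a-1,b-1,-)+f(b-1,c+1,-)+f(a-1,c+1,+)$. For an $n$-up-down coloring $C$ of $D$ and a real-crossing $c$ with under-semi-arcs $u_1,u_2$ and over-semi-arcs $o_1,o_2$ around $c$, labelled so that the orientation of $D$ points from $u_1$ to $u_2$ and from $o_1$ to $o_2$, the weight is $w_c=f(C(u_1),C(o_2),+)$ if $c$ is a positive crossing and $w_c=f(C(u_2),C(o_1),-)$ if $c$ is negative (usual sign: positive iff (direction of over-strand, direction of under-strand) is a positively oriented basis of $\mathbb R^2$). Put $W_f(D,C)=\sum_c w_c$, the sum over all real-crossings of $D$. $\Phi_f(D)$ is the multi-set $\{W_f(D,C)\mid C \text{ an } n\text{-up-down coloring of } D\}$. *)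

theory Defs
  imports "HOL-Analysis.Analysis"
begin

section \<open>Virtual-knot diagrams\<close>

text \<open>
  The plane is \<^typ>\<open>complex\<close> and the parametrising circle is \<^term>\<open>sphere (0::complex) 1\<close>, oriented
  counterclockwise.  Only the restriction of \<open>curve\<close> to that circle matters.  Crossing information
  is carried by the parameters: \<open>over\<close> and \<open>under\<close> consist of the parameters at which the curve runs
  through a real-crossing as the over-strand, respectively as the under-strand.  A double point whose
  two parameters lie in neither set is a virtual-crossing.
\<close>

record vdiagram =
  curve :: "complex \<Rightarrow> complex"
  over :: "complex set"
  under :: "complex set"

abbreviation circle :: "complex set"
  where "circle \<equiv> sphere 0 1"

definition tangent :: "vdiagram \<Rightarrow> complex \<Rightarrow> complex"
  where "tangent D z = vector_derivative (\<lambda>\<theta>. curve D (z * cis \<theta>)) (at 0)"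

text \<open>The determinant of the pair of plane vectors \<open>v\<close>, \<open>w\<close>.\<close>

definition det2 :: "complex \<Rightarrow> complex \<Rightarrow> real"
  where "det2 v w = Re v * Im w - Im v * Re w"

definition double_params :: "vdiagram \<Rightarrow> complex set"
  where "double_params D =
    {z \<in> circle. \<exists>w\<in>circle. w \<noteq> z \<and> curve D w = curve D z}"

definition virtual_knot_diagram :: "vdiagram \<Rightarrow> bool"
  where "virtual_knot_diagram D \<longleftrightarrow>
    (\<lambda>\<theta>. curve D (cis \<theta>)) C1_differentiable_on UNIV \<and>
    (\<forall>z\<in>circle. tangent D z \<noteq> 0) \<and>
    finite (double_params D) \<and>
    (\<forall>x\<in>circle. \<forall>y\<in>circle. \<forall>z\<in>circle.
       curve D x = curve D y \<longrightarrow> curve D y = curve D z \<longrightarrow> x = y \<or> y = z \<or> x = z) \<and>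
    (\<forall>z\<in>circle. \<forall>w\<in>circle. z \<noteq> w \<longrightarrow> curve D z = curve D w \<longrightarrow>
       det2 (tangent D z) (tangent D w) \<noteq> 0) \<and>
    over D \<union> under D \<subseteq> double_params D \<and>
    over D \<inter> under D = {} \<and>
    (\<forall>z\<in>circle. \<forall>w\<in>circle. z \<noteq> w \<longrightarrow> curve D z = curve D w \<longrightarrow>
       (z \<in> over D \<longleftrightarrow> w \<in> under D))"

text \<open>A real-crossing is recorded as the pair of its over- and its under-parameter.\<close>

definition real_crossings :: "vdiagram \<Rightarrow> (complex \<times> complex) set"
  where "real_crossings D =
    {(p, q). p \<in> over D \<and> q \<in> under D \<and> curve D p = curve D q}"

definition positive_crossing :: "vdiagram \<Rightarrow> complex \<times> complex \<Rightarrow> bool"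
  where "positive_crossing D c \<longleftrightarrow> det2 (tangent D (fst c)) (tangent D (snd c)) > 0"


section \<open>Generalized Reidemeister moves\<close>

text \<open>
  A plane isotopy is a path of \<open>C\<^sup>1\<close>-diffeomorphisms starting at the identity.
\<close>

definition plane_isotopy :: "(real \<Rightarrow> complex \<Rightarrow> complex) \<Rightarrow> bool"
  where "plane_isotopy H \<longleftrightarrow>
    (\<forall>z. H 0 z = z) \<and>
    (\<forall>t\<in>{0..1}. bij (H t)) \<and>
    continuous_on ({0..1} \<times> UNIV) (\<lambda>(t, z). H t z) \<and>
    (\<exists>H' :: real \<Rightarrow> complex \<Rightarrow> complex \<Rightarrow>\<^sub>L complex.
       continuous_on ({0..1} \<times> UNIV) (\<lambda>(t, z). H' t z) \<and>
       (\<forall>t\<in>{0..1}. \<forall>z. (H t has_derivative blinfun_apply (H' t z)) (at z) \<and>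
          bij (blinfun_apply (H' t z))))"

text \<open>
  The lift to the real line of an orientation preserving diffeomorphism of the circle.  Composing
  with it is needed because a diagram is an oriented curve without a preferred parametrisation.
\<close>

definition circle_reparam :: "(real \<Rightarrow> real) \<Rightarrow> bool"
  where "circle_reparam \<rho> \<longleftrightarrow>
    (\<forall>\<theta>. \<rho> (\<theta> + 2 * pi) = \<rho> \<theta> + 2 * pi) \<and>
    (\<exists>\<rho>'. continuous_on UNIV \<rho>' \<and>
       (\<forall>\<theta>. (\<rho> has_real_derivative \<rho>' \<theta>) (at \<theta>) \<and> 0 < \<rho>' \<theta>))"

definition isotopic :: "vdiagram \<Rightarrow> vdiagram \<Rightarrow> bool"
  where "isotopic D D' \<longleftrightarrow>
    virtual_knot_diagram D \<and> virtual_knot_diagram D' \<and>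
    (\<exists>H \<rho>. plane_isotopy H \<and> circle_reparam \<rho> \<and>
       (\<forall>\<theta>. curve D' (cis \<theta>) = H 1 (curve D (cis (\<rho> \<theta>))) \<and>
            (cis \<theta> \<in> over D' \<longleftrightarrow> cis (\<rho> \<theta>) \<in> over D) \<and>
            (cis \<theta> \<in> under D' \<longleftrightarrow> cis (\<rho> \<theta>) \<in> under D)))"

text \<open>
  Since plane isotopies are free, a move may be performed in the closed unit disk and between fixed
  model pictures.  A picture is a list of strands; each strand is parametrised by \<open>[-1,1]\<close>, runs
  inside the unit disk and has its end points on the unit circle.  The two pictures of a move have
  the same strand ends with the same tangent directions there.

  \<open>traverses D p a b \<sigma>\<close>: on the parameters of angle between \<open>a\<close> and \<open>b\<close> the curve of \<open>D\<close> runs once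
  along the strand \<open>p\<close>, in the direction of \<open>p\<close> if \<open>\<sigma> = 1\<close> and against it if \<open>\<sigma> = -1\<close>.
\<close>

definition traverses ::
    "vdiagram \<Rightarrow> (real \<Rightarrow> complex) \<Rightarrow> real \<Rightarrow> real \<Rightarrow> real \<Rightarrow> bool"
  where "traverses D p a b \<sigma> \<longleftrightarrow>
    (\<exists>\<rho> \<rho>'. \<rho> a = - \<sigma> \<and> \<rho> b = \<sigma> \<and> continuous_on {a..b} \<rho>' \<and>
       (\<forall>\<theta>\<in>{a..b}. (\<rho> has_real_derivative \<rho>' \<theta>) (at \<theta> within {a..b}) \<and> 0 < \<sigma> * \<rho>' \<theta> \<and>
          curve D (cis \<theta>) = p (\<rho> \<theta>)))"

text \<open>
  \<open>D\<close> and \<open>D'\<close> coincide outside the unit disk, meet the disk in the pictures \<open>P\<close> and \<open>P'\<close>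
  respectively, with corresponding orientations of the strands, and their crossings in the disk
  satisfy the condition \<open>Q\<close>, whose second argument \<open>S\<close> lists the parameter sets \<open>S i\<close> of the
  strands.
\<close>

definition local_change ::
    "(real \<Rightarrow> complex) list \<Rightarrow> (real \<Rightarrow> complex) list \<Rightarrow>
     (vdiagram \<Rightarrow> (nat \<Rightarrow> complex set) \<Rightarrow> bool) \<Rightarrow> vdiagram \<Rightarrow> vdiagram \<Rightarrow> bool"
  where "local_change P P' Q D D' \<longleftrightarrow>
    virtual_knot_diagram D \<and> virtual_knot_diagram D' \<and> length P = length P' \<and>
    (\<exists>a b \<sigma>. let S = (\<lambda>i. cis ` {a i..b i}) in
       (\<forall>i<length P. a i < b i \<and> b i < a i + 2 * pi \<and> \<sigma> i \<in> {1, -1} \<and>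
          traverses D (P ! i) (a i) (b i) (\<sigma> i) \<and>
          traverses D' (P' ! i) (a i) (b i) (\<sigma> i)) \<and>
       (\<forall>i<length P. \<forall>j<length P. i \<noteq> j \<longrightarrow> S i \<inter> S j = {}) \<and>
       (\<forall>z \<in> circle - (\<Union>i<length P. S i).
          curve D' z = curve D z \<and> 1 < norm (curve D z) \<and>
          (z \<in> over D' \<longleftrightarrow> z \<in> over D) \<and> (z \<in> under D' \<longleftrightarrow> z \<in> under D)) \<and>
       Q D S \<and> Q D' S)"

text \<open>
  The self-crossings of the single strand are all real (type I), respectively all virtual.
\<close>

definition real_kink :: "vdiagram \<Rightarrow> (nat \<Rightarrow> complex set) \<Rightarrow> bool"
  where "real_kink D S \<longleftrightarrow> S 0 \<inter> double_params D \<subseteq> over D \<union> under D"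

definition virtual_kink :: "vdiagram \<Rightarrow> (nat \<Rightarrow> complex set) \<Rightarrow> bool"
  where "virtual_kink D S \<longleftrightarrow> S 0 \<inter> (over D \<union> under D) = {}"

text \<open>
  \<open>crosses_as r k D S\<close>: where two of the \<open>k\<close> strands \<open>i \<noteq> j\<close> cross, the crossing is real with \<open>i\<close> over
  \<open>j\<close> iff \<open>r i j\<close>; it is virtual iff neither \<open>r i j\<close> nor \<open>r j i\<close>.
\<close>

definition crosses_as ::
    "(nat \<Rightarrow> nat \<Rightarrow> bool) \<Rightarrow> nat \<Rightarrow> vdiagram \<Rightarrow> (nat \<Rightarrow> complex set) \<Rightarrow> bool"
  where "crosses_as r k D S \<longleftrightarrow>
    (\<forall>i<k. \<forall>j<k. i \<noteq> j \<longrightarrow> (\<forall>z\<in>S i. \<forall>w\<in>S j. curve D z = curve D w \<longrightarrow>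
       (z \<in> over D \<longleftrightarrow> r i j) \<and> (z \<in> under D \<longleftrightarrow> r j i)))"

text \<open>
  The plain strand is the horizontal diameter.  The kink \<open>kink_strand s\<close> has its only double point at
  \<open>t = \<plusminus>1/\<surd>2\<close>; it curls one way for \<open>s = 1\<close> and the other way for \<open>s = -1\<close>.
\<close>

definition plain_strand :: "real \<Rightarrow> complex"
  where "plain_strand t = Complex t 0"

definition kink_strand :: "real \<Rightarrow> real \<Rightarrow> complex"
  where "kink_strand s t = Complex (2 * t ^ 3 - t) (s * (1 - t\<^sup>2)\<^sup>2 / 2)"

text \<open>
  A chord parallel to the horizontal diameter, and the same chord pushed down across the diameter,
  which it then meets in two points.
\<close>

definition chord_strand :: "real \<Rightarrow> complex"
  where "chord_strand t = Complex (4 / 5 * t) (3 / 5)"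

definition pushed_chord_strand :: "real \<Rightarrow> complex"
  where "pushed_chord_strand t = Complex (4 / 5 * t) (3 / 5 - (1 - t\<^sup>2)\<^sup>2)"

text \<open>
  Two diameters crossing at the centre, and a third strand passing above the centre for \<open>s = 1\<close> and
  below it for \<open>s = -1\<close>.
\<close>

definition triple_picture :: "real \<Rightarrow> (real \<Rightarrow> complex) list"
  where "triple_picture s =
    [\<lambda>t. Complex (3 / 5 * t) (4 / 5 * t),
     \<lambda>t. Complex (3 / 5 * t) (- 4 / 5 * t),
     \<lambda>t. Complex t (s * (1 - t\<^sup>2)\<^sup>2 / 4)]"

datatype move = RI | RII | RIII | VRI | VRII | VRIII | VRIV

fun directed_move :: "move \<Rightarrow> vdiagram \<Rightarrow> vdiagram \<Rightarrow> bool"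
  where
    "directed_move RI D D' \<longleftrightarrow>
       (\<exists>s\<in>{1, -1}. local_change [plain_strand] [kink_strand s] real_kink D D')"
  | "directed_move RII D D' \<longleftrightarrow>
       (\<exists>m<2. local_change [plain_strand, chord_strand] [plain_strand, pushed_chord_strand]
          (crosses_as (\<lambda>i j. i = m) 2) D D')"
  | "directed_move RIII D D' \<longleftrightarrow>
       (\<exists>h :: nat \<Rightarrow> nat. inj_on h {..<3} \<and>
          local_change (triple_picture 1) (triple_picture (-1))
            (crosses_as (\<lambda>i j. h j < h i) 3) D D')"
  | "directed_move VRI D D' \<longleftrightarrow>
       (\<exists>s\<in>{1, -1}. local_change [plain_strand] [kink_strand s] virtual_kink D D')"
  | "directed_move VRII D D' \<longleftrightarrow>
       local_change [plain_strand, chord_strand] [plain_strand, pushed_chord_strand]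
          (crosses_as (\<lambda>i j. False) 2) D D'"
  | "directed_move VRIII D D' \<longleftrightarrow>
       local_change (triple_picture 1) (triple_picture (-1)) (crosses_as (\<lambda>i j. False) 3) D D'"
  | "directed_move VRIV D D' \<longleftrightarrow>
       (\<exists>m<2. local_change (triple_picture 1) (triple_picture (-1))
          (crosses_as (\<lambda>i j. i = m \<and> j = 1 - m) 3) D D')"

definition reidemeister_move :: "move \<Rightarrow> vdiagram \<Rightarrow> vdiagram \<Rightarrow> bool"
  where "reidemeister_move m D D' \<longleftrightarrow> directed_move m D D' \<or> directed_move m D' D"

text \<open>
  \<open>move_sequence ms D D'\<close>: the moves \<open>ms\<close>, performed in this order and with plane isotopies in
  between, lead from \<open>D\<close> to \<open>D'\<close>.
\<close>

inductive move_sequence :: "move list \<Rightarrow> vdiagram \<Rightarrow> vdiagram \<Rightarrow> bool"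
  where
    Nil: "isotopic D D' \<Longrightarrow> move_sequence [] D D'"
  | Cons: "isotopic D E \<Longrightarrow> reidemeister_move m E F \<Longrightarrow> move_sequence ms F D' \<Longrightarrow>
      move_sequence (m # ms) D D'"

definition same_virtual_knot :: "vdiagram \<Rightarrow> vdiagram \<Rightarrow> bool"
  where "same_virtual_knot D D' \<longleftrightarrow> (\<exists>ms. move_sequence ms D D')"


section \<open>Up-down colorings and cocycles\<close>

text \<open>
  Semi-arcs are taken in the parametrising circle: in the plane they may meet each other, and
  themselves, at virtual-crossings.
\<close>

definition semi_arcs :: "vdiagram \<Rightarrow> complex set set"
  where "semi_arcs D = components (circle - (over D \<union> under D))"

definition arc_before :: "vdiagram \<Rightarrow> complex \<Rightarrow> complex set"
  where "arc_before D z =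
    (THE s. s \<in> semi_arcs D \<and> (\<forall>\<^sub>F \<epsilon> in at_right 0. z * cis (- \<epsilon>) \<in> s))"

definition arc_after :: "vdiagram \<Rightarrow> complex \<Rightarrow> complex set"
  where "arc_after D z =
    (THE s. s \<in> semi_arcs D \<and> (\<forall>\<^sub>F \<epsilon> in at_right 0. z * cis \<epsilon> \<in> s))"

text \<open>\<open>\<int>/n\<int>\<close> is represented by \<open>{0..<n}\<close> with arithmetic modulo \<open>n\<close>.\<close>

definition up_down_colorings :: "nat \<Rightarrow> vdiagram \<Rightarrow> (complex set \<Rightarrow> int) set"
  where "up_down_colorings n D =
    {C \<in> semi_arcs D \<rightarrow>\<^sub>E {0..<int n}.
       \<forall>(p, q) \<in> real_crossings D.
         C (arc_after D q) = (C (arc_before D q) - 1) mod int n \<and>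
         C (arc_after D p) = (C (arc_before D p) + 1) mod int n}"

datatype sign = Pos | Neg

definition up_down_cocycle :: "nat \<Rightarrow> (int \<Rightarrow> int \<Rightarrow> sign \<Rightarrow> 'a::ab_group_add) \<Rightarrow> bool"
  where "up_down_cocycle n f \<longleftrightarrow>
    (let F = (\<lambda>a b \<epsilon>. f (a mod int n) (b mod int n) \<epsilon>) in
      (\<forall>a\<in>{0..<int n}. \<forall>\<epsilon>. F a a \<epsilon> = 0) \<and>
      (\<forall>a\<in>{0..<int n}. \<forall>b\<in>{0..<int n}. \<forall>c\<in>{0..<int n}.
        F (a-1) b Neg + F (b+1) (c+1) Pos + F (a-1) (c+2) Pos
          = F (a-2) (b-1) Neg + F b (c+2) Pos + F a (c+1) Pos \<and>
        F (a-1) b Neg + F b (c+1) Neg + F (a-2) c Neg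
          = F (a-2) (b-1) Neg + F (b-1) c Neg + F (a-1) (c+1) Neg \<and>
        F (a-1) (b+1) Pos + F (b+1) (c+1) Pos + F (a-1) (c+1) Neg
          = F a b Pos + F b (c+2) Pos + F (a-2) c Neg \<and>
        F (a-1) (b+1) Pos + F b (c+1) Neg + F a (c+1) Pos
          = F a b Pos + F (b-1) c Neg + F (a-1) (c+2) Pos \<and>
        F a (b+1) Pos + F (b+1) (c+2) Pos + F (a-1) (c+1) Pos
          = F (a-1) b Pos + F b (c+1) Pos + F a (c+2) Pos \<and>
        F a (b+1) Pos + F b c Neg + F (a-2) (c+1) Neg
          = F (a-1) b Pos + F (b-1) (c+1) Neg + F (a-1) c Neg \<and>
        F (a-2) b Neg + F (b+1) (c+2) Pos + F (a-1) c Neg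
          = F (a-1) (b-1) Neg + F b (c+1) Pos + F (a-2) (c+1) Neg \<and>
        F (a-2) b Neg + F b c Neg + F a (c+2) Pos
          = F (a-1) (b-1) Neg + F (b-1) (c+1) Neg + F (a-1) (c+1) Pos))"

definition weight ::
    "(int \<Rightarrow> int \<Rightarrow> sign \<Rightarrow> 'a::ab_group_add) \<Rightarrow> vdiagram \<Rightarrow> (complex set \<Rightarrow> int) \<Rightarrow>
     complex \<times> complex \<Rightarrow> 'a"
  where "weight f D C c =
    (if positive_crossing D c
     then f (C (arc_before D (snd c))) (C (arc_after D (fst c))) Pos
     else f (C (arc_after D (snd c))) (C (arc_before D (fst c))) Neg)"

definition total_weight ::
    "(int \<Rightarrow> int \<Rightarrow> sign \<Rightarrow> 'a::ab_group_add) \<Rightarrow> vdiagram \<Rightarrow> (complex set \<Rightarrow> int) \<Rightarrow> 'a"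
  where "total_weight f D C = (\<Sum>c\<in>real_crossings D. weight f D C c)"

definition Phi ::
    "nat \<Rightarrow> (int \<Rightarrow> int \<Rightarrow> sign \<Rightarrow> 'a::ab_group_add) \<Rightarrow> vdiagram \<Rightarrow> 'a multiset"
  where "Phi n f D = image_mset (total_weight f D) (mset_set (up_down_colorings n D))"

end

theory Submission
  imports Defs
begin

text \<open>
  Along the parametrising circle a coloring rises by one at every over-parameter and falls by one at
  every under-parameter.  Over- and under-parameters are equally many, so an integral level function
  with these jumps exists and is unique up to a constant, and the colorings are exactly its \<open>n\<close>
  translates modulo \<open>n\<close>.  A move that changes neither the total jump along each strand in the disk nor
  the crossings outside leaves the levels outside the disk unchanged, so only the weights inside
  matter.  A kink contributes \<open>f x x \<epsilon> = 0\<close>; virtual crossings contribute nothing; and for the third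
  move the two sums of three weights are the two sides of one of the eight cocycle equations.
\<close>

section \<open>Levels along the curve\<close>

text \<open>Type II is the one move out of reach: both of its real crossings have the same strand on
  top, so one strand gains a net jump of 2 and the other of -2, and the levels outside the disk
  shift against each other. In every other move the two pictures have the same net jump on each
  strand: the two passages of a real kink cancel, and in a triple picture any two strands meet
  exactly once before and once after.

  The obstacle is that diagrams are differentiable curves and a move is given by pictures traversed
  at unknown speed, whereas weights need finite data: the order of the crossings on a strand and the
  sign of each. Order is read off the parameters of the picture, because a traversal is monotone.
  Sign is read off the velocities of the picture, because a traversal scales tangents by factors of
  known sign; an isotopy multiplies the determinant of two tangents by a positive number. Arcs of
  the circle are handled by real angles in windows of length at most \<open>2 * pi\<close>.\<close>

lemma cis_add_2pi [simp]: "cis (t + 2 * pi) = cis t"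
  by (simp flip: cis_mult)

lemma cis_eq_iff: "cis s = cis t \<longleftrightarrow> (\<exists>m::int. s = t + 2 * pi * of_int m)"
proof -
  have "cis s = cis t \<longleftrightarrow> sin s = sin t \<and> cos s = cos t"
    by (auto simp: complex_eq_iff)
  then show ?thesis
    by (simp add: sin_cos_eq_iff mult.commute mult.left_commute)
qed

lemma cis_add_2pi_int [simp]: "cis (t + 2 * pi * of_int m) = cis t"
  using cis_eq_iff by blast

lemma cis_inj_window:
  assumes "cis s = cis t" "\<bar>s - t\<bar> < 2 * pi"
  shows "s = t"
proof -
  obtain m :: int where m: "s = t + 2 * pi * of_int m"
    using assms(1) cis_eq_iff by blast
  then have "2 * pi * \<bar>of_int m\<bar> < 2 * pi * (1::real)"
    using assms(2) by (simp add: abs_mult)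
  then have "\<bar>of_int m\<bar> < (1::real)"
    by (subst (asm) mult_less_cancel_left_pos) auto
  then have "m = 0"
    by linarith
  then show ?thesis
    using m by simp
qed

lemma inj_on_cis_window: "t \<le> s + 2 * pi \<Longrightarrow> inj_on cis {s..<t}"
  by (intro inj_onI cis_inj_window) auto

text \<open>The window may start at any angle \<open>s\<close>: later arcs begin at the entry angle
  of a strand or just short of a given point, and no fixed base point then cuts them.\<close>

lemma circle_lift:
  assumes "z \<in> circle"
  obtains t where "s \<le> t" "t < s + 2 * pi" "z = cis t"
proof -
  obtain r where r: "z = cis r"
    using assms by (metis cis_Arg dist_0_norm mem_sphere norm_eq_zero sgn_eq zero_neq_one div_by_1 of_real_1)
  define m where "m = \<lfloor>(r - s) / (2 * pi)\<rfloor>"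
  have "of_int m \<le> (r - s) / (2 * pi)" "(r - s) / (2 * pi) < of_int m + 1"
    unfolding m_def by linarith+
  then have "2 * pi * of_int m \<le> r - s" "r - s < 2 * pi * (of_int m + 1)"
    by (auto simp: field_simps)
  moreover have "cis (r + 2 * pi * of_int (- m)) = z"
    unfolding r by (rule cis_add_2pi_int)
  ultimately show ?thesis
    by (intro that[of "r + 2 * pi * of_int (- m)"]) (auto simp: algebra_simps)
qed

section \<open>Jumps at the crossing parameters and their sums\<close>

definition crossing_params :: "vdiagram \<Rightarrow> complex set"
  where "crossing_params D = over D \<union> under D"

definition jump :: "vdiagram \<Rightarrow> complex \<Rightarrow> int"
  where "jump D z = (if z \<in> over D then 1 else 0) - (if z \<in> under D then 1 else 0)"

text \<open>Formed over arbitrary sets and not only arcs, so that an arc can be cut into its part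
  outside the disk and its pieces on the single strands.\<close>

definition rise :: "vdiagram \<Rightarrow> complex set \<Rightarrow> int"
  where "rise D A = sum (jump D) (crossing_params D \<inter> A)"

text \<open>
  A level is an integral lift of an up-down coloring: \<open>g z\<close> is the color of the semi-arc that ends at
  \<open>z\<close>, so that the jump at a crossing parameter \<open>z\<close> takes effect only behind \<open>z\<close>.
\<close>

definition level :: "vdiagram \<Rightarrow> (complex \<Rightarrow> int) \<Rightarrow> bool"
  where "level D g \<longleftrightarrow>
    (\<forall>s t. s \<le> t \<longrightarrow> t \<le> s + 2 * pi \<longrightarrow> g (cis t) = g (cis s) + rise D (cis ` {s..<t}))"

lemma levelD:
  "level D g \<Longrightarrow> s \<le> t \<Longrightarrow> t \<le> s + 2 * pi \<Longrightarrow> g (cis t) = g (cis s) + rise D (cis ` {s..<t})"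
  unfolding level_def by blast

lemma jump_notin: "z \<notin> crossing_params D \<Longrightarrow> jump D z = 0"
  by (auto simp: jump_def crossing_params_def)

lemma rise_empty: "crossing_params D \<inter> A = {} \<Longrightarrow> rise D A = 0"
  by (simp add: rise_def)

lemma rise_Un:
  "finite (crossing_params D) \<Longrightarrow> A \<inter> B = {} \<Longrightarrow> rise D (A \<union> B) = rise D A + rise D B"
  unfolding rise_def Int_Un_distrib by (intro sum.union_disjoint) auto

section \<open>Real crossings as a perfect matching of over- and under-parameters\<close>

context
  fixes D
  assumes D: "virtual_knot_diagram D"
begin

lemma finite_crossing_params: "finite (crossing_params D)"
  using D finite_subset unfolding virtual_knot_diagram_def crossing_params_def by blast

lemma crossing_params_double: "crossing_params D \<subseteq> double_params D"
  using D unfolding virtual_knot_diagram_def crossing_params_def by blast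

lemma crossing_params_circle: "crossing_params D \<subseteq> circle"
  using crossing_params_double unfolding double_params_def by blast

lemma over_under_disjoint: "z \<in> over D \<Longrightarrow> z \<in> under D \<Longrightarrow> False"
  using D unfolding virtual_knot_diagram_def by blast

lemma crossing_iff:
  assumes "z \<in> circle" "w \<in> circle" "z \<noteq> w" "curve D z = curve D w"
  shows "z \<in> over D \<longleftrightarrow> w \<in> under D"
  using D assms unfolding virtual_knot_diagram_def by blast

lemma no_triple_points:
  assumes "x \<in> circle" "y \<in> circle" "z \<in> circle" "curve D x = curve D y" "curve D y = curve D z"
  shows "x = y \<or> y = z \<or> x = z"
  using D assms unfolding virtual_knot_diagram_def by blast

lemma crossing_partner:
  assumes "z \<in> crossing_params D"
  obtains w where "w \<in> circle" "w \<noteq> z" "curve D w = curve D z"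
  using assms crossing_params_double unfolding double_params_def by blast

lemma real_crossingD:
  assumes "(p, q) \<in> real_crossings D"
  shows "p \<in> over D" "q \<in> under D" "p \<in> circle" "q \<in> circle" "p \<noteq> q" "curve D p = curve D q"
  using assms crossing_params_circle over_under_disjoint
  unfolding real_crossings_def crossing_params_def by blast+

text \<open>Two different crossings with a common over-parameter would put three parameters over one
  point of the plane.\<close>

lemma inj_on_fst_crossings: "inj_on fst (real_crossings D)"
proof (rule inj_onI)
  fix x y assume x: "x \<in> real_crossings D" and y: "y \<in> real_crossings D" and e: "fst x = fst y"
  obtain p q q' where pq: "x = (p, q)" "y = (p, q')"
    using e by (metis prod.collapse)
  show "x = y"
    using no_triple_points[of q p q'] real_crossingD[of p q] real_crossingD[of p q'] x y pq by metis
qed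

lemma inj_on_snd_crossings: "inj_on snd (real_crossings D)"
proof (rule inj_onI)
  fix x y assume x: "x \<in> real_crossings D" and y: "y \<in> real_crossings D" and e: "snd x = snd y"
  obtain p q p' where pq: "x = (p, q)" "y = (p', q)"
    using e by (metis prod.collapse)
  show "x = y"
    using no_triple_points[of p q p'] real_crossingD[of p q] real_crossingD[of p' q] x y pq by metis
qed

lemma fst_crossings: "fst ` real_crossings D = over D"
proof
  show "over D \<subseteq> fst ` real_crossings D"
  proof
    fix p assume p: "p \<in> over D"
    then obtain q where q: "q \<in> circle" "q \<noteq> p" "curve D q = curve D p"
      using crossing_partner unfolding crossing_params_def by blast
    moreover have "p \<in> circle"
      using p crossing_params_circle crossing_params_def by blast
    ultimately have "(p, q) \<in> real_crossings D"
      using p crossing_iff[of p q] by (auto simp: real_crossings_def)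
    then show "p \<in> fst ` real_crossings D"
      by force
  qed
qed (auto simp: real_crossings_def)

lemma snd_crossings: "snd ` real_crossings D = under D"
proof
  show "under D \<subseteq> snd ` real_crossings D"
  proof
    fix p assume p: "p \<in> under D"
    then obtain q where q: "q \<in> circle" "q \<noteq> p" "curve D q = curve D p"
      using crossing_partner unfolding crossing_params_def by blast
    moreover have "p \<in> circle"
      using p crossing_params_circle crossing_params_def by blast
    ultimately have "(q, p) \<in> real_crossings D"
      using p crossing_iff[of q p] by (auto simp: real_crossings_def)
    then show "p \<in> snd ` real_crossings D"
      by force
  qed
qed (auto simp: real_crossings_def)

lemma finite_real_crossings: "finite (real_crossings D)"
  using finite_crossing_params fst_crossings inj_on_fst_crossings
  by (metis crossing_params_def finite_Un finite_imageD)

text \<open>Both projections of the set of crossings are injective, with images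
  \<open>over D\<close> and \<open>under D\<close>, so the jumps 1 and -1 balance. This is what lets
  a level close up after a full turn.\<close>

lemma rise_UNIV: "rise D UNIV = 0"
proof -
  have fin: "finite (over D)" "finite (under D)"
    using finite_crossing_params by (auto simp: crossing_params_def)
  have "sum (jump D) (over D \<union> under D) = sum (jump D) (over D) + sum (jump D) (under D)"
    using fin over_under_disjoint by (intro sum.union_disjoint) auto
  also have "sum (jump D) (over D) = (\<Sum>z\<in>over D. 1)"
    using over_under_disjoint by (intro sum.cong) (auto simp: jump_def)
  also have "sum (jump D) (under D) = (\<Sum>z\<in>under D. - 1)"
    using over_under_disjoint by (intro sum.cong) (auto simp: jump_def)
  finally show ?thesis
    using fst_crossings snd_crossings card_image[OF inj_on_fst_crossings] card_image[OF inj_on_snd_crossings]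
    by (simp add: rise_def crossing_params_def)
qed

lemma rise_full_turn: "rise D (cis ` {s..<s + 2 * pi}) = 0"
proof -
  have "crossing_params D \<inter> cis ` {s..<s + 2 * pi} = crossing_params D \<inter> UNIV"
  proof -
    have "z \<in> cis ` {s..<s + 2 * pi}" if "z \<in> crossing_params D" for z
      using circle_lift[of z s] that crossing_params_circle by (metis atLeastLessThan_iff image_eqI subsetD)
    then show ?thesis
      by blast
  qed
  then show ?thesis
    using rise_UNIV by (simp add: rise_def)
qed

lemma rise_split:
  assumes "r \<le> s" "s \<le> t" "t \<le> r + 2 * pi"
  shows "rise D (cis ` {r..<t}) = rise D (cis ` {r..<s}) + rise D (cis ` {s..<t})"
proof -
  have "inj_on cis {r..<t}"
    using assms inj_on_cis_window by blast
  then have "cis ` {r..<s} \<inter> cis ` {s..<t} = cis ` ({r..<s} \<inter> {s..<t})"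
    using assms by (intro inj_on_image_Int[symmetric, of cis "{r..<t}"]) auto
  then have "cis ` {r..<s} \<inter> cis ` {s..<t} = {}"
    by auto
  moreover have "{r..<t} = {r..<s} \<union> {s..<t}"
    using assms by auto
  ultimately show ?thesis
    by (simp add: image_Un rise_Un finite_crossing_params)
qed

lemma rise_shift: "rise D (cis ` {s + 2 * pi * of_int m..<t + 2 * pi * of_int m}) = rise D (cis ` {s..<t})"
proof -
  have "{s + 2 * pi * of_int m..<t + 2 * pi * of_int m} = (\<lambda>x. x + 2 * pi * of_int m) ` {s..<t}"
    by (simp add: image_add_atLeastLessThan')
  then have "cis ` {s + 2 * pi * of_int m..<t + 2 * pi * of_int m} = cis ` {s..<t}"
    by (simp only: image_image cis_add_2pi_int)
  then show ?thesis
    by simp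
qed

text \<open>The level of a point is taken to be the rise from angle 0 to its representative in
  \<open>[0, 2 * pi)\<close>. Only arcs that run past angle 0 need an argument, and there the
  vanishing rise of a full turn makes up the difference.\<close>

lemma level_exists: "\<exists>g. level D g"
proof -
  define l where "l z = (SOME t. 0 \<le> t \<and> t < 2 * pi \<and> z = cis t)" for z
  define g where "g z = rise D (cis ` {0..<l z})" for z
  have l: "l (cis t) = t" if "0 \<le> t" "t < 2 * pi" for t
  proof -
    have "0 \<le> l (cis t) \<and> l (cis t) < 2 * pi \<and> cis t = cis (l (cis t))"
      unfolding l_def by (rule someI_ex) (use that in blast)
    then show ?thesis
      using cis_inj_window[of "l (cis t)" t] that by auto
  qed
  have gt: "g (cis t) = rise D (cis ` {0..<t})" if "0 \<le> t" "t < 2 * pi" for t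
    using l[OF that] by (simp add: g_def)
  have main: "g (cis t) = g (cis s) + rise D (cis ` {s..<t})"
    if s: "0 \<le> s" "s < 2 * pi" and t: "s \<le> t" "t \<le> s + 2 * pi" for s t
  proof (cases "t < 2 * pi")
    case True
    then show ?thesis
      using rise_split[of 0 s t] gt[of s] gt[of t] s t by simp
  next
    case False
    \<comment> \<open>The arc passes the angle \<open>2 * pi\<close>. Its part beyond is moved back
      by one turn; its part before has minus the rise from 0 to \<open>s\<close>.\<close>
    have "g (cis t) = g (cis (t - 2 * pi))"
      using cis_add_2pi[of "t - 2 * pi"] by simp
    also have "\<dots> = rise D (cis ` {0..<t - 2 * pi})"
      using gt[of "t - 2 * pi"] False s t by simp
    also have "\<dots> = rise D (cis ` {2 * pi..<t})"
      using rise_shift[of 0 1 "t - 2 * pi"] by simp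
    finally have "g (cis t) = rise D (cis ` {2 * pi..<t})" .
    moreover have "rise D (cis ` {s..<t}) = rise D (cis ` {s..<2 * pi}) + rise D (cis ` {2 * pi..<t})"
      using rise_split[of s "2 * pi" t] s t False by simp
    moreover have "0 = rise D (cis ` {0..<s}) + rise D (cis ` {s..<2 * pi})"
      using rise_split[of 0 s "2 * pi"] rise_full_turn[of 0] s by simp
    ultimately show ?thesis
      using gt[of s] s by simp
  qed
  have "g (cis t) = g (cis s) + rise D (cis ` {s..<t})" if st: "s \<le> t" "t \<le> s + 2 * pi" for s t
  proof -
    obtain r where r: "0 \<le> r" "r < 0 + 2 * pi" "cis s = cis r"
      using circle_lift[of "cis s" 0] by auto
    then obtain m :: int where m: "r = s + 2 * pi * of_int m"
      using cis_eq_iff by metis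
    \<comment> \<open>Both angles are moved by the same number of turns, chosen such that the first
      lands in \<open>[0, 2 * pi)\<close>.\<close>
    have "g (cis (t + 2 * pi * of_int m)) = g (cis r) + rise D (cis ` {r..<t + 2 * pi * of_int m})"
      using r m st by (intro main) auto
    then show ?thesis
      unfolding m rise_shift cis_add_2pi_int .
  qed
  then show ?thesis
    unfolding level_def by blast
qed

end

lemma level_add_const: "level D g \<Longrightarrow> level D (\<lambda>z. g z + c)"
  by (auto simp: level_def)


section \<open>Colorings as state sums\<close>

text \<open>The over-strand leaves a crossing one level higher and the under-strand one level lower
  than it arrives. Expressed by levels of arrival, the outgoing over-color is thus
  \<open>g (fst c) + 1\<close> and the outgoing under-color \<open>g (snd c) - 1\<close>.\<close>

definition crossing_weight ::
    "nat \<Rightarrow> (int \<Rightarrow> int \<Rightarrow> sign \<Rightarrow> 'a::ab_group_add) \<Rightarrow> vdiagram \<Rightarrow> (complex \<Rightarrow> int) \<Rightarrow>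
     complex \<times> complex \<Rightarrow> 'a"
  where "crossing_weight n f D g c =
    (if positive_crossing D c
     then f (g (snd c) mod int n) ((g (fst c) + 1) mod int n) Pos
     else f ((g (snd c) - 1) mod int n) (g (fst c) mod int n) Neg)"

definition state_sum ::
    "nat \<Rightarrow> (int \<Rightarrow> int \<Rightarrow> sign \<Rightarrow> 'a::ab_group_add) \<Rightarrow> vdiagram \<Rightarrow> (complex \<Rightarrow> int) \<Rightarrow> 'a"
  where "state_sum n f D g = (\<Sum>c\<in>real_crossings D. crossing_weight n f D g c)"

section \<open>Semi-arcs just before and just behind a parameter\<close>

abbreviation arc_of :: "vdiagram \<Rightarrow> complex \<Rightarrow> complex set"
  where "arc_of D \<equiv> connected_component_set (circle - crossing_params D)"

lemma semi_arcs_def': "semi_arcs D = components (circle - crossing_params D)"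
  by (simp add: semi_arcs_def crossing_params_def)

lemma arc_of_const:
  assumes "s \<le> t" "\<And>r. s \<le> r \<Longrightarrow> r \<le> t \<Longrightarrow> cis r \<notin> crossing_params D"
  shows "arc_of D (cis s) = arc_of D (cis t)"
proof (rule connected_component_eq, unfold mem_Collect_eq connected_component_def, intro exI conjI)
  show "connected (cis ` {s..t})"
    by (intro connected_continuous_image continuous_intros) auto
qed (use assms in auto)

text \<open>Uniqueness for the definite descriptions in \<open>arc_before\<close> and
  \<open>arc_after\<close>: two eventual properties hold at a common point, and distinct components
  are disjoint.\<close>

lemma eventually_arc_unique:
  assumes "A \<in> semi_arcs D" "B \<in> semi_arcs D"
    and "\<forall>\<^sub>F e in at_right (0::real). f e \<in> A" "\<forall>\<^sub>F e in at_right (0::real). f e \<in> B"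
  shows "A = B"
proof -
  have "\<forall>\<^sub>F e in at_right (0::real). f e \<in> A \<and> f e \<in> B"
    using assms(3,4) by eventually_elim simp
  then obtain e where "f e \<in> A" "f e \<in> B"
    using eventually_happens'[OF trivial_limit_at_right_real] by blast
  then show ?thesis
    using components_nonoverlap[of A _ B] assms(1,2) unfolding semi_arcs_def' by blast
qed

lemma arc_before_cis:
  assumes "s < t" "\<And>r. s \<le> r \<Longrightarrow> r < t \<Longrightarrow> cis r \<notin> crossing_params D"
  shows "arc_before D (cis t) = arc_of D (cis s)"
proof -
  have A: "arc_of D (cis s) \<in> semi_arcs D"
    using assms unfolding semi_arcs_def' by (auto intro!: componentsI)
  have "\<forall>\<^sub>F e in at_right 0. cis t * cis (- e) \<in> arc_of D (cis s)"
    unfolding eventually_at_right_field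
  proof (intro exI[of _ "t - s"] conjI allI impI)
    fix e assume e: "0 < e" "e < t - s"
    have "arc_of D (cis s) = arc_of D (cis (t - e))"
      using assms e by (intro arc_of_const) auto
    moreover have "cis (t - e) \<in> arc_of D (cis (t - e))"
      using assms e by auto
    ultimately show "cis t * cis (- e) \<in> arc_of D (cis s)"
      by (simp add: cis_mult)
  qed (use assms in auto)
  with A show ?thesis
    unfolding arc_before_def
    by - (rule the_equality, (rule conjI | assumption | erule conjE eventually_arc_unique)+)
qed

lemma arc_after_cis:
  assumes "t < s" "\<And>r. t < r \<Longrightarrow> r \<le> s \<Longrightarrow> cis r \<notin> crossing_params D"
  shows "arc_after D (cis t) = arc_of D (cis s)"
proof -
  have A: "arc_of D (cis s) \<in> semi_arcs D"
    using assms unfolding semi_arcs_def' by (auto intro!: componentsI)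
  have "\<forall>\<^sub>F e in at_right 0. cis t * cis e \<in> arc_of D (cis s)"
    unfolding eventually_at_right_field
  proof (intro exI[of _ "s - t"] conjI allI impI)
    fix e assume e: "0 < e" "e < s - t"
    have "arc_of D (cis (t + e)) = arc_of D (cis s)"
      using assms e by (intro arc_of_const) auto
    moreover have "cis (t + e) \<in> arc_of D (cis (t + e))"
      using assms e by auto
    ultimately show "cis t * cis e \<in> arc_of D (cis s)"
      by (simp add: cis_mult)
  qed (use assms in auto)
  with A show ?thesis
    unfolding arc_after_def
    by - (rule the_equality, (rule conjI | assumption | erule conjE eventually_arc_unique)+)
qed

text \<open>The end \<open>t\<close> may itself be a crossing parameter, since its jump counts only
  behind it. A crossing parameter at the start is the case of \<open>level_after\<close>.\<close>

lemma level_before: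
  assumes "level D g" "s \<le> t" "t \<le> s + 2 * pi"
    and "\<And>r. s \<le> r \<Longrightarrow> r < t \<Longrightarrow> cis r \<notin> crossing_params D"
  shows "g (cis t) = g (cis s)"
proof -
  have "crossing_params D \<inter> cis ` {s..<t} = {}"
    using assms(4) by auto
  then show ?thesis
    using levelD[OF assms(1-3)] by (simp add: rise_empty)
qed

lemma level_after:
  assumes "level D g" "s < t" "t \<le> s + 2 * pi"
    and "\<And>r. s < r \<Longrightarrow> r < t \<Longrightarrow> cis r \<notin> crossing_params D"
  shows "g (cis t) = g (cis s) + jump D (cis s)"
proof -
  have "{s..<t} = insert s {s<..<t}"
    using assms(2) by auto
  then have "crossing_params D \<inter> cis ` {s..<t} = crossing_params D \<inter> {cis s}"
    using assms(4) by auto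
  then have "rise D (cis ` {s..<t}) = jump D (cis s)"
    using jump_notin by (cases "cis s \<in> crossing_params D") (auto simp: rise_def)
  then show ?thesis
    using levelD[OF assms(1) _ assms(3)] assms(2) by simp
qed

context
  fixes D
  assumes D: "virtual_knot_diagram D"
begin

text \<open>The bound \<open>e < 1\<close> keeps the angles around \<open>t\<close> within one turn,
  where \<open>cis\<close> is injective and the level equation applies.\<close>

lemma isolated_crossing_params:
  obtains e where "0 < e" "e < 1" "\<And>s. s \<noteq> t \<Longrightarrow> \<bar>s - t\<bar> < e \<Longrightarrow> cis s \<notin> crossing_params D"
proof -
  have "inj_on cis {t - 1..<t + 1}"
    using pi_gt3 by (intro inj_on_cis_window) auto
  then have "finite (cis -` crossing_params D \<inter> {t - 1..<t + 1})"
    using finite_crossing_params[OF D] by (rule finite_vimage_IntI[rotated])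
  then obtain d where d: "d > 0"
    "\<And>s. s \<in> cis -` crossing_params D \<inter> {t - 1..<t + 1} \<Longrightarrow> s \<noteq> t \<Longrightarrow> d \<le> dist t s"
    using finite_set_avoid by metis
  show ?thesis
  proof (rule that[of "min d (1/2)"])
    fix s assume s: "s \<noteq> t" "\<bar>s - t\<bar> < min d (1/2)"
    then have "s \<in> {t - 1..<t + 1}" "dist t s < d"
      unfolding min_less_iff_conj atLeastLessThan_iff dist_real_def by linarith+
    then show "cis s \<notin> crossing_params D"
      using d(2)[of s] s by auto
  qed (use d in auto)
qed

text \<open>A level is locally constant away from the crossing parameters, and a semi-arc is
  connected.\<close>

lemma level_const_on_arc:
  assumes g: "level D g" and A: "A \<in> semi_arcs D" "z \<in> A" "w \<in> A"
  shows "g z = g w"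
proof -
  have sub: "A \<subseteq> circle - crossing_params D" and conn: "connected A"
    using A in_components_subset in_components_connected unfolding semi_arcs_def' by blast+
  have "g constant_on A"
  proof (rule locally_constant_imp_constant[OF conn])
    fix z assume z: "z \<in> A"
    then obtain t where t: "z = cis t" "cis t \<notin> crossing_params D"
      using sub circle_lift[of z 0] by blast
    obtain e where e: "0 < e" "e < 1"
      "\<And>s. s \<noteq> t \<Longrightarrow> \<bar>s - t\<bar> < e \<Longrightarrow> cis s \<notin> crossing_params D"
      using isolated_crossing_params[of t] by blast
    then have e': "cis s \<notin> crossing_params D" if "\<bar>s - t\<bar> < e" for s
      using t that by (cases "s = t") auto
    \<comment> \<open>The neighborhood of \<open>z\<close> is the complement of the compact arc
      \<open>F\<close> of the angles at distance at least \<open>e / 2\<close> from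
      \<open>t\<close>. Compactness of \<open>F\<close> replaces an argument that short arcs are
      open in the circle.\<close>
    define F where "F = cis ` {t + e / 2..t + 2 * pi - e / 2}"
    have "closed F"
      unfolding F_def
      by (intro compact_imp_closed compact_continuous_image continuous_intros) auto
    moreover have "z \<notin> F"
    proof
      assume "z \<in> F"
      then obtain s where s: "cis s = cis t" "t + e / 2 \<le> s" "s \<le> t + 2 * pi - e / 2"
        using t by (auto simp: F_def)
      then show False
        using cis_inj_window[of s t] e by auto
    qed
    moreover have "\<forall>w\<in>A \<inter> - F. g w = g z"
    proof
      fix w assume w: "w \<in> A \<inter> - F"
      obtain s where s: "t - e / 2 \<le> s" "s < t - e / 2 + 2 * pi" "w = cis s"
        using circle_lift[of w "t - e / 2"] w sub by blast
      have "s < t + e / 2"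
        using w s by (force simp: F_def)
      then show "g w = g z"
        using level_before[OF g, of s t] level_before[OF g, of t s] e' s t e pi_gt3
        by (cases "s \<le> t") auto
    qed
    ultimately show "\<exists>T. openin (top_of_set A) T \<and> z \<in> T \<and> (\<forall>w\<in>T. g w = g z)"
      using z openin_open_Int by blast
  qed
  then show ?thesis
    using A(2,3) unfolding constant_on_def by metis
qed

lemma level_arc_before:
  assumes g: "level D g" and z: "z \<in> circle"
  obtains w where "w \<in> arc_before D z" "arc_before D z \<in> semi_arcs D" "g w = g z"
proof -
  obtain t where t: "z = cis t"
    using z circle_lift[of z 0] by blast
  obtain e where e: "0 < e" "e < 1"
    "\<And>s. s \<noteq> t \<Longrightarrow> \<bar>s - t\<bar> < e \<Longrightarrow> cis s \<notin> crossing_params D"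
    using isolated_crossing_params[of t] by blast
  have "arc_before D z = arc_of D (cis (t - e / 2))"
    unfolding t using e by (intro arc_before_cis) auto
  moreover have "g (cis t) = g (cis (t - e / 2))"
    using e pi_gt3 by (intro level_before[OF g]) auto
  moreover have "cis (t - e / 2) \<in> circle - crossing_params D"
    using e by simp
  ultimately show ?thesis
    using that[of "cis (t - e / 2)"] t by (auto simp: semi_arcs_def' componentsI)
qed

lemma level_arc_after:
  assumes g: "level D g" and z: "z \<in> circle"
  obtains w where "w \<in> arc_after D z" "arc_after D z \<in> semi_arcs D" "g w = g z + jump D z"
proof -
  obtain t where t: "z = cis t"
    using z circle_lift[of z 0] by blast
  obtain e where e: "0 < e" "e < 1"
    "\<And>s. s \<noteq> t \<Longrightarrow> \<bar>s - t\<bar> < e \<Longrightarrow> cis s \<notin> crossing_params D"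
    using isolated_crossing_params[of t] by blast
  have "arc_after D z = arc_of D (cis (t + e / 2))"
    unfolding t using e by (intro arc_after_cis) auto
  moreover have "g (cis (t + e / 2)) = g (cis t) + jump D (cis t)"
    using e pi_gt3 by (intro level_after[OF g]) auto
  moreover have "cis (t + e / 2) \<in> circle - crossing_params D"
    using e by simp
  ultimately show ?thesis
    using that[of "cis (t + e / 2)"] t by (auto simp: semi_arcs_def' componentsI)
qed

lemma arc_before_self:
  assumes "A \<in> semi_arcs D" "z \<in> A"
  shows "arc_before D z = A"
proof -
  have sub: "A \<subseteq> circle - crossing_params D"
    using assms in_components_subset unfolding semi_arcs_def' by blast
  obtain t where t: "z = cis t"
    using assms sub circle_lift[of z 0] by blast
  obtain e where e: "0 < e" "e < 1"
    "\<And>s. s \<noteq> t \<Longrightarrow> \<bar>s - t\<bar> < e \<Longrightarrow> cis s \<notin> crossing_params D"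
    using isolated_crossing_params[of t] by blast
  have e': "cis s \<notin> crossing_params D" if "\<bar>s - t\<bar> < e" for s
    using t that sub assms e by (cases "s = t") auto
  have "arc_before D z = arc_of D (cis (t - e / 2))"
    unfolding t using e by (intro arc_before_cis) auto
  also have "\<dots> = arc_of D (cis t)"
    using e e' by (intro arc_of_const) auto
  also have "\<dots> = A"
    using assms t unfolding semi_arcs_def'
    by (metis (no_types, lifting) components_iff connected_component_eq)
  finally show ?thesis .
qed

lemma arc_after_eq_before:
  assumes "z \<in> circle - crossing_params D"
  shows "arc_after D z = arc_before D z"
proof -
  obtain t where t: "z = cis t"
    using assms circle_lift[of z 0] by blast
  obtain e where e: "0 < e" "e < 1"
    "\<And>s. s \<noteq> t \<Longrightarrow> \<bar>s - t\<bar> < e \<Longrightarrow> cis s \<notin> crossing_params D"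
    using isolated_crossing_params[of t] by blast
  have e': "cis s \<notin> crossing_params D" if "\<bar>s - t\<bar> < e" for s
    using t that assms e by (cases "s = t") auto
  have "arc_before D z = arc_of D (cis (t - e / 2))"
    unfolding t using e by (intro arc_before_cis) auto
  also have "\<dots> = arc_of D (cis (t + e / 2))"
    using e e' by (intro arc_of_const) auto
  also have "\<dots> = arc_after D z"
    unfolding t using e by (intro arc_after_cis[symmetric]) auto
  finally show ?thesis ..
qed

text \<open>Brings over-, under- and ordinary parameters under one rule, so that the passage along
  the circle needs no case distinction.\<close>

lemma coloring_jump:
  assumes C: "C \<in> up_down_colorings n D" and z: "z \<in> circle"
  shows "C (arc_after D z) mod int n = (C (arc_before D z) + jump D z) mod int n"
proof -
  consider "z \<in> over D" | "z \<in> under D" | "z \<notin> crossing_params D"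
    by (auto simp: crossing_params_def)
  then show ?thesis
  proof cases
    case 1
    then obtain q where "(z, q) \<in> real_crossings D"
      using fst_crossings[OF D] by force
    then have "C (arc_after D z) = (C (arc_before D z) + 1) mod int n"
      using C unfolding up_down_colorings_def by blast
    moreover have "jump D z = 1"
      using 1 over_under_disjoint[OF D] by (auto simp: jump_def)
    ultimately show ?thesis
      by simp
  next
    case 2
    then obtain p where "(p, z) \<in> real_crossings D"
      using snd_crossings[OF D] by force
    then have "C (arc_after D z) = (C (arc_before D z) - 1) mod int n"
      using C unfolding up_down_colorings_def by blast
    moreover have "jump D z = - 1"
      using 2 over_under_disjoint[OF D] by (auto simp: jump_def)
    ultimately show ?thesis
      by simp
  next
    case 3
    then show ?thesis
      using arc_after_eq_before z by (simp add: jump_notin)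
  qed
qed

text \<open>Color and level have the same jumps modulo \<open>n\<close>, so their difference is
  locally constant along the line of angles and hence a constant \<open>k\<close>.\<close>

lemma coloring_eq_level:
  assumes C: "C \<in> up_down_colorings n D" and g: "level D g" and n: "0 < n"
  obtains k where "k \<in> {0..<int n}" "\<And>A z. A \<in> semi_arcs D \<Longrightarrow> z \<in> A \<Longrightarrow> C A = (k + g z) mod int n"
proof -
  \<comment> \<open>The semi-arc before a parameter makes sense at crossing parameters too, so
    \<open>h\<close> lives on the whole real line, which is connected.\<close>
  define h where "h t = (C (arc_before D (cis t)) - g (cis t)) mod int n" for t
  have "h constant_on UNIV"
  proof (rule locally_constant_imp_constant[OF connected_UNIV])
    fix t :: real
    obtain e where e: "0 < e" "e < 1"
      "\<And>s. s \<noteq> t \<Longrightarrow> \<bar>s - t\<bar> < e \<Longrightarrow> cis s \<notin> crossing_params D"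
      using isolated_crossing_params[of t] by blast
    have h: "h s = h t" if s: "s \<in> {t - e / 2<..<t + e / 2}" for s
    proof (cases "s \<le> t")
      case True
      have "arc_before D (cis s) = arc_of D (cis (t - e / 2))"
        using e s True by (intro arc_before_cis) auto
      moreover have "arc_before D (cis t) = arc_of D (cis (t - e / 2))"
        using e s True by (intro arc_before_cis) auto
      moreover have "g (cis t) = g (cis s)"
        using e s True pi_gt3 by (intro level_before[OF g]) auto
      ultimately show ?thesis
        by (simp add: h_def)
    next
      case False
      \<comment> \<open>The midpoint of \<open>t\<close> and \<open>s\<close> lies on the semi-arc
        that is behind \<open>t\<close> and before \<open>s\<close>.\<close>
      have "arc_before D (cis s) = arc_of D (cis ((s + t) / 2))"
        using e s False by (intro arc_before_cis) auto
      moreover have "arc_after D (cis t) = arc_of D (cis ((s + t) / 2))"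
        using e s False by (intro arc_after_cis) auto
      moreover have "g (cis s) = g (cis t) + jump D (cis t)"
        using e s False pi_gt3 by (intro level_after[OF g]) auto
      moreover have "C (arc_after D (cis t)) mod int n =
          (C (arc_before D (cis t)) + jump D (cis t)) mod int n"
        using coloring_jump[OF C] by simp
      ultimately show ?thesis
        unfolding h_def by (metis add_diff_cancel_right mod_diff_left_eq)
    qed
    show "\<exists>T. openin (top_of_set UNIV) T \<and> t \<in> T \<and> (\<forall>s\<in>T. h s = h t)"
    proof (intro exI conjI ballI)
      show "openin (top_of_set UNIV) {t - e / 2<..<t + e / 2}" "t \<in> {t - e / 2<..<t + e / 2}"
        using e by auto
    qed (rule h)
  qed
  then obtain k where k: "\<And>t. h t = k"
    by (auto simp: constant_on_def)
  show ?thesis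
  proof
    show "k \<in> {0..<int n}"
      using n k[of 0] by (auto simp: h_def)
    fix A z assume A: "A \<in> semi_arcs D" "z \<in> A"
    then have "z \<in> circle"
      using in_components_subset unfolding semi_arcs_def' by blast
    then obtain t where t: "z = cis t"
      using circle_lift[of z 0] by blast
    have "(C A - g z) mod int n = k"
      using k[of t] arc_before_self[OF A] t by (simp add: h_def)
    moreover have "C A \<in> {0..<int n}"
      using C A by (auto simp: up_down_colorings_def)
    moreover have "((C A - g z) mod int n + g z) mod int n = C A mod int n"
      by (metis diff_add_cancel mod_add_left_eq)
    ultimately show "C A = (k + g z) mod int n"
      by simp
  qed
qed

text \<open>Distinct residues already give distinct colors to one semi-arc, and every coloring is a
  translate by \<open>coloring_eq_level\<close>. Reindexing the multiset by \<open>k\<close> removes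
  the semi-arcs from all later arguments and leaves only levels.\<close>

lemma Phi_eq_state_sums:
  assumes g: "level D g" and n: "0 < n"
  shows "Phi n f D = image_mset (\<lambda>k. state_sum n f D (\<lambda>z. k + g z)) (mset_set {0..<int n})"
proof -
  \<comment> \<open>Any point of the semi-arc may be chosen, since the level is constant
    there.\<close>
  define E where "E k = restrict (\<lambda>A. (k + g (SOME z. z \<in> A)) mod int n) (semi_arcs D)" for k
  have E: "E k A = (k + g z) mod int n" if "A \<in> semi_arcs D" "z \<in> A" for k A z
  proof -
    have "(SOME z. z \<in> A) \<in> A"
      using that(2) by (rule someI)
    then show ?thesis
      using level_const_on_arc[OF g that(1) _ that(2)] that(1) by (simp add: E_def)
  qed
  have before: "E k (arc_before D z) = (k + g z) mod int n" if "z \<in> circle" for k z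
    using level_arc_before[OF g that] E by metis
  have after: "E k (arc_after D z) = (k + g z + jump D z) mod int n" if "z \<in> circle" for k z
    using level_arc_after[OF g that] E by (metis add.assoc)
  have jumps: "jump D p = 1 \<and> jump D q = - 1" if "(p, q) \<in> real_crossings D" for p q
    using real_crossingD[OF D that] over_under_disjoint[OF D] by (auto simp: jump_def)
  have col: "E k \<in> up_down_colorings n D" for k
    unfolding up_down_colorings_def
  proof (intro CollectI conjI ballI)
    show "E k \<in> semi_arcs D \<rightarrow>\<^sub>E {0..<int n}"
      using n by (auto simp: E_def)
    fix c assume c: "c \<in> real_crossings D"
    obtain p q where pq: "c = (p, q)"
      by (cases c)
    have "p \<in> circle" "q \<in> circle"
      using real_crossingD[OF D] c pq by blast+
    then show "case c of (p, q) \<Rightarrow>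
         E k (arc_after D q) = (E k (arc_before D q) - 1) mod int n \<and>
         E k (arc_after D p) = (E k (arc_before D p) + 1) mod int n"
      using jumps[of p q] c by (simp add: pq before after mod_simps)
  qed
  have surj: "up_down_colorings n D \<subseteq> E ` {0..<int n}"
  proof
    fix C assume C: "C \<in> up_down_colorings n D"
    obtain k where k: "k \<in> {0..<int n}" "\<And>A z. A \<in> semi_arcs D \<Longrightarrow> z \<in> A \<Longrightarrow> C A = (k + g z) mod int n"
      using coloring_eq_level[OF C g n] by blast
    have "C = E k"
    proof (rule extensionalityI[of _ "semi_arcs D"])
      fix A assume A: "A \<in> semi_arcs D"
      then obtain z where "z \<in> A"
        using in_components_nonempty unfolding semi_arcs_def' by blast
      then show "C A = E k A"
        using k E A by simp
    qed (use C in \<open>auto simp: E_def up_down_colorings_def PiE_def\<close>)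
    then show "C \<in> E ` {0..<int n}"
      using k by blast
  qed
  have inj: "inj_on E {0..<int n}"
  proof (rule inj_onI)
    fix k l assume kl: "k \<in> {0..<int n}" "l \<in> {0..<int n}" "E k = E l"
    then have "(k + g (cis 0)) mod int n = (l + g (cis 0)) mod int n"
      using before[of "cis 0"] by (metis dist_0_norm mem_sphere norm_cis)
    then have "k mod int n = l mod int n"
      by (metis add_diff_cancel_right' mod_diff_left_eq)
    then show "k = l"
      using kl by simp
  qed
  have "up_down_colorings n D = E ` {0..<int n}"
    using surj col by blast
  then have "Phi n f D = image_mset (\<lambda>k. total_weight f D (E k)) (mset_set {0..<int n})"
    using image_mset_mset_set[OF inj] by (simp add: Phi_def multiset.map_comp comp_def flip: image_mset_mset_set[OF inj])
  also have "\<dots> = image_mset (\<lambda>k. state_sum n f D (\<lambda>z. k + g z)) (mset_set {0..<int n})"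
  proof (intro image_mset_cong)
    fix k
    have "weight f D (E k) c = crossing_weight n f D (\<lambda>z. k + g z) c" if c: "c \<in> real_crossings D" for c
    proof -
      obtain p q where pq: "c = (p, q)"
        by (cases c)
      then have "p \<in> circle" "q \<in> circle"
        using real_crossingD[OF D] c by blast+
      then show ?thesis
        using jumps[of p q] c by (simp add: pq weight_def crossing_weight_def before after)
    qed
    then show "total_weight f D (E k) = state_sum n f D (\<lambda>z. k + g z)"
      by (simp add: total_weight_def state_sum_def)
  qed
  finally show ?thesis .
qed

end


section \<open>Plane isotopies\<close>

lemma Phi_eqI:
  assumes "virtual_knot_diagram D" "virtual_knot_diagram D'" "level D g" "level D' g'" "0 < n"
    and "\<And>k. state_sum n f D (\<lambda>z. k + g z) = state_sum n f D' (\<lambda>z. k + g' z)"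
  shows "Phi n f D = Phi n f D'"
  using assms by (simp add: Phi_eq_state_sums)

text \<open>\<open>tangent\<close> rotates the circle and then differentiates at angle 0; here this
  becomes an ordinary derivative at the angle \<open>t\<close>.\<close>

lemma tangent_eqI:
  assumes "((\<lambda>s. curve D (cis s)) has_vector_derivative v) (at t)"
  shows "tangent D (cis t) = v"
proof -
  have "((\<lambda>s. curve D (cis (t + s))) has_vector_derivative v) (at 0)"
  proof -
    have "((\<lambda>s. t + s) has_vector_derivative 1) (at 0)"
      by (auto intro!: derivative_eq_intros)
    then show ?thesis
      using vector_diff_chain_at[of "\<lambda>s. t + s" 1 0 "\<lambda>s. curve D (cis s)" v] assms
      by (simp add: comp_def)
  qed
  then show ?thesis
    unfolding tangent_def cis_mult by (rule vector_derivative_at)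
qed

lemma tangent_has_vector_derivative:
  assumes "virtual_knot_diagram D"
  shows "((\<lambda>s. curve D (cis s)) has_vector_derivative tangent D (cis t)) (at t)"
proof -
  have "(\<lambda>s. curve D (cis s)) differentiable at t"
    using assms C1_differentiable_imp_continuous_on
    unfolding virtual_knot_diagram_def C1_differentiable_on_eq by blast
  then have "((\<lambda>s. curve D (cis s)) has_vector_derivative
      vector_derivative (\<lambda>s. curve D (cis s)) (at t)) (at t)"
    by (simp add: vector_derivative_works)
  then show ?thesis
    using tangent_eqI by fastforce
qed

section \<open>Determinants, and the orientation at the end of an isotopy\<close>

lemma det2_scaleR: "det2 (a *\<^sub>R v) (b *\<^sub>R w) = a * b * det2 v w"
  by (simp add: det2_def algebra_simps)

lemma linear_complex_expand:
  fixes L :: "complex \<Rightarrow> complex"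
  assumes "linear L"
  shows "L v = Re v *\<^sub>R L 1 + Im v *\<^sub>R L \<i>"
proof -
  have "v = Re v *\<^sub>R 1 + Im v *\<^sub>R \<i>"
    by (simp add: complex_eq_iff)
  then show ?thesis
    using assms by (metis linear_add linear_scale)
qed

text \<open>The factor \<open>det2 (L 1) (L \<i>)\<close> is the determinant of \<open>L\<close>,
  the images of \<open>1\<close> and \<open>\<i>\<close> being its columns.\<close>

lemma det2_linear:
  fixes L :: "complex \<Rightarrow> complex"
  assumes "linear L"
  shows "det2 (L v) (L w) = det2 (L 1) (L \<i>) * det2 v w"
  unfolding linear_complex_expand[OF assms, of v] linear_complex_expand[OF assms, of w]
  by (simp add: det2_def algebra_simps)

lemma det2_bij_linear:
  fixes L :: "complex \<Rightarrow> complex"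
  assumes L: "linear L" and bij: "bij L"
  shows "det2 (L 1) (L \<i>) \<noteq> 0"
proof
  assume 0: "det2 (L 1) (L \<i>) = 0"
  have zero: "v = 0" if "L v = 0" for v
    using that bij L linear_0 by (metis bij_pointE)
  \<comment> \<open>The entries of one row of the matrix of \<open>L\<close>, exchanged and with one
    sign changed, are the coefficients of a vector that \<open>L\<close> kills when the determinant
    vanishes. The second vector comes from the other row.\<close>
  have "L (Complex (Re (L \<i>)) (- Re (L 1))) = 0"
    using 0 unfolding linear_complex_expand[OF L, of "Complex _ _"]
    by (simp add: complex_eq_iff det2_def algebra_simps)
  moreover have "L (Complex (Im (L \<i>)) (- Im (L 1))) = 0"
    using 0 unfolding linear_complex_expand[OF L, of "Complex _ _"]
    by (simp add: complex_eq_iff det2_def algebra_simps)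
  ultimately have "L 1 = 0"
    using zero by (metis complex.sel(2) complex_eq_0 add.inverse_neutral minus_minus neg_equal_0_iff_equal zero_complex.sel(2) complex_eq_iff zero_complex.sel(1))
  then show False
    using zero by force
qed

text \<open>The determinant of the derivative at \<open>z\<close> depends continuously on time, is 1
  at time 0 and never vanishes, so it is positive at time 1. This is why crossing signs survive
  isotopies.\<close>

lemma plane_isotopy_end:
  assumes "plane_isotopy H"
  obtains L where "(H 1 has_derivative L) (at z)" "linear L" "det2 (L 1) (L \<i>) > 0"
proof -
  obtain H' :: "real \<Rightarrow> complex \<Rightarrow> complex \<Rightarrow>\<^sub>L complex" where
    cont: "continuous_on ({0..1} \<times> UNIV) (\<lambda>(t, z). H' t z)" and
    der: "\<And>t z. t \<in> {0..1} \<Longrightarrow> (H t has_derivative blinfun_apply (H' t z)) (at z)" and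
    bij: "\<And>t z. t \<in> {0..1} \<Longrightarrow> bij (blinfun_apply (H' t z))"
    using assms unfolding plane_isotopy_def by blast
  have H0: "H 0 = (\<lambda>z. z)"
    using assms unfolding plane_isotopy_def by blast
  define d where "d t = det2 (H' t z 1) (H' t z \<i>)" for t
  have "continuous_on {0..1} (\<lambda>t. case (t, z) of (t, z) \<Rightarrow> H' t z)"
    by (rule continuous_on_compose2[OF cont]) (auto intro!: continuous_intros)
  then have contz: "continuous_on {0..1} (\<lambda>t. H' t z)"
    by simp
  have "continuous_on {0..1} d"
    unfolding d_def det2_def by (intro continuous_intros contz)
  moreover have nz: "d t \<noteq> 0" if "t \<in> {0..1}" for t
    unfolding d_def using bij[OF that]
    by (rule det2_bij_linear[OF bounded_linear.linear[OF blinfun.bounded_linear_right]])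
  moreover have "blinfun_apply (H' 0 z) = (\<lambda>z. z)"
    using der[of 0 z] H0 has_derivative_ident has_derivative_unique by (metis atLeastAtMost_iff le_numeral_extra(1) le_numeral_extra(3))
  then have "d 0 = 1"
    by (simp add: d_def det2_def)
  ultimately have "d 1 > 0"
    using IVT2'[of d 1 0 0] by (metis atLeastAtMost_iff linorder_not_le zero_le_one)
  then show ?thesis
    using that[of "blinfun_apply (H' 1 z)"] der[of 1 z]
    by (simp add: d_def has_derivative_linear)
qed

section \<open>Reparametrisations of the circle, and invariance under isotopy\<close>

lemma circle_reparam_add:
  assumes "circle_reparam \<rho>"
  shows "\<rho> (t + 2 * pi * of_int m) = \<rho> t + 2 * pi * of_int m"
proof -
  have step: "\<rho> (s + 2 * pi) = \<rho> s + 2 * pi" for s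
    using assms by (simp add: circle_reparam_def)
  have nat: "\<rho> (s + 2 * pi * real k) = \<rho> s + 2 * pi * real k" for k s
  proof (induction k)
    case (Suc k)
    have "\<rho> (s + 2 * pi * real (Suc k)) = \<rho> ((s + 2 * pi * real k) + 2 * pi)"
      by (simp add: algebra_simps)
    also have "\<dots> = \<rho> s + 2 * pi * real (Suc k)"
      unfolding step Suc by (simp add: algebra_simps)
    finally show ?case .
  qed simp
  show ?thesis
  proof (cases m)
    case (nonneg k)
    then show ?thesis
      using nat by simp
  next
    case (neg k)
    then have m: "of_int m = - real (Suc k)"
      by simp
    define s where "s = t - 2 * pi * real (Suc k)"
    have "\<rho> t = \<rho> s + 2 * pi * real (Suc k)"
      using nat[of s "Suc k"] by (simp add: s_def del: of_nat_Suc)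
    then show ?thesis
      unfolding m s_def by (simp del: of_nat_Suc)
  qed
qed

lemma circle_reparam_mono:
  assumes "circle_reparam \<rho>"
  shows "strict_mono \<rho>"
proof (rule strict_monoI)
  fix x y :: real assume "x < y"
  then show "\<rho> x < \<rho> y"
    using assms unfolding circle_reparam_def
    by (meson DERIV_pos_imp_increasing)
qed

lemma circle_reparam_image:
  assumes "circle_reparam \<rho>"
  shows "\<rho> ` {s..<t} = {\<rho> s..<\<rho> t}"
proof
  show "\<rho> ` {s..<t} \<subseteq> {\<rho> s..<\<rho> t}"
    using circle_reparam_mono[OF assms] by (auto simp: strict_mono_less strict_mono_less_eq)
  have "isCont \<rho> x" for x
    using assms DERIV_isCont unfolding circle_reparam_def by blast
  then have cont: "continuous_on A \<rho>" for A
    by (simp add: continuous_at_imp_continuous_on)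
  show "{\<rho> s..<\<rho> t} \<subseteq> \<rho> ` {s..<t}"
  proof
    fix y assume y: "y \<in> {\<rho> s..<\<rho> t}"
    then have "s \<le> t"
      using circle_reparam_mono[OF assms] by (metis atLeastLessThan_iff le_less_trans less_imp_le strict_mono_less)
    then obtain x where "s \<le> x" "x \<le> t" "\<rho> x = y"
      using IVT'[of \<rho> s y t] y cont by auto
    then show "y \<in> \<rho> ` {s..<t}"
      using y by (cases "x = t") auto
  qed
qed

text \<open>The reparametrisation induces a bijection \<open>\<phi>\<close> of the circle under
  which over- and under-parameters, crossings and levels correspond, so the state sums agree term by
  term.\<close>

lemma Phi_isotopic:
  assumes iso: "isotopic D D'" and n: "0 < n"
  shows "Phi n f D = Phi n f D'"
proof -
  obtain H \<rho> where D: "virtual_knot_diagram D" and D': "virtual_knot_diagram D'"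
    and H: "plane_isotopy H" and \<rho>: "circle_reparam \<rho>"
    and curve: "\<And>t. curve D' (cis t) = H 1 (curve D (cis (\<rho> t)))"
    and over: "\<And>t. cis t \<in> over D' \<longleftrightarrow> cis (\<rho> t) \<in> over D"
    and under: "\<And>t. cis t \<in> under D' \<longleftrightarrow> cis (\<rho> t) \<in> under D"
    using iso unfolding isotopic_def by blast
  have "bij (H 1)"
    using H unfolding plane_isotopy_def by auto
  then have inj: "H 1 z = H 1 w \<longleftrightarrow> z = w" for z w
    by (simp add: bij_is_inj inj_eq)
  \<comment> \<open>\<open>Arg\<close> only selects some lift; \<open>\<rho>\<close> commutes with
    full turns, so the choice does not matter.\<close>
  define \<phi> where "\<phi> z = cis (\<rho> (Arg z))" for z
  have \<phi>: "\<phi> (cis t) = cis (\<rho> t)" for t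
  proof -
    have "cis (Arg (cis t)) = cis t"
      by (metis cis_Arg cis_neq_zero norm_cis of_real_1 sgn_eq div_by_1)
    then obtain m :: int where "Arg (cis t) = t + 2 * pi * of_int m"
      using cis_eq_iff by blast
    then show ?thesis
      by (simp add: \<phi>_def circle_reparam_add[OF \<rho>])
  qed
  have inj_window: "cis (\<rho> s) = cis (\<rho> t) \<longleftrightarrow> cis s = cis t" for s t
  proof
    assume "cis (\<rho> s) = cis (\<rho> t)"
    then obtain m :: int where "\<rho> s = \<rho> t + 2 * pi * of_int m"
      using cis_eq_iff by blast
    then have "\<rho> s = \<rho> (t + 2 * pi * of_int m)"
      by (simp add: circle_reparam_add[OF \<rho>])
    then have "s = t + 2 * pi * of_int m"
      using circle_reparam_mono[OF \<rho>] strict_mono_eq by blast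
    then show "cis s = cis t"
      by simp
  next
    assume "cis s = cis t"
    then show "cis (\<rho> s) = cis (\<rho> t)"
      by (metis \<phi>)
  qed
  have lift: "\<exists>t. z = cis t" if "z \<in> circle" for z
    using that circle_lift[of z 0] by blast
  have onto: "\<exists>t. z = cis (\<rho> t)" if z: "z \<in> circle" for z
  proof -
    obtain t where "\<rho> 0 \<le> t" "t < \<rho> 0 + 2 * pi" "z = cis t"
      using z circle_lift by blast
    moreover have "\<rho> 0 + 2 * pi = \<rho> (2 * pi)"
      using circle_reparam_add[OF \<rho>, of 0 1] by simp
    ultimately show ?thesis
      using circle_reparam_image[OF \<rho>, of 0 "2 * pi"] by (metis atLeastLessThan_iff imageE)
  qed
  have inj_\<phi>: "inj_on \<phi> circle"
    using lift by (intro inj_onI) (metis \<phi> inj_window)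
  have circ: "crossing_params D \<subseteq> circle" "crossing_params D' \<subseteq> circle"
    using crossing_params_circle D D' by blast+
  have over\<phi>: "\<phi> z \<in> over D \<longleftrightarrow> z \<in> over D'" and under\<phi>: "\<phi> z \<in> under D \<longleftrightarrow> z \<in> under D'"
    if "z \<in> circle" for z
    using lift[OF that] by (auto simp: \<phi> over under)
  obtain g where g: "level D g"
    using level_exists[OF D] by blast
  have "level D' (g \<circ> \<phi>)"
    unfolding level_def
  proof (intro allI impI)
    fix s t :: real assume st: "s \<le> t" "t \<le> s + 2 * pi"
    have img: "\<phi> ` (crossing_params D' \<inter> cis ` {s..<t}) = crossing_params D \<inter> cis ` {\<rho> s..<\<rho> t}"
    proof -
      have im: "\<phi> ` cis ` {s..<t} = cis ` {\<rho> s..<\<rho> t}"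
        unfolding image_image \<phi> by (simp add: circle_reparam_image[OF \<rho>, symmetric] image_image)
      have "z \<in> crossing_params D' \<longleftrightarrow> \<phi> z \<in> crossing_params D" if "z \<in> cis ` {s..<t}" for z
        using over\<phi>[of z] under\<phi>[of z] that by (auto simp: crossing_params_def)
      then have "\<phi> ` (crossing_params D' \<inter> cis ` {s..<t}) = crossing_params D \<inter> \<phi> ` cis ` {s..<t}"
        by blast
      then show ?thesis
        unfolding im .
    qed
    have "rise D (cis ` {\<rho> s..<\<rho> t}) = (\<Sum>z\<in>crossing_params D' \<inter> cis ` {s..<t}. jump D (\<phi> z))"
      unfolding rise_def img[symmetric]
      using inj_\<phi> circ by (subst sum.reindex) (auto intro: inj_on_subset)
    also have "\<dots> = rise D' (cis ` {s..<t})"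
      unfolding rise_def using over\<phi> under\<phi> circ by (intro sum.cong) (auto simp: jump_def)
    finally have "rise D (cis ` {\<rho> s..<\<rho> t}) = rise D' (cis ` {s..<t})" .
    moreover have "\<rho> s \<le> \<rho> t" "\<rho> t \<le> \<rho> s + 2 * pi"
      using st circle_reparam_mono[OF \<rho>] circle_reparam_add[OF \<rho>, of s 1]
        strict_mono_less_eq[of \<rho> t "s + 2 * pi"] by (auto simp: strict_mono_less_eq)
    ultimately show "(g \<circ> \<phi>) (cis t) = (g \<circ> \<phi>) (cis s) + rise D' (cis ` {s..<t})"
      using levelD[OF g] by (simp add: \<phi>)
  qed
  moreover have "state_sum n f D (\<lambda>z. k + g z) = state_sum n f D' (\<lambda>z. k + (g \<circ> \<phi>) z)" for k
  proof -
    have "real_crossings D = map_prod \<phi> \<phi> ` real_crossings D'"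
    proof
      show "map_prod \<phi> \<phi> ` real_crossings D' \<subseteq> real_crossings D"
      proof
        fix c assume "c \<in> map_prod \<phi> \<phi> ` real_crossings D'"
        then obtain p q where c: "c = (\<phi> p, \<phi> q)" "(p, q) \<in> real_crossings D'"
          by auto
        then obtain s t where "p = cis s" "q = cis t"
          using lift real_crossingD[OF D'] by metis
        then show "c \<in> real_crossings D"
          using c by (auto simp: real_crossings_def \<phi> over under curve inj)
      qed
      show "real_crossings D \<subseteq> map_prod \<phi> \<phi> ` real_crossings D'"
      proof
        fix c assume "c \<in> real_crossings D"
        then obtain p q where c: "c = (p, q)" "(p, q) \<in> real_crossings D"
          by (cases c) auto
        then obtain s t where st: "p = cis (\<rho> s)" "q = cis (\<rho> t)"
          using onto real_crossingD[OF D] by metis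
        then have "(cis s, cis t) \<in> real_crossings D'"
          using c by (auto simp: real_crossings_def over under curve)
        then show "c \<in> map_prod \<phi> \<phi> ` real_crossings D'"
          using c st \<phi> by (metis image_eqI map_prod_simp)
      qed
    qed
    moreover have "inj_on (map_prod \<phi> \<phi>) (real_crossings D')"
      using real_crossingD[OF D'] by (intro inj_on_subset[OF map_prod_inj_on[OF inj_\<phi> inj_\<phi>]]) auto
    moreover have "crossing_weight n f D (\<lambda>z. k + g z) (map_prod \<phi> \<phi> c) =
        crossing_weight n f D' (\<lambda>z. k + (g \<circ> \<phi>) z) c" if c: "c \<in> real_crossings D'" for c
    proof -
      obtain p q where pq: "c = (p, q)" "(p, q) \<in> real_crossings D'"
        using c by (cases c) auto
      then obtain s t where st: "p = cis s" "q = cis t"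
        using lift real_crossingD[OF D'] by metis
      have same: "curve D (cis (\<rho> s)) = curve D (cis (\<rho> t))"
        using real_crossingD(6)[OF D' pq(2)] by (simp add: st curve inj)
      obtain L where L: "(H 1 has_derivative L) (at (curve D (cis (\<rho> s))))" "linear L"
        "det2 (L 1) (L \<i>) > 0"
        using plane_isotopy_end[OF H] by blast
      obtain \<rho>' where \<rho>': "\<And>t. (\<rho> has_real_derivative \<rho>' t) (at t)" "\<And>t. 0 < \<rho>' t"
        using \<rho> unfolding circle_reparam_def by blast
      \<comment> \<open>At a crossing both parameters lie over the same point, so a single
        derivative \<open>L\<close> of \<open>H 1\<close> transforms both tangents, and their
        determinant only picks up positive factors.\<close>
      have tan: "tangent D' (cis r) = L (\<rho>' r *\<^sub>R tangent D (cis (\<rho> r)))"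
        if "curve D (cis (\<rho> r)) = curve D (cis (\<rho> s))" for r
      proof (rule tangent_eqI)
        have "((\<lambda>r. curve D (cis r)) \<circ> \<rho> has_vector_derivative \<rho>' r *\<^sub>R tangent D (cis (\<rho> r))) (at r)"
          using \<rho>'(1)[of r] tangent_has_vector_derivative[OF D, of "\<rho> r"]
          by (intro vector_diff_chain_at) (auto simp: has_real_derivative_iff_has_vector_derivative)
        then have "(H 1 \<circ> ((\<lambda>r. curve D (cis r)) \<circ> \<rho>) has_derivative
             L \<circ> (\<lambda>h. h *\<^sub>R (\<rho>' r *\<^sub>R tangent D (cis (\<rho> r))))) (at r)"
          using L(1) that by (intro diff_chain_at) (auto simp: has_vector_derivative_def)
        then show "((\<lambda>r. curve D' (cis r)) has_vector_derivative
            L (\<rho>' r *\<^sub>R tangent D (cis (\<rho> r)))) (at r)"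
          unfolding has_vector_derivative_def curve comp_def linear_scale[OF L(2)] .
      qed
      have "det2 (tangent D' (cis s)) (tangent D' (cis t)) =
         det2 (L 1) (L \<i>) * (\<rho>' s * \<rho>' t) * det2 (tangent D (cis (\<rho> s))) (tangent D (cis (\<rho> t)))"
        unfolding tan[OF refl] tan[OF same[symmetric]]
        by (simp only: det2_linear[OF L(2), of "_ *\<^sub>R _"] det2_scaleR mult.assoc)
      then have "positive_crossing D' c \<longleftrightarrow> positive_crossing D (map_prod \<phi> \<phi> c)"
        using mult_less_cancel_left_pos[OF mult_pos_pos[OF L(3) mult_pos_pos[OF \<rho>'(2)[of s] \<rho>'(2)[of t]]], of 0]
        by (simp add: positive_crossing_def pq(1) st \<phi>)
      then show ?thesis
        by (simp add: crossing_weight_def pq(1))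
    qed
    ultimately show ?thesis
      unfolding state_sum_def by (simp add: sum.reindex)
  qed
  ultimately show ?thesis
    using Phi_eqI[OF D D' g] n by blast
qed


section \<open>Local changes of diagrams\<close>

text \<open>If the two arcs meet, then on the lift where they do so neither \<open>x\<close> nor
  \<open>y\<close> can lie on the strand except at its start. As arcs omit their end, the start is
  harmless: used as \<open>x\<close> it takes the strand in, used as \<open>y\<close> it leaves it
  out.\<close>

lemma arc_inside_or_outside:
  assumes "a < b" "b < a + 2 * pi"
    and x: "cis x \<notin> cis ` {a..b} \<or> cis x = cis a" and y: "cis y \<notin> cis ` {a..b} \<or> cis y = cis a"
  shows "cis ` {a..b} \<subseteq> cis ` {x..<y} \<or> cis ` {a..b} \<inter> cis ` {x..<y} = {}"
proof (rule disjCI)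
  assume "cis ` {a..b} \<inter> cis ` {x..<y} \<noteq> {}"
  then obtain t u where t: "a \<le> t" "t \<le> b" and u: "x \<le> u" "u < y" and "cis u = cis t"
    by fastforce
  then obtain m :: int where m: "u = t + 2 * pi * of_int m"
    using cis_eq_iff by blast
  \<comment> \<open>The full turns that carry the angles of the strand to the place where they meet
    the interval from \<open>x\<close> to \<open>y\<close>.\<close>
  define c where "c = 2 * pi * real_of_int m"
  have cis_c: "cis (v + c) = cis v" for v
    by (simp add: c_def)
  have start: "v = a + c" if v: "a + c \<le> v" "v \<le> b + c" "cis v \<notin> cis ` {a..b} \<or> cis v = cis a" for v
  proof -
    have "cis v = cis (v - c)"
      using cis_c[of "v - c"] by simp
    then have "cis (v - c) = cis a"
      using v by force
    then have "v - c = a"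
      by (rule cis_inj_window) (use v assms in auto)
    then show ?thesis
      by simp
  qed
  have "x \<le> a + c"
    using start[of x] x t u m by (fastforce simp: c_def)
  moreover have "b + c < y"
    using start[of y] y t u m by (fastforce simp: c_def)
  ultimately have "{a + c..b + c} \<subseteq> {x..<y}"
    by auto
  then have "cis ` {a + c..b + c} \<subseteq> cis ` {x..<y}"
    by (rule image_mono)
  moreover have "cis ` {a + c..b + c} = cis ` (\<lambda>v. v + c) ` {a..b}"
    by simp
  ultimately show "cis ` {a..b} \<subseteq> cis ` {x..<y}"
    by (simp only: image_image cis_c)
qed

lemma rise_UN:
  assumes "finite (crossing_params D)" "finite I"
    and "\<And>i j. i \<in> I \<Longrightarrow> j \<in> I \<Longrightarrow> i \<noteq> j \<Longrightarrow> B i \<inter> B j = {}"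
  shows "rise D (\<Union>i\<in>I. B i) = (\<Sum>i\<in>I. rise D (B i))"
  unfolding rise_def Int_UN_distrib
  using assms by (intro sum.UNION_disjoint) auto

text \<open>What the comparison outside the disk keeps of a local change: the pictures enter only
  through the norm bounds, which prevent crossings between inside and outside. Strand 0 supplies the
  point \<open>cis (a 0)\<close> at which levels are matched, hence \<open>0 < k\<close>.\<close>

locale diagram_change =
  fixes D D' :: vdiagram and a b :: "nat \<Rightarrow> real" and k :: nat
  assumes D: "virtual_knot_diagram D" and D': "virtual_knot_diagram D'"
    and k: "0 < k"
    and ab: "i < k \<Longrightarrow> a i < b i" "i < k \<Longrightarrow> b i < a i + 2 * pi"
    and disjoint: "i < k \<Longrightarrow> j < k \<Longrightarrow> i \<noteq> j \<Longrightarrow> cis ` {a i..b i} \<inter> cis ` {a j..b j} = {}"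
    and curve_outside: "z \<in> circle \<Longrightarrow> z \<notin> (\<Union>i<k. cis ` {a i..b i}) \<Longrightarrow> curve D' z = curve D z"
    and norm_outside: "z \<in> circle \<Longrightarrow> z \<notin> (\<Union>i<k. cis ` {a i..b i}) \<Longrightarrow> 1 < norm (curve D z)"
    and over_outside:
      "z \<in> circle \<Longrightarrow> z \<notin> (\<Union>i<k. cis ` {a i..b i}) \<Longrightarrow> z \<in> over D' \<longleftrightarrow> z \<in> over D"
    and under_outside:
      "z \<in> circle \<Longrightarrow> z \<notin> (\<Union>i<k. cis ` {a i..b i}) \<Longrightarrow> z \<in> under D' \<longleftrightarrow> z \<in> under D"
    and norm_inside: "i < k \<Longrightarrow> t \<in> {a i..b i} \<Longrightarrow> norm (curve D (cis t)) \<le> 1"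
    and norm_inside': "i < k \<Longrightarrow> t \<in> {a i..b i} \<Longrightarrow> norm (curve D' (cis t)) \<le> 1"
begin

definition strand :: "nat \<Rightarrow> complex set"
  where "strand i = cis ` {a i..b i}"

definition strands :: "complex set"
  where "strands = (\<Union>i<k. strand i)"

lemma outside:
  assumes "z \<in> circle - strands"
  shows "curve D' z = curve D z" "1 < norm (curve D z)" "1 < norm (curve D' z)"
    "z \<in> over D' \<longleftrightarrow> z \<in> over D" "z \<in> under D' \<longleftrightarrow> z \<in> under D"
  using curve_outside[of z] norm_outside[of z] over_outside[of z] under_outside[of z] assms
  unfolding strands_def strand_def by auto

lemma crossing_params_outside:
  "z \<in> circle - strands \<Longrightarrow> z \<in> crossing_params D' \<longleftrightarrow> z \<in> crossing_params D"
  using outside by (auto simp: crossing_params_def)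

lemma inside: "z \<in> strands \<Longrightarrow> norm (curve D z) \<le> 1" "z \<in> strands \<Longrightarrow> norm (curve D' z) \<le> 1"
  using norm_inside norm_inside' unfolding strands_def strand_def by auto

text \<open>On the way from \<open>cis (a 0)\<close> to \<open>z\<close> each strand is traversed
  completely or not at all. A complete strand contributes equally to both diagrams, and off the
  strands the jumps coincide.\<close>

lemma levels_agree_outside:
  assumes net: "\<And>i. i < k \<Longrightarrow> rise D (strand i) = rise D' (strand i)"
    and g: "level D g" and g': "level D' g'" and eq: "g (cis (a 0)) = g' (cis (a 0))"
    and z: "z \<in> circle - strands \<or> (\<exists>i<k. z = cis (a i))"
  shows "g z = g' z"
proof -
  have "z \<in> circle"
    using z by auto
  then obtain y where y: "a 0 \<le> y" "y < a 0 + 2 * pi" "z = cis y"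
    using circle_lift by blast
  define A where "A = cis ` {a 0..<y}"
  \<comment> \<open>The start of one strand never lies on another, so all entry points are
    admissible ends in \<open>arc_inside_or_outside\<close>.\<close>
  have start: "cis (a i) \<notin> strand j \<or> cis (a i) = cis (a j)" if "i < k" "j < k" for i j
    using disjoint[OF that] ab[OF that(1)] unfolding strand_def
    by (cases "i = j") (auto simp: disjoint_iff)
  have inout: "A \<inter> strand i = strand i \<or> A \<inter> strand i = {}" if i: "i < k" for i
  proof -
    have "z \<notin> strand i \<or> z = cis (a i)"
      using z
    proof
      assume "z \<in> circle - strands"
      then show ?thesis
        using i by (auto simp: strands_def)
    next
      assume "\<exists>j<k. z = cis (a j)"
      then show ?thesis
        using start i by metis
    qed
    then have "strand i \<subseteq> A \<or> strand i \<inter> A = {}"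
      using arc_inside_or_outside[OF ab[OF i], of "a 0" y] start[OF k i]
      unfolding A_def strand_def y(3) by simp
    then show ?thesis
      by blast
  qed
  have split: "rise E A = rise E (A - strands) + (\<Sum>i<k. rise E (A \<inter> strand i))"
    if E: "virtual_knot_diagram E" for E
  proof -
    have "rise E A = rise E ((A - strands) \<union> (A \<inter> strands))"
      by (rule arg_cong) blast
    also have "\<dots> = rise E (A - strands) + rise E (A \<inter> strands)"
      by (intro rise_Un finite_crossing_params[OF E]) blast
    also have "A \<inter> strands = (\<Union>i<k. A \<inter> strand i)"
      by (auto simp: strands_def)
    also have "rise E \<dots> = (\<Sum>i<k. rise E (A \<inter> strand i))"
    proof (intro rise_UN finite_crossing_params[OF E])
      show "A \<inter> strand i \<inter> (A \<inter> strand j) = {}" if "i \<in> {..<k}" "j \<in> {..<k}" "i \<noteq> j" for i j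
        using disjoint[of i j] that unfolding strand_def by blast
    qed simp
    finally show ?thesis .
  qed
  have "rise D (A - strands) = rise D' (A - strands)"
    unfolding rise_def
  proof (rule sum.cong)
    have "A \<subseteq> circle"
      by (auto simp: A_def)
    then show "crossing_params D \<inter> (A - strands) = crossing_params D' \<inter> (A - strands)"
      using crossing_params_outside by blast
    show "jump D z = jump D' z" if "z \<in> crossing_params D' \<inter> (A - strands)" for z
      using outside(4,5)[of z] that \<open>A \<subseteq> circle\<close> by (auto simp: jump_def)
  qed
  moreover have "rise D (A \<inter> strand i) = rise D' (A \<inter> strand i)" if i: "i < k" for i
    using inout[OF i] net[OF i] by (auto simp: rise_empty)
  ultimately have "rise D A = rise D' A"
    using split[OF D] split[OF D'] by simp
  then show ?thesis
    using levelD[OF g, of "a 0" y] levelD[OF g', of "a 0" y] y eq by (simp add: A_def)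
qed

text \<open>The strands form a closed set, so the two curves agree on a whole neighborhood of the
  parameter.\<close>

lemma tangent_outside:
  assumes "z \<in> circle - strands"
  shows "tangent D' z = tangent D z"
proof -
  obtain t where t: "z = cis t"
    using assms circle_lift[of z 0] by blast
  have "closed strands"
    unfolding strands_def strand_def
    by (intro closed_UN ballI compact_imp_closed compact_continuous_image continuous_intros) auto
  then have "open (cis -` (- strands))"
    by (intro open_vimage continuous_intros) auto
  moreover have "t \<in> cis -` (- strands)"
    using assms t by simp
  moreover have "curve D (cis s) = curve D' (cis s)" if "s \<in> cis -` (- strands)" for s
    using outside(1)[of "cis s"] that by simp
  ultimately have "((\<lambda>s. curve D' (cis s)) has_vector_derivative tangent D (cis t)) (at t)"
    by (rule has_vector_derivative_transform_within_open[OF tangent_has_vector_derivative[OF D, of t]])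
  then show ?thesis
    unfolding t by (rule tangent_eqI)
qed

text \<open>The strands run in the closed unit disk and the rest of the curve strictly outside it,
  so no crossing has one parameter of each kind.\<close>

lemma crossing_inside_or_outside:
  assumes "c \<in> real_crossings D - strands \<times> strands \<or> c \<in> real_crossings D' - strands \<times> strands"
  shows "fst c \<in> circle - strands" "snd c \<in> circle - strands"
proof -
  obtain p q where c: "c = (p, q)"
    by (cases c)
  have circ: "p \<in> circle" "q \<in> circle"
    using assms c real_crossingD[OF D] real_crossingD[OF D'] by blast+
  have "curve D p = curve D q \<or> curve D' p = curve D' q"
    using assms c by (auto simp: real_crossings_def)
  then have "p \<in> strands \<longleftrightarrow> q \<in> strands"
    using inside[of p] inside[of q] outside[of p] outside[of q] circ
    by (metis DiffI linorder_not_le)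
  then show "fst c \<in> circle - strands" "snd c \<in> circle - strands"
    using assms c circ by auto
qed

text \<open>\<open>inside_sum\<close> is asked for all pairs of levels that agree at the strand
  starts, because it is applied to every translate of one matched pair.\<close>

lemma Phi_change:
  assumes net: "\<And>i. i < k \<Longrightarrow> rise D (strand i) = rise D' (strand i)"
    and inside_sum: "\<And>g g'. \<lbrakk>level D g; level D' g'; \<And>i. i < k \<Longrightarrow> g (cis (a i)) = g' (cis (a i))\<rbrakk> \<Longrightarrow>
      (\<Sum>c\<in>real_crossings D \<inter> strands \<times> strands. crossing_weight n f D g c) =
      (\<Sum>c\<in>real_crossings D' \<inter> strands \<times> strands. crossing_weight n f D' g' c)"
    and n: "0 < n"
  shows "Phi n f D = Phi n f D'"
proof -
  obtain g where g: "level D g"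
    using level_exists[OF D] by blast
  obtain h where "level D' h"
    using level_exists[OF D'] by blast
  \<comment> \<open>A level may be shifted by a constant; the constant is chosen to match
    \<open>g\<close> at the start of strand 0.\<close>
  then have "level D' (\<lambda>z. h z + (g (cis (a 0)) - h (cis (a 0))))"
    by (rule level_add_const)
  then obtain g' where g': "level D' g'" "g (cis (a 0)) = g' (cis (a 0))"
    by fastforce
  note agree = levels_agree_outside[OF net g g']
  show ?thesis
  proof (rule Phi_eqI[OF D D' g g'(1) n])
    fix m :: int
    have lev: "level D (\<lambda>z. m + g z)" "level D' (\<lambda>z. m + g' z)"
      using level_add_const[OF g, of m] level_add_const[OF g'(1), of m] by (simp_all add: add.commute)
    have split: "state_sum n f E h = (\<Sum>c\<in>real_crossings E - strands \<times> strands. crossing_weight n f E h c) +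
        (\<Sum>c\<in>real_crossings E \<inter> strands \<times> strands. crossing_weight n f E h c)"
      if "virtual_knot_diagram E" for E h
      unfolding state_sum_def using finite_real_crossings[OF that]
      by (subst add.commute) (rule sum.Int_Diff)
    have "(\<Sum>c\<in>real_crossings D - strands \<times> strands. crossing_weight n f D (\<lambda>z. m + g z) c) =
        (\<Sum>c\<in>real_crossings D' - strands \<times> strands. crossing_weight n f D' (\<lambda>z. m + g' z) c)"
    proof (rule sum.cong)
      show "real_crossings D - strands \<times> strands = real_crossings D' - strands \<times> strands"
      proof (intro set_eqI iffI)
        fix c assume c: "c \<in> real_crossings D - strands \<times> strands"
        then show "c \<in> real_crossings D' - strands \<times> strands"
          using crossing_inside_or_outside[of c] outside[of "fst c"] outside[of "snd c"]
          by (auto simp: real_crossings_def)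
      next
        fix c assume c: "c \<in> real_crossings D' - strands \<times> strands"
        then show "c \<in> real_crossings D - strands \<times> strands"
          using crossing_inside_or_outside[of c] outside[of "fst c"] outside[of "snd c"]
          by (auto simp: real_crossings_def)
      qed
      fix c assume c: "c \<in> real_crossings D' - strands \<times> strands"
      then have out: "fst c \<in> circle - strands" "snd c \<in> circle - strands"
        using crossing_inside_or_outside by blast+
      then have "positive_crossing D' c = positive_crossing D c"
        by (simp add: positive_crossing_def tangent_outside)
      then show "crossing_weight n f D (\<lambda>z. m + g z) c = crossing_weight n f D' (\<lambda>z. m + g' z) c"
        using agree out by (simp add: crossing_weight_def)
    qed
    moreover have "(\<Sum>c\<in>real_crossings D \<inter> strands \<times> strands. crossing_weight n f D (\<lambda>z. m + g z) c) =
      (\<Sum>c\<in>real_crossings D' \<inter> strands \<times> strands. crossing_weight n f D' (\<lambda>z. m + g' z) c)"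
      by (rule inside_sum[OF lev]) (use agree in auto)
    ultimately show "state_sum n f D (\<lambda>z. m + g z) = state_sum n f D' (\<lambda>z. m + g' z)"
      by (simp only: split[OF D] split[OF D'])
  qed
qed

lemma Phi_change_virtual:
  assumes "crossing_params D \<inter> strands = {}" "crossing_params D' \<inter> strands = {}" "0 < n"
  shows "Phi n f D = Phi n f D'"
proof (rule Phi_change)
  have "crossing_params D \<inter> strand i = {}" "crossing_params D' \<inter> strand i = {}" if "i < k" for i
    using assms that unfolding strands_def by blast+
  then show "rise D (strand i) = rise D' (strand i)" if "i < k" for i
    using that by (simp add: rise_empty)
  have "real_crossings D \<inter> strands \<times> strands = {}" "real_crossings D' \<inter> strands \<times> strands = {}"
    using assms by (auto simp: real_crossings_def crossing_params_def)
  then show "(\<Sum>c\<in>real_crossings D \<inter> strands \<times> strands. crossing_weight n f D g c) =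
      (\<Sum>c\<in>real_crossings D' \<inter> strands \<times> strands. crossing_weight n f D' g' c)" for g g'
    by simp
qed (use assms in simp)

end

text \<open>Multiplying by \<open>\<sigma>\<close> treats both directions of travel at once, since
  \<open>\<sigma> * \<rho>\<close> increases. Two-sided derivatives are stated for interior angles,
  which is where the crossings of the pictures lie.\<close>

lemma traversesE:
  assumes "traverses D p a b \<sigma>" and ab: "a < b" and \<sigma>: "\<sigma> \<in> {1, - 1}"
  obtains \<rho> \<rho>' where
    "\<rho> a = - \<sigma>" "\<rho> b = \<sigma>"
    "\<And>t. t \<in> {a..b} \<Longrightarrow> \<rho> t \<in> {- 1..1}"
    "\<And>t. t \<in> {a..b} \<Longrightarrow> curve D (cis t) = p (\<rho> t)"
    "\<And>s t. s \<in> {a..b} \<Longrightarrow> t \<in> {a..b} \<Longrightarrow> s < t \<longleftrightarrow> \<sigma> * \<rho> s < \<sigma> * \<rho> t"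
    "\<And>u. u \<in> {- 1..1} \<Longrightarrow> \<exists>t\<in>{a..b}. \<rho> t = u"
    "\<And>t. t \<in> {a<..<b} \<Longrightarrow> (\<rho> has_real_derivative \<rho>' t) (at t)"
    "\<And>t. t \<in> {a<..<b} \<Longrightarrow> 0 < \<sigma> * \<rho>' t"
proof -
  obtain \<rho> \<rho>' where ends: "\<rho> a = - \<sigma>" "\<rho> b = \<sigma>" and
    der: "\<And>t. t \<in> {a..b} \<Longrightarrow> (\<rho> has_real_derivative \<rho>' t) (at t within {a..b})" and
    pos: "\<And>t. t \<in> {a..b} \<Longrightarrow> 0 < \<sigma> * \<rho>' t" and
    cur: "\<And>t. t \<in> {a..b} \<Longrightarrow> curve D (cis t) = p (\<rho> t)"
    using assms(1) unfolding traverses_def by blast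
  have at: "(\<rho> has_real_derivative \<rho>' t) (at t)" if "t \<in> {a<..<b}" for t
    using der[of t] that at_within_Icc_at[of a t b] by auto
  have cont: "continuous_on {a..b} \<rho>"
    using der DERIV_continuous continuous_on_eq_continuous_within by blast
  have \<sigma>2: "\<sigma> * \<sigma> = 1"
    using \<sigma> by auto
  have mono: "\<sigma> * \<rho> s < \<sigma> * \<rho> t" if st: "s \<in> {a..b}" "t \<in> {a..b}" "s < t" for s t
  proof (rule DERIV_pos_imp_increasing_open[OF \<open>s < t\<close>])
    fix x assume x: "s < x" "x < t"
    then have "x \<in> {a<..<b}"
      using st by auto
    then show "\<exists>y. ((\<lambda>x. \<sigma> * \<rho> x) has_real_derivative y) (at x) \<and> 0 < y"
      using at pos[of x] by (intro exI[of _ "\<sigma> * \<rho>' x"]) (auto intro: DERIV_cmult)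
  next
    show "continuous_on {s..t} (\<lambda>x. \<sigma> * \<rho> x)"
      by (intro continuous_intros continuous_on_subset[OF cont]) (use st in auto)
  qed
  have mono_iff: "s < t \<longleftrightarrow> \<sigma> * \<rho> s < \<sigma> * \<rho> t" if "s \<in> {a..b}" "t \<in> {a..b}" for s t
    using mono[OF that] mono[OF that(2,1)] by (cases s t rule: linorder_cases) auto
  have range: "\<rho> t \<in> {- 1..1}" if t: "t \<in> {a..b}" for t
  proof -
    have "\<not> \<sigma> * \<rho> t < \<sigma> * \<rho> a" "\<not> \<sigma> * \<rho> b < \<sigma> * \<rho> t"
      using mono_iff[of t a] mono_iff[of b t] t ab by auto
    then show ?thesis
      using \<sigma> by (auto simp: ends)
  qed
  have onto: "\<exists>t\<in>{a..b}. \<rho> t = u" if u: "u \<in> {- 1..1}" for u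
  proof -
    have "\<exists>t. a \<le> t \<and> t \<le> b \<and> \<sigma> * \<rho> t = \<sigma> * u"
      by (rule IVT') (use u \<sigma> ab cont in \<open>auto simp: ends intro!: continuous_intros\<close>)
    then show ?thesis
      using \<sigma> by auto
  qed
  show ?thesis
    using that[OF ends range cur mono_iff onto at] pos by auto
qed

lemma traverses_in_image:
  assumes "traverses D p a b \<sigma>" "a < b" "\<sigma> \<in> {1, - 1}" "t \<in> {a..b}"
  shows "curve D (cis t) \<in> p ` {- 1..1}"
proof (rule traversesE[OF assms(1-3)])
  fix \<rho>
  assume "\<And>t. t \<in> {a..b} \<Longrightarrow> \<rho> t \<in> {- 1..1}" "\<And>t. t \<in> {a..b} \<Longrightarrow> curve D (cis t) = p (\<rho> t)"
  then show ?thesis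
    using assms(4) by simp
qed

lemma local_changeE:
  assumes lc: "local_change P P' Q D D'" and "P \<noteq> []"
    and P: "\<And>i t. i < length P \<Longrightarrow> t \<in> {- 1..1} \<Longrightarrow> norm ((P ! i) t) \<le> 1"
    and P': "\<And>i t. i < length P \<Longrightarrow> t \<in> {- 1..1} \<Longrightarrow> norm ((P' ! i) t) \<le> 1"
  obtains a b \<sigma> where "diagram_change D D' a b (length P)"
    "\<And>i. i < length P \<Longrightarrow> \<sigma> i \<in> {1, - 1}"
    "\<And>i. i < length P \<Longrightarrow> traverses D (P ! i) (a i) (b i) (\<sigma> i)"
    "\<And>i. i < length P \<Longrightarrow> traverses D' (P' ! i) (a i) (b i) (\<sigma> i)"
    "Q D (\<lambda>i. cis ` {a i..b i})" "Q D' (\<lambda>i. cis ` {a i..b i})"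
  using lc unfolding local_change_def Let_def
proof (elim exE conjE)
  fix a b \<sigma>
  assume vkd: "virtual_knot_diagram D" "virtual_knot_diagram D'"
    and str: "\<forall>i<length P. a i < b i \<and> b i < a i + 2 * pi \<and> \<sigma> i \<in> {1, -1} \<and>
          traverses D (P ! i) (a i) (b i) (\<sigma> i) \<and>
          traverses D' (P' ! i) (a i) (b i) (\<sigma> i)"
    and disj: "\<forall>i<length P. \<forall>j<length P. i \<noteq> j \<longrightarrow> cis ` {a i..b i} \<inter> cis ` {a j..b j} = {}"
    and out: "\<forall>z\<in>circle - (\<Union>i<length P. cis ` {a i..b i}).
          curve D' z = curve D z \<and> 1 < norm (curve D z) \<and>
          (z \<in> over D' \<longleftrightarrow> z \<in> over D) \<and> (z \<in> under D' \<longleftrightarrow> z \<in> under D)"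
    and Q: "Q D (\<lambda>i. cis ` {a i..b i})" "Q D' (\<lambda>i. cis ` {a i..b i})"
  have norm: "norm (curve E (cis t)) \<le> 1"
    if E: "traverses E p (a i) (b i) (\<sigma> i)" and p: "\<And>u. u \<in> {- 1..1} \<Longrightarrow> norm (p u) \<le> 1"
      and i: "i < length P" and t: "t \<in> {a i..b i}" for E p i t
  proof -
    have "a i < b i" "\<sigma> i \<in> {1, -1}"
      using str i by blast+
    then show ?thesis
      using traverses_in_image[OF E _ _ t] p by auto
  qed
  have "diagram_change D D' a b (length P)"
  proof
    show "norm (curve D (cis t)) \<le> 1" if "i < length P" "t \<in> {a i..b i}" for i t
      by (rule norm[OF _ _ that]) (use str P that in auto)
    show "norm (curve D' (cis t)) \<le> 1" if "i < length P" "t \<in> {a i..b i}" for i t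
      by (rule norm[OF _ _ that]) (use str P' that in auto)
  qed (use vkd str disj out \<open>P \<noteq> []\<close> in auto)
  then show ?thesis
    using that str Q by blast
qed


section \<open>Pictures in the disk and virtual moves\<close>

text \<open>One side of a move on its own, so that every lemma here serves both diagrams.
  \<open>far\<close> and \<open>near\<close> force the partner of a double point on a strand to lie
  on a strand again.\<close>

locale picture =
  fixes D :: vdiagram and P :: "nat \<Rightarrow> real \<Rightarrow> complex" and a b \<sigma> :: "nat \<Rightarrow> real" and k :: nat
  assumes D: "virtual_knot_diagram D"
    and ab: "i < k \<Longrightarrow> a i < b i"
    and ab_turn: "i < k \<Longrightarrow> b i < a i + 2 * pi"
    and \<sigma>: "i < k \<Longrightarrow> \<sigma> i \<in> {1, - 1}"
    and disjoint: "i < k \<Longrightarrow> j < k \<Longrightarrow> i \<noteq> j \<Longrightarrow> cis ` {a i..b i} \<inter> cis ` {a j..b j} = {}"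
    and traverses: "i < k \<Longrightarrow> traverses D (P i) (a i) (b i) (\<sigma> i)"
    and far: "z \<in> circle \<Longrightarrow> z \<notin> (\<Union>i<k. cis ` {a i..b i}) \<Longrightarrow> 1 < norm (curve D z)"
    and near: "i < k \<Longrightarrow> t \<in> {- 1..1} \<Longrightarrow> norm (P i t) \<le> 1"
begin

lemma on_strand:
  assumes "i < k" "z \<in> cis ` {a i..b i}"
  shows "curve D z \<in> P i ` {- 1..1}"
  using traverses_in_image[OF traverses ab \<sigma>] assms by blast

lemma strand_partner:
  assumes "i < k" "z \<in> cis ` {a i..b i}" "w \<in> circle" "curve D w = curve D z"
  shows "w \<in> (\<Union>j<k. cis ` {a j..b j})"
proof -
  obtain t where "t \<in> {- 1..1}" "curve D z = P i t"
    using on_strand[OF assms(1,2)] by blast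
  then have "norm (curve D w) \<le> 1"
    using near[OF assms(1)] assms(4) by simp
  then show ?thesis
    using far[OF assms(3)] by fastforce
qed

lemma strand_parametrization:
  assumes i: "i < k"
  obtains \<rho> \<rho>' where
    "\<And>t. t \<in> {a i..b i} \<Longrightarrow> \<rho> t \<in> {- 1..1}"
    "\<And>t. t \<in> {a i..b i} \<Longrightarrow> curve D (cis t) = P i (\<rho> t)"
    "\<And>s t. s \<in> {a i..b i} \<Longrightarrow> t \<in> {a i..b i} \<Longrightarrow> s < t \<longleftrightarrow> \<sigma> i * \<rho> s < \<sigma> i * \<rho> t"
    "\<And>u. u \<in> {- 1<..<1} \<Longrightarrow> \<exists>t\<in>{a i<..<b i}. \<rho> t = u"
    "\<And>t v. t \<in> {a i<..<b i} \<Longrightarrow> (P i has_vector_derivative v) (at (\<rho> t)) \<Longrightarrow>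
        tangent D (cis t) = \<rho>' t *\<^sub>R v"
    "\<And>t. t \<in> {a i<..<b i} \<Longrightarrow> 0 < \<sigma> i * \<rho>' t"
proof (rule traversesE[OF traverses[OF i] ab[OF i] \<sigma>[OF i]])
  fix \<rho> \<rho>'
  assume ends: "\<rho> (a i) = - \<sigma> i" "\<rho> (b i) = \<sigma> i"
    and range: "\<And>t. t \<in> {a i..b i} \<Longrightarrow> \<rho> t \<in> {- 1..1}"
    and cur: "\<And>t. t \<in> {a i..b i} \<Longrightarrow> curve D (cis t) = P i (\<rho> t)"
    and mono: "\<And>s t. s \<in> {a i..b i} \<Longrightarrow> t \<in> {a i..b i} \<Longrightarrow> s < t \<longleftrightarrow> \<sigma> i * \<rho> s < \<sigma> i * \<rho> t"
    and onto: "\<And>u. u \<in> {- 1..1} \<Longrightarrow> \<exists>t\<in>{a i..b i}. \<rho> t = u"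
    and der: "\<And>t. t \<in> {a i<..<b i} \<Longrightarrow> (\<rho> has_real_derivative \<rho>' t) (at t)"
    and pos: "\<And>t. t \<in> {a i<..<b i} \<Longrightarrow> 0 < \<sigma> i * \<rho>' t"
  have inner: "\<exists>t\<in>{a i<..<b i}. \<rho> t = u" if u: "u \<in> {- 1<..<1}" for u
  proof -
    obtain t where t: "t \<in> {a i..b i}" "\<rho> t = u"
      using onto[of u] u by auto
    moreover have "t \<noteq> a i" "t \<noteq> b i"
      using t u ends \<sigma>[OF i] by auto
    ultimately show ?thesis
      by force
  qed
  have tangent: "tangent D (cis t) = \<rho>' t *\<^sub>R v"
    if t: "t \<in> {a i<..<b i}" and v: "(P i has_vector_derivative v) (at (\<rho> t))" for t v
  proof (rule tangent_eqI)
    have "(P i \<circ> \<rho> has_vector_derivative \<rho>' t *\<^sub>R v) (at t)"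
      using der[OF t] v
      by (intro vector_diff_chain_at) (simp_all add: has_real_derivative_iff_has_vector_derivative)
    moreover have "(P i \<circ> \<rho>) s = curve D (cis s)" if "s \<in> {a i<..<b i}" for s
      using cur[of s] that by simp
    ultimately show "((\<lambda>s. curve D (cis s)) has_vector_derivative \<rho>' t *\<^sub>R v) (at t)"
      using t has_vector_derivative_transform_within_open[of "P i \<circ> \<rho>" _ t "{a i<..<b i}"] by simp
  qed
  show ?thesis
    by (rule that[OF range cur mono inner tangent pos])
qed

lemma inj_strand:
  assumes i: "i < k" and inj: "inj_on (P i) {- 1..1}"
    and zw: "z \<in> cis ` {a i..b i}" "w \<in> cis ` {a i..b i}" "curve D z = curve D w"
  shows "z = w"
proof (rule strand_parametrization[OF i])
  fix \<rho>
  assume range: "\<And>t. t \<in> {a i..b i} \<Longrightarrow> \<rho> t \<in> {- 1..1}"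
    and cur: "\<And>t. t \<in> {a i..b i} \<Longrightarrow> curve D (cis t) = P i (\<rho> t)"
    and mono: "\<And>s t. s \<in> {a i..b i} \<Longrightarrow> t \<in> {a i..b i} \<Longrightarrow> s < t \<longleftrightarrow> \<sigma> i * \<rho> s < \<sigma> i * \<rho> t"
  obtain s t where st: "s \<in> {a i..b i}" "t \<in> {a i..b i}" "z = cis s" "w = cis t"
    using zw by blast
  then have "P i (\<rho> s) = P i (\<rho> t)"
    using zw(3) cur by metis
  then have "\<rho> s = \<rho> t"
    using inj range st by (metis inj_onD)
  then have "s = t"
    using mono[OF st(1,2)] mono[OF st(2,1)] by (cases s t rule: linorder_cases) auto
  then show ?thesis
    using st by simp
qed

text \<open>The partner of a parameter on a strand has its image in the disk, so it lies on some
  strand, and by injectivity on a different one.\<close>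

lemma crossing_partner_strand:
  assumes i: "i < k" and inj: "inj_on (P i) {- 1..1}"
    and z: "z \<in> cis ` {a i..b i}" "z \<in> crossing_params D"
  obtains j w where "j < k" "j \<noteq> i" "w \<in> cis ` {a j..b j}" "curve D z = curve D w"
proof -
  obtain w where w: "w \<in> circle" "w \<noteq> z" "curve D w = curve D z"
    using crossing_partner[OF D z(2)] by blast
  obtain j where j: "j < k" "w \<in> cis ` {a j..b j}"
    using strand_partner[OF i z(1) w(1,3)] by blast
  moreover have "j \<noteq> i"
    using inj_strand[OF i inj z(1) _ w(3)[symmetric]] j w(2) by blast
  ultimately show ?thesis
    using that w(3) by metis
qed

lemma virtual_strands:
  assumes inj: "\<And>i. i < k \<Longrightarrow> inj_on (P i) {- 1..1}"
    and virt: "crosses_as (\<lambda>i j. False) k D (\<lambda>i. cis ` {a i..b i})"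
  shows "crossing_params D \<inter> (\<Union>i<k. cis ` {a i..b i}) = {}"
proof (rule ccontr)
  assume "\<not> ?thesis"
  then obtain i z where z: "i < k" "z \<in> cis ` {a i..b i}" "z \<in> crossing_params D"
    by blast
  then obtain j w where "j < k" "j \<noteq> i" "w \<in> cis ` {a j..b j}" "curve D z = curve D w"
    using crossing_partner_strand[OF z(1) inj[OF z(1)] z(2,3)] by blast
  then have "z \<notin> over D" "z \<notin> under D"
    using virt z(1,2) unfolding crosses_as_def by metis+
  then show False
    using z(3) by (simp add: crossing_params_def)
qed

end

lemma local_change_picturesE:
  assumes lc: "local_change P P' Q D D'" and "P \<noteq> []"
    and P: "\<And>i t. i < length P \<Longrightarrow> t \<in> {- 1..1} \<Longrightarrow> norm ((P ! i) t) \<le> 1"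
    and P': "\<And>i t. i < length P \<Longrightarrow> t \<in> {- 1..1} \<Longrightarrow> norm ((P' ! i) t) \<le> 1"
  obtains a b \<sigma> where "diagram_change D D' a b (length P)"
    "picture D ((!) P) a b \<sigma> (length P)" "picture D' ((!) P') a b \<sigma> (length P)"
    "Q D (\<lambda>i. cis ` {a i..b i})" "Q D' (\<lambda>i. cis ` {a i..b i})"
proof (rule local_changeE[OF assms])
  fix a b \<sigma>
  assume dc: "diagram_change D D' a b (length P)"
    and \<sigma>: "\<And>i. i < length P \<Longrightarrow> \<sigma> i \<in> {1, - 1}"
    and tr: "\<And>i. i < length P \<Longrightarrow> traverses D (P ! i) (a i) (b i) (\<sigma> i)"
      "\<And>i. i < length P \<Longrightarrow> traverses D' (P' ! i) (a i) (b i) (\<sigma> i)"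
    and Q: "Q D (\<lambda>i. cis ` {a i..b i})" "Q D' (\<lambda>i. cis ` {a i..b i})"
  interpret diagram_change D D' a b "length P"
    by (rule dc)
  have "picture D ((!) P) a b \<sigma> (length P)"
    by unfold_locales (use D ab disjoint \<sigma> tr P norm_outside in auto)
  moreover have "picture D' ((!) P') a b \<sigma> (length P)"
    by unfold_locales (use D' ab disjoint \<sigma> tr P' norm_outside curve_outside in auto)
  ultimately show ?thesis
    using that[OF dc _ _ Q] by blast
qed

section \<open>The model strands stay in the closed unit disk\<close>

lemma less2_cases: "i < Suc (Suc 0) \<Longrightarrow> i = 0 \<or> i = Suc 0"
  by auto

lemma norm_Complex_le_1: "x\<^sup>2 + y\<^sup>2 \<le> 1 \<Longrightarrow> norm (Complex x y) \<le> 1"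
  by (simp add: cmod_def)

lemma square_le_1: "t \<in> {- 1..1} \<Longrightarrow> t\<^sup>2 \<le> (1::real)"
  by (simp add: abs_square_le_1 abs_le_iff)

lemma norm_plain_strand: "t \<in> {- 1..1} \<Longrightarrow> norm (plain_strand t) \<le> 1"
  unfolding plain_strand_def by (rule norm_Complex_le_1) (use square_le_1 in simp)

lemma norm_kink_strand:
  assumes "t \<in> {- 1..1}" "s \<in> {1, - 1}"
  shows "norm (kink_strand s t) \<le> 1"
  unfolding kink_strand_def
proof (rule norm_Complex_le_1)
  \<comment> \<open>In terms of \<open>x\<close> the squared norm is at most
    \<open>x + (1 - x) / 4\<close>, because \<open>2 * x - 1\<close> lies between -1 and 1.\<close>
  define x where "x = t\<^sup>2"
  have x: "0 \<le> x" "x \<le> 1"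
    using square_le_1[OF assms(1)] by (auto simp: x_def)
  have "(2 * t ^ 3 - t)\<^sup>2 = x * (2 * x - 1)\<^sup>2"
    by (simp add: x_def power2_eq_square power3_eq_cube algebra_simps)
  moreover have "(s * (1 - t\<^sup>2)\<^sup>2 / 2)\<^sup>2 = (1 - x) ^ 4 / 4"
    using assms(2) by (auto simp: x_def power_divide)
  moreover have "x * (2 * x - 1)\<^sup>2 \<le> x * 1"
    using x by (intro mult_left_mono) (auto intro!: abs_square_le_1[THEN iffD2] simp: abs_le_iff)
  moreover have "(1 - x) ^ 4 \<le> (1 - x) ^ 1"
    using x by (intro power_decreasing) auto
  ultimately show "(2 * t ^ 3 - t)\<^sup>2 + (s * (1 - t\<^sup>2)\<^sup>2 / 2)\<^sup>2 \<le> 1"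
    using x by simp
qed

lemma norm_chord_strand:
  assumes "t \<in> {- 1..1}"
  shows "norm (chord_strand t) \<le> 1"
  unfolding chord_strand_def
  by (rule norm_Complex_le_1) (use square_le_1[OF assms] in \<open>simp add: power2_eq_square\<close>)

lemma norm_pushed_chord_strand:
  assumes "t \<in> {- 1..1}"
  shows "norm (pushed_chord_strand t) \<le> 1"
  unfolding pushed_chord_strand_def
proof (rule norm_Complex_le_1)
  \<comment> \<open>The squared norm is \<open>1 - 16/25 * y - 6/5 * y^2 + y^4\<close>, and
    \<open>y^4\<close> is at most \<open>y^2\<close>.\<close>
  define y where "y = 1 - t\<^sup>2"
  have y: "0 \<le> y" "y \<le> 1"
    using square_le_1[OF assms] by (auto simp: y_def)
  have "y * y * (y * y) \<le> y * y * (1 * 1)"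
    using y by (intro mult_left_mono mult_mono) auto
  then have "y * (y * (y * y)) \<le> y * y"
    by (simp add: mult.assoc)
  moreover have "(4 / 5 * t)\<^sup>2 = 16 / 25 * (1 - y)"
    by (simp add: y_def power2_eq_square)
  moreover have "(3 / 5 - y\<^sup>2)\<^sup>2 = 9 / 25 - 6 / 5 * (y * y) + y * (y * (y * y))"
    by (simp add: power2_eq_square algebra_simps)
  moreover have "16 / 25 * (1 - y) + (9 / 25 - 6 / 5 * z + w) \<le> 1" if "w \<le> z" "0 \<le> z" for z w
    using y that by (simp add: field_simps)
  moreover have "0 \<le> y * y"
    using y by simp
  ultimately show "(4 / 5 * t)\<^sup>2 + (3 / 5 - (1 - t\<^sup>2)\<^sup>2)\<^sup>2 \<le> 1"
    unfolding y_def[symmetric] by (simp only:)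
qed

lemma norm_triple_picture:
  assumes "t \<in> {- 1..1}" "s \<in> {1, - 1}" "i < 3"
  shows "norm ((triple_picture s ! i) t) \<le> 1"
proof -
  \<comment> \<open>The squared norm of the third strand is \<open>1 - y + y^4 / 16\<close>. For the
    diameters the 3-4-5 triangle gives \<open>1 - y\<close>.\<close>
  define y where "y = 1 - t\<^sup>2"
  have y: "0 \<le> y" "y \<le> 1"
    using square_le_1[OF assms(1)] by (auto simp: y_def)
  have "y ^ 4 \<le> y ^ 1"
    using y by (intro power_decreasing) auto
  moreover have "(s * y\<^sup>2 / 4)\<^sup>2 = y ^ 4 / 16"
    using assms(2) by (auto simp: power_divide)
  ultimately have "norm (Complex t (s * (1 - t\<^sup>2)\<^sup>2 / 4)) \<le> 1"
    using y by (intro norm_Complex_le_1) (simp add: y_def)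
  moreover have "norm (Complex (3 / 5 * t) (4 / 5 * t)) \<le> 1" "norm (Complex (3 / 5 * t) (- 4 / 5 * t)) \<le> 1"
    using y by (intro norm_Complex_le_1; simp add: y_def power2_eq_square)+
  ultimately show ?thesis
    using assms(3) by (auto simp: triple_picture_def numeral_3_eq_3 less_Suc_eq)
qed

lemma inj_triple_picture: "i < 3 \<Longrightarrow> inj (triple_picture s ! i)"
  by (rule injI) (auto simp: triple_picture_def numeral_3_eq_3 less_Suc_eq)

section \<open>The purely virtual moves\<close>

lemma Phi_VRIII:
  assumes "directed_move VRIII D D'" "0 < n"
  shows "Phi n f D = Phi n f D'"
proof (rule local_change_picturesE)
  show "local_change (triple_picture 1) (triple_picture (-1)) (crosses_as (\<lambda>i j. False) 3) D D'"
    using assms by simp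
  have len: "length (triple_picture s) = 3" for s
    by (simp add: triple_picture_def)
  show "triple_picture 1 \<noteq> []"
    by (simp add: triple_picture_def)
  show "norm ((triple_picture 1 ! i) t) \<le> 1" "norm ((triple_picture (-1) ! i) t) \<le> 1"
    if "i < length (triple_picture 1)" "t \<in> {- 1..1}" for i t
    using that norm_triple_picture by (auto simp: len)
  fix a b \<sigma>
  assume dc: "diagram_change D D' a b (length (triple_picture 1))"
    and pic: "picture D ((!) (triple_picture 1)) a b \<sigma> (length (triple_picture 1))"
      "picture D' ((!) (triple_picture (-1))) a b \<sigma> (length (triple_picture 1))"
    and Q: "crosses_as (\<lambda>i j. False) 3 D (\<lambda>i. cis ` {a i..b i})"
      "crosses_as (\<lambda>i j. False) 3 D' (\<lambda>i. cis ` {a i..b i})"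
  interpret diagram_change D D' a b "length (triple_picture 1)"
    by (rule dc)
  have "crossing_params D \<inter> strands = {}" "crossing_params D' \<inter> strands = {}"
    using picture.virtual_strands[OF pic(1)] picture.virtual_strands[OF pic(2)] Q
    unfolding strands_def strand_def by (simp_all add: len inj_on_subset[OF inj_triple_picture])
  then show ?thesis
    using assms(2) by (rule Phi_change_virtual)
qed

lemma Phi_VRII:
  assumes "directed_move VRII D D'" "0 < n"
  shows "Phi n f D = Phi n f D'"
proof (rule local_change_picturesE)
  show "local_change [plain_strand, chord_strand] [plain_strand, pushed_chord_strand]
      (crosses_as (\<lambda>i j. False) 2) D D'"
    using assms by simp
  have inj: "inj plain_strand" "inj chord_strand" "inj pushed_chord_strand"
    by (auto intro!: injI simp: plain_strand_def chord_strand_def pushed_chord_strand_def)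
  show "norm (([plain_strand, chord_strand] ! i) t) \<le> 1"
    "norm (([plain_strand, pushed_chord_strand] ! i) t) \<le> 1"
    if "i < length [plain_strand, chord_strand]" "t \<in> {- 1..1}" for i t
    using that less2_cases[of i] norm_plain_strand norm_chord_strand norm_pushed_chord_strand by auto
  fix a b \<sigma>
  assume dc: "diagram_change D D' a b (length [plain_strand, chord_strand])"
    and pic: "picture D ((!) [plain_strand, chord_strand]) a b \<sigma> (length [plain_strand, chord_strand])"
      "picture D' ((!) [plain_strand, pushed_chord_strand]) a b \<sigma> (length [plain_strand, chord_strand])"
    and Q: "crosses_as (\<lambda>i j. False) 2 D (\<lambda>i. cis ` {a i..b i})"
      "crosses_as (\<lambda>i j. False) 2 D' (\<lambda>i. cis ` {a i..b i})"
  interpret diagram_change D D' a b "length [plain_strand, chord_strand]"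
    by (rule dc)
  have "inj_on ([plain_strand, chord_strand] ! i) {- 1..1}"
    "inj_on ([plain_strand, pushed_chord_strand] ! i) {- 1..1}" if "i < length [plain_strand, chord_strand]" for i
    using less2_cases[of i] that inj by (auto intro: inj_on_subset)
  then have "crossing_params D \<inter> strands = {}" "crossing_params D' \<inter> strands = {}"
    using picture.virtual_strands[OF pic(1)] picture.virtual_strands[OF pic(2)] Q
    unfolding strands_def strand_def by (simp_all add: numeral_2_eq_2)
  then show ?thesis
    using assms(2) by (rule Phi_change_virtual)
qed simp

text \<open>The kink strand is not injective, so \<open>virtual_strands\<close> does not apply to
  it; \<open>virtual_kink\<close> itself excludes crossing parameters on the strand.\<close>

lemma Phi_VRI:
  assumes "directed_move VRI D D'" "0 < n"
  shows "Phi n f D = Phi n f D'"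
proof -
  obtain s where s: "s \<in> {1, - 1}" and lc: "local_change [plain_strand] [kink_strand s] virtual_kink D D'"
    using assms by auto
  show ?thesis
  proof (rule local_change_picturesE[OF lc])
    fix a b
    assume dc: "diagram_change D D' a b (length [plain_strand])"
      and Q: "virtual_kink D (\<lambda>i. cis ` {a i..b i})" "virtual_kink D' (\<lambda>i. cis ` {a i..b i})"
    interpret diagram_change D D' a b "length [plain_strand]"
      by (rule dc)
    have "crossing_params D \<inter> strands = {}" "crossing_params D' \<inter> strands = {}"
      using Q unfolding virtual_kink_def strands_def strand_def by (auto simp: crossing_params_def)
    then show ?thesis
      using assms(2) by (rule Phi_change_virtual)
  qed (use s norm_plain_strand norm_kink_strand in auto)
qed


section \<open>The first move\<close>

lemma cocycle_diag:
  assumes "up_down_cocycle n f" "0 < n"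
  shows "f (x mod int n) (x mod int n) \<epsilon> = 0"
proof -
  have "x mod int n \<in> {0..<int n}"
    using assms(2) by simp
  then show ?thesis
    using assms(1) unfolding up_down_cocycle_def Let_def by (metis mod_mod_trivial)
qed

text \<open>The ordinate determines the square of the parameter, which forces
  \<open>u = - t\<close>. The abscissa is odd, so it must vanish, and \<open>t\<close> is
  nonzero.\<close>

lemma kink_strand_eq_iff:
  assumes s: "s \<in> {1, - 1}" and tu: "t \<in> {- 1..1}" "u \<in> {- 1..1}" "t \<noteq> u"
  shows "kink_strand s t = kink_strand s u \<longleftrightarrow> u = - t \<and> 2 * t\<^sup>2 = 1"
proof
  assume eq: "kink_strand s t = kink_strand s u"
  then have "(1 - t\<^sup>2)\<^sup>2 = (1 - u\<^sup>2)\<^sup>2"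
    using s by (auto simp: kink_strand_def)
  moreover have "0 \<le> 1 - t\<^sup>2" "0 \<le> 1 - u\<^sup>2"
    using square_le_1 tu by auto
  ultimately have "1 - t\<^sup>2 = 1 - u\<^sup>2"
    using power2_eq_iff_nonneg by blast
  then have u: "u = - t"
    using tu(3) by (auto simp: power2_eq_iff)
  have "t * (2 * t\<^sup>2 - 1) = 0"
    using eq u by (simp add: kink_strand_def power2_eq_square power3_eq_cube algebra_simps)
  then show "u = - t \<and> 2 * t\<^sup>2 = 1"
    using u tu(3) by auto
next
  assume "u = - t \<and> 2 * t\<^sup>2 = 1"
  then have "u = - t" "t * (2 * t\<^sup>2 - 1) = 0"
    by auto
  then show "kink_strand s t = kink_strand s u"
    by (simp add: kink_strand_def power2_eq_square power3_eq_cube algebra_simps)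
qed

text \<open>There is only one strand, so the partner of a crossing parameter on it lies on the kink
  itself, where \<open>kink_strand_eq_iff\<close> leaves a single pair.\<close>

lemma kink_double_point:
  assumes pic: "picture D P a b \<sigma> 1" and P: "P 0 = kink_strand s" and s: "s \<in> {1, - 1}"
  obtains t u where "a 0 < t" "t < u" "u < b 0" "curve D (cis t) = curve D (cis u)" "cis t \<noteq> cis u"
    "cis ` {a 0..b 0} \<inter> crossing_params D \<subseteq> {cis t, cis u}"
proof -
  interpret picture D P a b \<sigma> 1
    by (rule pic)
  define r :: real where "r = 1 / sqrt 2"
  have r: "2 * r\<^sup>2 = 1" "0 < r" "r < 1"
    by (simp_all add: r_def power_divide)
  show ?thesis
  proof (rule strand_parametrization[of 0])
    fix \<rho>
    assume range: "\<And>t. t \<in> {a 0..b 0} \<Longrightarrow> \<rho> t \<in> {- 1..1}"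
      and cur: "\<And>t. t \<in> {a 0..b 0} \<Longrightarrow> curve D (cis t) = P 0 (\<rho> t)"
      and mono: "\<And>s t. s \<in> {a 0..b 0} \<Longrightarrow> t \<in> {a 0..b 0} \<Longrightarrow> s < t \<longleftrightarrow> \<sigma> 0 * \<rho> s < \<sigma> 0 * \<rho> t"
      and onto: "\<And>u. u \<in> {- 1<..<1} \<Longrightarrow> \<exists>t\<in>{a 0<..<b 0}. \<rho> t = u"
    have \<sigma>0: "\<sigma> 0 \<in> {1, - 1}"
      using \<sigma> by simp
    \<comment> \<open>The factor \<open>- \<sigma> 0\<close> makes this the earlier of the two
      passages for either direction of travel.\<close>
    obtain t where t: "t \<in> {a 0<..<b 0}" "\<rho> t = - \<sigma> 0 * r"
      using onto[of "- \<sigma> 0 * r"] \<sigma>0 r by auto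
    obtain u where u: "u \<in> {a 0<..<b 0}" "\<rho> u = \<sigma> 0 * r"
      using onto[of "\<sigma> 0 * r"] \<sigma>0 r by auto
    have "t < u"
      using mono[of t u] t u \<sigma>0 r by auto
    have inj: "x = y" if "x \<in> {a 0..b 0}" "y \<in> {a 0..b 0}" "\<rho> x = \<rho> y" for x y
      using mono[OF that(1,2)] mono[OF that(2,1)] that(3) by (cases x y rule: linorder_cases) auto
    have sq: "2 * (\<rho> t)\<^sup>2 = 1" "\<rho> u = - \<rho> t" "\<rho> t \<noteq> \<rho> u"
      using t u \<sigma>0 r by auto
    have "curve D (cis t) = curve D (cis u)"
      using kink_strand_eq_iff[OF s, of "\<rho> t" "\<rho> u"] sq range[of t] range[of u] cur[of t] cur[of u] t(1) u(1) P
      by simp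
    moreover have "cis t \<noteq> cis u"
      using cis_inj_window[of t u] \<open>t < u\<close> t u ab_turn[of 0] by auto
    moreover have "z \<in> {cis t, cis u}" if z: "z \<in> cis ` {a 0..b 0} \<inter> crossing_params D" for z
    proof -
      obtain w where w: "w \<in> circle" "w \<noteq> z" "curve D w = curve D z"
        using crossing_partner[OF D] z by blast
      have "w \<in> (\<Union>j<1. cis ` {a j..b j})"
        using z w by (intro strand_partner[of 0 z]) auto
      then obtain y where y: "y \<in> {a 0..b 0}" "w = cis y"
        by auto
      obtain x where x: "x \<in> {a 0..b 0}" "z = cis x"
        using z by blast
      have "\<rho> x \<noteq> \<rho> y"
        using inj[OF x(1) y(1)] w(2) x(2) y(2) by blast
      then have "2 * (\<rho> x)\<^sup>2 = 1"
        using kink_strand_eq_iff[OF s range[OF x(1)] range[OF y(1)]] cur[OF x(1)] cur[OF y(1)] w(3) x(2) y(2) P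
        by simp
      then have "(\<rho> x)\<^sup>2 = (\<rho> t)\<^sup>2"
        using sq by simp
      then have "\<rho> x = \<rho> t \<or> \<rho> x = \<rho> u"
        using sq(2) by (auto simp: power2_eq_iff)
      then have "x = t \<or> x = u"
        using inj[OF x(1)] t(1) u(1) by auto
      then show ?thesis
        using x by auto
    qed
    ultimately show ?thesis
      using that[of t u] t u \<open>t < u\<close> by auto
  qed simp
qed

lemma Phi_RI:
  assumes "directed_move RI D D'" and n: "0 < n" and f: "up_down_cocycle n f"
  shows "Phi n f D = Phi n f D'"
proof -
  obtain s where s: "s \<in> {1, - 1}" and lc: "local_change [plain_strand] [kink_strand s] real_kink D D'"
    using assms by auto
  show ?thesis
  proof (rule local_change_picturesE[OF lc])
    fix a b \<sigma>
    assume dc: "diagram_change D D' a b (length [plain_strand])"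
      and pic: "picture D ((!) [plain_strand]) a b \<sigma> (length [plain_strand])"
        "picture D' ((!) [kink_strand s]) a b \<sigma> (length [plain_strand])"
      and Q: "real_kink D' (\<lambda>i. cis ` {a i..b i})"
    interpret diagram_change D D' a b 1
      using dc by simp
    have strands: "strands = cis ` {a 0..b 0}"
      unfolding strands_def strand_def by auto
    have "inj plain_strand"
      by (auto intro!: injI simp: plain_strand_def)
    then have inj: "inj_on ([plain_strand] ! 0) {- 1..1}"
      by (auto intro: inj_on_subset)
    have plain: "crossing_params D \<inter> strands = {}"
    proof (rule ccontr)
      assume "\<not> ?thesis"
      then obtain z where z: "z \<in> cis ` {a 0..b 0}" "z \<in> crossing_params D"
        using strands by blast
      show False
        by (rule picture.crossing_partner_strand[OF pic(1) _ inj z]) auto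
    qed
    obtain t u where tu: "a 0 < t" "t < u" "u < b 0"
      and eq: "curve D' (cis t) = curve D' (cis u)" and neq: "cis t \<noteq> cis u"
      and sub: "cis ` {a 0..b 0} \<inter> crossing_params D' \<subseteq> {cis t, cis u}"
      using kink_double_point[of D' "(!) [kink_strand s]" a b \<sigma> s] pic(2) s by auto
    have ts: "cis t \<in> strands" "cis u \<in> strands"
      using tu strands by auto
    have "cis t \<in> double_params D'"
      using eq neq unfolding double_params_def by (auto intro!: bexI[of _ "cis u"])
    moreover have "cis u \<in> double_params D'"
      using eq neq unfolding double_params_def by (auto intro!: bexI[of _ "cis t"])
    ultimately have "cis t \<in> crossing_params D'" "cis u \<in> crossing_params D'"
      using Q ts unfolding real_kink_def strands crossing_params_def by blast+
    then have kink: "crossing_params D' \<inter> strands = {cis t, cis u}"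
      using sub ts unfolding strands by blast
    have ou: "cis t \<in> over D' \<longleftrightarrow> cis u \<in> under D'" "cis u \<in> over D' \<longleftrightarrow> cis t \<in> under D'"
      using crossing_iff[OF D', of "cis t" "cis u"] crossing_iff[OF D', of "cis u" "cis t"] eq neq by auto
    have jumps: "jump D' (cis t) + jump D' (cis u) = 0"
      using ou by (auto simp: jump_def)
    show ?thesis
    proof (rule Phi_change)
      fix i :: nat assume "i < 1"
      then have "strand i = strands"
        unfolding strands_def by auto
      then show "rise D (strand i) = rise D' (strand i)"
        using plain kink jumps neq by (simp add: rise_def)
    next
      fix g g' assume g': "level D' g'"
      have "cis r \<notin> crossing_params D'" if r: "t < r" "r < u" for r
      proof -
        have "cis r \<noteq> cis t" "cis r \<noteq> cis u"
          using cis_inj_window[of r t] cis_inj_window[of r u] r tu ab(2)[of 0] by auto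
        moreover have "cis r \<in> strands"
          using r tu strands by auto
        ultimately show ?thesis
          using kink by blast
      qed
      then have lev: "g' (cis u) = g' (cis t) + jump D' (cis t)"
        using tu ab(2)[of 0] by (intro level_after[OF g']) auto
      have "crossing_weight n f D' g' c = 0" if c: "c \<in> real_crossings D' \<inter> strands \<times> strands" for c
      proof -
        obtain p q where pq: "c = (p, q)" "p \<in> over D'" "q \<in> under D'" "p \<in> strands" "q \<in> strands" "p \<noteq> q"
          using c real_crossingD[OF D'] by (cases c) auto
        then have "p \<in> {cis t, cis u}" "q \<in> {cis t, cis u}"
          using kink by (auto simp: crossing_params_def)
        \<comment> \<open>If the over-passage comes first, the level rises by 1 from
          \<open>p\<close> to \<open>q\<close>; if the under-passage comes first, it falls by 1 from
          \<open>q\<close> to \<open>p\<close>. The relation is the same, and for either sign of the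
          crossing it makes the two arguments of \<open>f\<close> equal.\<close>
        then have "g' q = g' p + 1"
          using pq lev over_under_disjoint[OF D'] by (auto simp: jump_def)
        then show ?thesis
          using cocycle_diag[OF f n] by (simp add: crossing_weight_def pq(1))
      qed
      moreover have "real_crossings D \<inter> strands \<times> strands = {}"
        using plain by (auto simp: real_crossings_def crossing_params_def)
      ultimately show "(\<Sum>c\<in>real_crossings D \<inter> strands \<times> strands. crossing_weight n f D g c) =
          (\<Sum>c\<in>real_crossings D' \<inter> strands \<times> strands. crossing_weight n f D' g' c)"
        by simp
    qed (rule n)
  qed (use s norm_plain_strand norm_kink_strand in auto)
qed


section \<open>Pictures with single crossings\<close>

text \<open>Here \<open>u i j\<close> is the parameter of strand \<open>i\<close> at its meeting
  with strand \<open>j\<close>, \<open>r i j\<close> says that \<open>i\<close> is over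
  \<open>j\<close>, and \<open>c i\<close> is the level at which \<open>i\<close> enters the disk.
  The sum runs over the meetings passed before the one with \<open>j\<close>; the factor
  \<open>\<sigma> i\<close> orders them in the direction of travel.\<close>

definition strand_level ::
    "nat \<Rightarrow> (nat \<Rightarrow> real) \<Rightarrow> (nat \<Rightarrow> nat \<Rightarrow> real) \<Rightarrow> (nat \<Rightarrow> nat \<Rightarrow> bool) \<Rightarrow> (nat \<Rightarrow> int) \<Rightarrow> nat \<Rightarrow> nat \<Rightarrow> int"
  where "strand_level k \<sigma> u r c i j =
    c i + (\<Sum>l | l < k \<and> l \<noteq> i \<and> \<sigma> i * u i l < \<sigma> i * u i j. of_bool (r i l) - of_bool (r l i))"

text \<open>\<open>v i j\<close> is the velocity of strand \<open>i\<close> at its meeting with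
  \<open>j\<close>. Traversing a strand backwards reverses its tangent, whence the factors
  \<open>\<sigma> i * \<sigma> j\<close> in the sign. The over-strand comes first in the
  pair.\<close>

definition strand_weight ::
    "nat \<Rightarrow> (int \<Rightarrow> int \<Rightarrow> sign \<Rightarrow> 'a::ab_group_add) \<Rightarrow> nat \<Rightarrow> (nat \<Rightarrow> real) \<Rightarrow> (nat \<Rightarrow> nat \<Rightarrow> real) \<Rightarrow>
     (nat \<Rightarrow> nat \<Rightarrow> complex) \<Rightarrow> (nat \<Rightarrow> nat \<Rightarrow> bool) \<Rightarrow> (nat \<Rightarrow> int) \<Rightarrow> nat \<times> nat \<Rightarrow> 'a"
  where "strand_weight n f k \<sigma> u v r c = (\<lambda>(i, j).
    if 0 < \<sigma> i * \<sigma> j * det2 (v i j) (v j i)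
    then f (strand_level k \<sigma> u r c j i mod int n) ((strand_level k \<sigma> u r c i j + 1) mod int n) Pos
    else f ((strand_level k \<sigma> u r c j i - 1) mod int n) (strand_level k \<sigma> u r c i j mod int n) Neg)"

definition crossing_pairs :: "nat \<Rightarrow> (nat \<Rightarrow> nat \<Rightarrow> bool) \<Rightarrow> (nat \<times> nat) set"
  where "crossing_pairs k r = {(i, j). i < k \<and> j < k \<and> i \<noteq> j \<and> r i j}"

text \<open>Any two strands meet exactly once and in their interior, so a crossing is named by an
  ordered pair of strands. Kinks and bigons are outside this scheme.\<close>

locale crossing_picture = picture +
  fixes u :: "nat \<Rightarrow> nat \<Rightarrow> real" and v :: "nat \<Rightarrow> nat \<Rightarrow> complex" and r :: "nat \<Rightarrow> nat \<Rightarrow> bool"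
  assumes cross: "\<lbrakk>i < k; j < k; i \<noteq> j; s \<in> {- 1..1}; t \<in> {- 1..1}\<rbrakk> \<Longrightarrow>
      P i s = P j t \<longleftrightarrow> s = u i j \<and> t = u j i"
    and u: "\<lbrakk>i < k; j < k; i \<noteq> j\<rbrakk> \<Longrightarrow> u i j \<in> {- 1<..<1}"
    and u_distinct: "\<lbrakk>i < k; j < k; l < k; i \<noteq> j; i \<noteq> l; j \<noteq> l\<rbrakk> \<Longrightarrow> u i j \<noteq> u i l"
    and v: "\<lbrakk>i < k; j < k; i \<noteq> j\<rbrakk> \<Longrightarrow> (P i has_vector_derivative v i j) (at (u i j))"
    and inj: "i < k \<Longrightarrow> inj_on (P i) {- 1..1}"
    and crosses: "crosses_as r k D (\<lambda>i. cis ` {a i..b i})"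
    and asym: "r i j \<Longrightarrow> \<not> r j i"
begin

definition theta :: "nat \<Rightarrow> nat \<Rightarrow> real"
  where "theta i j = (SOME t. t \<in> {a i<..<b i} \<and> curve D (cis t) = P i (u i j))"

lemma theta:
  assumes ij: "i < k" "j < k" "i \<noteq> j"
  shows "theta i j \<in> {a i<..<b i}" "curve D (cis (theta i j)) = P i (u i j)"
proof -
  have "\<exists>t. t \<in> {a i<..<b i} \<and> curve D (cis t) = P i (u i j)"
  proof (rule strand_parametrization[OF ij(1)])
    fix \<rho>
    assume cur: "\<And>t. t \<in> {a i..b i} \<Longrightarrow> curve D (cis t) = P i (\<rho> t)"
      and onto: "\<And>u. u \<in> {- 1<..<1} \<Longrightarrow> \<exists>t\<in>{a i<..<b i}. \<rho> t = u"
    obtain t where "t \<in> {a i<..<b i}" "\<rho> t = u i j"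
      using onto u[OF ij] by blast
    then show ?thesis
      using cur[of t] by auto
  qed
  then have "theta i j \<in> {a i<..<b i} \<and> curve D (cis (theta i j)) = P i (u i j)"
    unfolding theta_def by (rule someI_ex)
  then show "theta i j \<in> {a i<..<b i}" "curve D (cis (theta i j)) = P i (u i j)"
    by auto
qed

lemma theta_on_strand: "\<lbrakk>i < k; j < k; i \<noteq> j\<rbrakk> \<Longrightarrow> cis (theta i j) \<in> cis ` {a i..b i}"
  using theta(1) by fastforce

lemma theta_parameter:
  assumes ij: "i < k" "j < k" "i \<noteq> j"
    and range: "\<And>t. t \<in> {a i..b i} \<Longrightarrow> \<rho> t \<in> {- 1..1}"
    and cur: "\<And>t. t \<in> {a i..b i} \<Longrightarrow> curve D (cis t) = P i (\<rho> t)"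
  shows "\<rho> (theta i j) = u i j"
proof -
  have mem: "theta i j \<in> {a i..b i}"
    using theta(1)[OF ij] by auto
  then have "P i (\<rho> (theta i j)) = P i (u i j)"
    using theta(2)[OF ij] cur by metis
  moreover have "u i j \<in> {- 1..1}"
    using u[OF ij] by auto
  ultimately show ?thesis
    using inj_onD[OF inj[OF ij(1)]] range[OF mem] by blast
qed

text \<open>The product of \<open>\<sigma> i\<close> with the parameter increases along the strand,
  so the order of crossings on the circle becomes a comparison of fixed numbers of the
  picture.\<close>

lemma theta_less_iff:
  assumes "i < k" "j < k" "i \<noteq> j" "l < k" "i \<noteq> l"
  shows "theta i l < theta i j \<longleftrightarrow> \<sigma> i * u i l < \<sigma> i * u i j"
proof (rule strand_parametrization[OF assms(1)])
  fix \<rho>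
  assume range: "\<And>t. t \<in> {a i..b i} \<Longrightarrow> \<rho> t \<in> {- 1..1}"
    and cur: "\<And>t. t \<in> {a i..b i} \<Longrightarrow> curve D (cis t) = P i (\<rho> t)"
    and mono: "\<And>s t. s \<in> {a i..b i} \<Longrightarrow> t \<in> {a i..b i} \<Longrightarrow> s < t \<longleftrightarrow> \<sigma> i * \<rho> s < \<sigma> i * \<rho> t"
  have "\<rho> (theta i j) = u i j" "\<rho> (theta i l) = u i l"
    using theta_parameter[of i _ \<rho>] assms range cur by blast+
  moreover have "theta i j \<in> {a i..b i}" "theta i l \<in> {a i..b i}"
    using theta(1)[of i j] theta(1)[of i l] assms by auto
  ultimately show ?thesis
    using mono[of "theta i l" "theta i j"] by simp
qed

lemma tangent_theta:
  assumes ij: "i < k" "j < k" "i \<noteq> j"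
  obtains c where "0 < \<sigma> i * c" "tangent D (cis (theta i j)) = c *\<^sub>R v i j"
proof (rule strand_parametrization[OF ij(1)])
  fix \<rho> \<rho>'
  assume range: "\<And>t. t \<in> {a i..b i} \<Longrightarrow> \<rho> t \<in> {- 1..1}"
    and cur: "\<And>t. t \<in> {a i..b i} \<Longrightarrow> curve D (cis t) = P i (\<rho> t)"
    and tangent: "\<And>t v. t \<in> {a i<..<b i} \<Longrightarrow> (P i has_vector_derivative v) (at (\<rho> t)) \<Longrightarrow>
        tangent D (cis t) = \<rho>' t *\<^sub>R v"
    and pos: "\<And>t. t \<in> {a i<..<b i} \<Longrightarrow> 0 < \<sigma> i * \<rho>' t"
  have "\<rho> (theta i j) = u i j"
    using theta_parameter[OF ij, of \<rho>] range cur by blast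
  then show ?thesis
    using that[of "\<rho>' (theta i j)"] pos[OF theta(1)[OF ij]] tangent[OF theta(1)[OF ij]] v[OF ij] by simp
qed

text \<open>The tangents of the diagram are multiples of the velocities of the picture by factors
  that have the signs of \<open>\<sigma> i\<close> and \<open>\<sigma> j\<close>.\<close>

lemma positive_theta:
  assumes ij: "i < k" "j < k" "i \<noteq> j"
  shows "positive_crossing D (cis (theta i j), cis (theta j i)) \<longleftrightarrow>
    0 < \<sigma> i * \<sigma> j * det2 (v i j) (v j i)"
proof -
  obtain c where c: "0 < \<sigma> i * c" "tangent D (cis (theta i j)) = c *\<^sub>R v i j"
    using tangent_theta[OF ij] by blast
  obtain d where d: "0 < \<sigma> j * d" "tangent D (cis (theta j i)) = d *\<^sub>R v j i"
    using tangent_theta[OF ij(2,1) ij(3)[symmetric]] by blast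
  have "\<sigma> i \<in> {1, - 1}" "\<sigma> j \<in> {1, - 1}"
    using \<sigma> ij by blast+
  then show ?thesis
    using c d by (auto simp: positive_crossing_def det2_scaleR zero_less_mult_iff mult_less_0_iff)
qed

lemma crossing_at_theta:
  assumes ij: "i < k" "j < k" "i \<noteq> j" and zw: "z \<in> cis ` {a i..b i}" "w \<in> cis ` {a j..b j}"
  shows "curve D z = curve D w \<longleftrightarrow> z = cis (theta i j) \<and> w = cis (theta j i)"
proof
  have u': "u i j \<in> {- 1..1}" "u j i \<in> {- 1..1}"
    using u[OF ij] u[OF ij(2,1) ij(3)[symmetric]] by auto
  have P: "P i (u i j) = P j (u j i)"
    using cross[OF ij u'] by simp
  show "curve D z = curve D w" if "z = cis (theta i j) \<and> w = cis (theta j i)"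
    using that theta(2)[OF ij] theta(2)[OF ij(2,1) ij(3)[symmetric]] P by simp
  assume eq: "curve D z = curve D w"
  obtain s where s: "s \<in> {- 1..1}" "curve D z = P i s"
    using on_strand[OF ij(1) zw(1)] by blast
  obtain t where t: "t \<in> {- 1..1}" "curve D w = P j t"
    using on_strand[OF ij(2) zw(2)] by blast
  have "s = u i j" "t = u j i"
    using cross[OF ij s(1) t(1)] eq s t by auto
  then have "curve D z = curve D (cis (theta i j))" "curve D w = curve D (cis (theta j i))"
    using s t theta(2)[OF ij] theta(2)[OF ij(2,1) ij(3)[symmetric]] by auto
  then show "z = cis (theta i j) \<and> w = cis (theta j i)"
    using inj_strand[OF ij(1) inj[OF ij(1)] zw(1) theta_on_strand[OF ij]]
      inj_strand[OF ij(2) inj[OF ij(2)] zw(2) theta_on_strand[OF ij(2,1) ij(3)[symmetric]]] by blast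
qed

lemma over_theta: "\<lbrakk>i < k; j < k; i \<noteq> j\<rbrakk> \<Longrightarrow> cis (theta i j) \<in> over D \<longleftrightarrow> r i j"
  and under_theta: "\<lbrakk>i < k; j < k; i \<noteq> j\<rbrakk> \<Longrightarrow> cis (theta i j) \<in> under D \<longleftrightarrow> r j i"
proof -
  assume ij: "i < k" "j < k" "i \<noteq> j"
  have "curve D (cis (theta i j)) = curve D (cis (theta j i))"
    using crossing_at_theta[OF ij theta_on_strand[OF ij] theta_on_strand[OF ij(2,1) ij(3)[symmetric]]]
    by simp
  then show "cis (theta i j) \<in> over D \<longleftrightarrow> r i j" "cis (theta i j) \<in> under D \<longleftrightarrow> r j i"
    using crosses theta_on_strand[OF ij] theta_on_strand[OF ij(2,1) ij(3)[symmetric]] ij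
    unfolding crosses_as_def by blast+
qed

lemma crossing_params_strand:
  assumes i: "i < k" and z: "z \<in> cis ` {a i..b i}" "z \<in> crossing_params D"
  obtains j where "j < k" "i \<noteq> j" "z = cis (theta i j)"
proof (rule crossing_partner_strand[OF i inj[OF i] z])
  fix j w assume "j < k" "j \<noteq> i" "w \<in> cis ` {a j..b j}" "curve D z = curve D w"
  then show ?thesis
    using crossing_at_theta[OF i _ _ z(1)] that by metis
qed

lemma jump_theta:
  "\<lbrakk>i < k; j < k; i \<noteq> j\<rbrakk> \<Longrightarrow> jump D (cis (theta i j)) = of_bool (r i j) - of_bool (r j i)"
  by (simp add: jump_def over_theta under_theta)

text \<open>The sum may include virtual crossings, where both indicators vanish. Distinctness of the
  meeting parameters ensures one term per angle.\<close>

lemma rise_strand: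
  assumes i: "i < k" and A: "A \<subseteq> {a i..b i}"
  shows "rise D (cis ` A) = (\<Sum>l | l < k \<and> l \<noteq> i \<and> theta i l \<in> A. of_bool (r i l) - of_bool (r l i))"
proof -
  define J where "J = {l. l < k \<and> l \<noteq> i \<and> theta i l \<in> A}"
  have J: "l < k" "i \<noteq> l" "theta i l \<in> A" if "l \<in> J" for l
    using that by (auto simp: J_def)
  have inj: "inj_on (\<lambda>l. cis (theta i l)) J"
  proof (rule inj_onI)
    fix l m assume lm: "l \<in> J" "m \<in> J" "cis (theta i l) = cis (theta i m)"
    have "theta i l \<in> {a i..b i}" "theta i m \<in> {a i..b i}"
      using J lm A by blast+
    then have "theta i l = theta i m"
      using cis_inj_window[OF lm(3)] ab[OF i] ab_turn[OF i] by auto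
    then have "u i l = u i m"
      using theta_less_iff[of i l m] theta_less_iff[of i m l] i J lm \<sigma>[OF i] by auto
    then show "l = m"
      using u_distinct[of i l m] i J lm by blast
  qed
  have sub: "crossing_params D \<inter> cis ` A \<subseteq> (\<lambda>l. cis (theta i l)) ` J"
  proof
    fix z assume z: "z \<in> crossing_params D \<inter> cis ` A"
    then obtain t where t: "t \<in> A" "z = cis t"
      by blast
    obtain l where l: "l < k" "i \<noteq> l" "z = cis (theta i l)"
      using crossing_params_strand[OF i, of z] z A by blast
    have "theta i l = t"
      using cis_inj_window[of "theta i l" t] t l theta(1)[OF i l(1,2)] A ab_turn[OF i] by fastforce
    then show "z \<in> (\<lambda>l. cis (theta i l)) ` J"
      using t l by (auto simp: J_def)
  qed
  have "rise D (cis ` A) = sum (jump D) ((\<lambda>l. cis (theta i l)) ` J)"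
    unfolding rise_def
  proof (rule sum.mono_neutral_left[OF _ sub])
    show "\<forall>z\<in>(\<lambda>l. cis (theta i l)) ` J - crossing_params D \<inter> cis ` A. jump D z = 0"
      using jump_notin J by blast
  qed (simp add: J_def)
  also have "\<dots> = (\<Sum>l\<in>J. jump D (cis (theta i l)))"
    using inj by (simp add: sum.reindex)
  also have "\<dots> = (\<Sum>l\<in>J. of_bool (r i l) - of_bool (r l i))"
    using J i by (intro sum.cong) (auto simp: jump_theta)
  finally show ?thesis
    by (simp add: J_def)
qed

text \<open>The right side involves only \<open>k\<close>, \<open>i\<close> and \<open>r\<close>,
  which the two pictures of a move share; it supplies the condition on net jumps in
  \<open>Phi_change\<close>.\<close>

lemma rise_whole_strand:
  assumes i: "i < k"
  shows "rise D (cis ` {a i..b i}) = (\<Sum>l | l < k \<and> l \<noteq> i. of_bool (r i l) - of_bool (r l i))"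
proof -
  have "{l. l < k \<and> l \<noteq> i \<and> theta i l \<in> {a i..b i}} = {l. l < k \<and> l \<noteq> i}"
    using theta(1) i by fastforce
  then show ?thesis
    using rise_strand[OF i, of "{a i..b i}"] by simp
qed

lemma level_theta:
  assumes g: "level D g" and ij: "i < k" "j < k" "i \<noteq> j"
  shows "g (cis (theta i j)) = strand_level k \<sigma> u r (\<lambda>i. g (cis (a i))) i j"
proof -
  have t: "theta i j \<in> {a i<..<b i}"
    by (rule theta(1)[OF ij])
  then have "g (cis (theta i j)) = g (cis (a i)) + rise D (cis ` {a i..<theta i j})"
    using levelD[OF g, of "a i" "theta i j"] ab_turn[OF ij(1)] by auto
  moreover have "{l. l < k \<and> l \<noteq> i \<and> theta i l \<in> {a i..<theta i j}} =
      {l. l < k \<and> l \<noteq> i \<and> \<sigma> i * u i l < \<sigma> i * u i j}"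
  proof (intro Collect_cong conj_cong refl)
    fix l assume l: "l < k" "l \<noteq> i"
    then show "theta i l \<in> {a i..<theta i j} \<longleftrightarrow> \<sigma> i * u i l < \<sigma> i * u i j"
      using theta_less_iff[OF ij, of l] theta(1)[OF ij(1), of l] by auto
  qed
  moreover have "{a i..<theta i j} \<subseteq> {a i..b i}"
    using t by auto
  ultimately show ?thesis
    using rise_strand[OF ij(1), of "{a i..<theta i j}"] by (simp add: strand_level_def)
qed

lemma crossings_inside:
  defines "U \<equiv> \<Union>i<k. cis ` {a i..b i}"
  shows "real_crossings D \<inter> U \<times> U = (\<lambda>(i, j). (cis (theta i j), cis (theta j i))) ` crossing_pairs k r"
proof (intro equalityI subsetI)
  fix c assume c: "c \<in> real_crossings D \<inter> U \<times> U"
  then obtain p q i where pq: "c = (p, q)" and i: "i < k" "p \<in> cis ` {a i..b i}"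
    and cr: "(p, q) \<in> real_crossings D"
    unfolding U_def by auto
  note cr' = real_crossingD[OF D cr]
  obtain j where j: "j < k" "q \<in> cis ` {a j..b j}"
    using strand_partner[OF i cr'(4) cr'(6)[symmetric]] by blast
  have "i \<noteq> j"
    using inj_strand[OF i(1) inj[OF i(1)] i(2) _ cr'(6)] cr'(5) j(2) by blast
  then have "p = cis (theta i j)" "q = cis (theta j i)"
    using crossing_at_theta[OF i(1) j(1) _ i(2) j(2)] cr'(6) by blast+
  moreover have "r i j"
    using over_theta[OF i(1) j(1) \<open>i \<noteq> j\<close>] cr'(1) calculation(1) by simp
  ultimately show "c \<in> (\<lambda>(i, j). (cis (theta i j), cis (theta j i))) ` crossing_pairs k r"
    using pq i j \<open>i \<noteq> j\<close> by (auto simp: crossing_pairs_def)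
next
  fix c assume "c \<in> (\<lambda>(i, j). (cis (theta i j), cis (theta j i))) ` crossing_pairs k r"
  then obtain i j where ij: "i < k" "j < k" "i \<noteq> j" "r i j" and c: "c = (cis (theta i j), cis (theta j i))"
    by (auto simp: crossing_pairs_def)
  have on: "cis (theta i j) \<in> cis ` {a i..b i}" "cis (theta j i) \<in> cis ` {a j..b j}"
    using theta_on_strand ij by blast+
  then have "curve D (cis (theta i j)) = curve D (cis (theta j i))"
    using crossing_at_theta[OF ij(1-3)] by blast
  then have "c \<in> real_crossings D"
    using over_theta[OF ij(1-3)] under_theta[of j i] ij c by (auto simp: real_crossings_def)
  then show "c \<in> real_crossings D \<inter> U \<times> U"
    using on ij c unfolding U_def by blast
qed

text \<open>After this reduction the diagram enters only through the levels at the strand starts and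
  the directions \<open>\<sigma>\<close>; the rest is data of the picture and of the type of
  move.\<close>

lemma inside_sum:
  assumes g: "level D g"
  defines "U \<equiv> \<Union>i<k. cis ` {a i..b i}"
  shows "(\<Sum>c\<in>real_crossings D \<inter> U \<times> U. crossing_weight n f D g c) =
    (\<Sum>c\<in>crossing_pairs k r. strand_weight n f k \<sigma> u v r (\<lambda>i. g (cis (a i))) c)"
proof -
  have "inj_on (\<lambda>(i, j). (cis (theta i j), cis (theta j i))) (crossing_pairs k r)"
  proof (rule inj_onI)
    fix x y assume xy: "x \<in> crossing_pairs k r" "y \<in> crossing_pairs k r"
      and eq: "(case x of (i, j) \<Rightarrow> (cis (theta i j), cis (theta j i))) =
        (case y of (i, j) \<Rightarrow> (cis (theta i j), cis (theta j i)))"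
    obtain i j l m where x: "x = (i, j)" and y: "y = (l, m)"
      by (cases x, cases y) auto
    have ij: "i < k" "j < k" "i \<noteq> j" and lm: "l < k" "m < k" "l \<noteq> m"
      using xy x y by (auto simp: crossing_pairs_def)
    have same: "i = l" if "i < k" "j < k" "i \<noteq> j" "l < k" "m < k" "l \<noteq> m"
      "cis (theta i j) = cis (theta l m)" for i j l m
      using disjoint[of i l] theta_on_strand[of i j] theta_on_strand[of l m] that by (metis disjoint_iff)
    have "cis (theta i j) = cis (theta l m)" "cis (theta j i) = cis (theta m l)"
      using eq x y by auto
    then have "i = l" "j = m"
      using same[of i j l m] same[of j i m l] ij lm by blast+
    then show "x = y"
      using x y by simp
  qed
  then have "(\<Sum>c\<in>real_crossings D \<inter> U \<times> U. crossing_weight n f D g c) =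
      (\<Sum>(i, j)\<in>crossing_pairs k r. crossing_weight n f D g (cis (theta i j), cis (theta j i)))"
    unfolding U_def crossings_inside by (simp add: sum.reindex case_prod_unfold)
  also have "\<dots> = (\<Sum>c\<in>crossing_pairs k r. strand_weight n f k \<sigma> u v r (\<lambda>i. g (cis (a i))) c)"
  proof (rule sum.cong[OF refl], clarify)
    fix i j assume "(i, j) \<in> crossing_pairs k r"
    then have ij: "i < k" "j < k" "i \<noteq> j"
      by (auto simp: crossing_pairs_def)
    show "crossing_weight n f D g (cis (theta i j), cis (theta j i)) =
        strand_weight n f k \<sigma> u v r (\<lambda>i. g (cis (a i))) (i, j)"
      using positive_theta[OF ij] level_theta[OF g ij] level_theta[OF g ij(2,1) ij(3)[symmetric]]
      by (simp add: crossing_weight_def strand_weight_def)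
  qed
  finally show ?thesis .
qed

end

text \<open>The two pictures share directions and over-relation but may differ in meeting parameters
  and velocities. The identity of weights is required for all entry levels \<open>c\<close>, as
  these are dictated by the diagram outside the disk.\<close>

lemma Phi_crossing_pictures:
  assumes dc: "diagram_change D D' a b k"
    and cp: "crossing_picture D P a b \<sigma> k u v r" "crossing_picture D' P' a b \<sigma> k u' v' r"
    and weights: "\<And>c. (\<Sum>x\<in>crossing_pairs k r. strand_weight n f k \<sigma> u v r c x) =
      (\<Sum>x\<in>crossing_pairs k r. strand_weight n f k \<sigma> u' v' r c x)"
    and n: "0 < n"
  shows "Phi n f D = Phi n f D'"
proof -
  interpret diagram_change D D' a b k
    by (rule dc)
  have strands': "strands = (\<Union>i<k. cis ` {a i..b i})"
    unfolding strands_def strand_def by simp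
  show ?thesis
  proof (rule Phi_change)
    show "rise D (strand i) = rise D' (strand i)" if "i < k" for i
      using crossing_picture.rise_whole_strand[OF cp(1) that]
        crossing_picture.rise_whole_strand[OF cp(2) that]
      by (simp add: strand_def)
  next
    fix g g' assume g: "level D g" and g': "level D' g'"
      and eq: "\<And>i. i < k \<Longrightarrow> g (cis (a i)) = g' (cis (a i))"
    \<comment> \<open>The levels are known to agree only at the starts of the strands below
      \<open>k\<close>, and the weight of such a pair reads no other value.\<close>
    have "strand_weight n f k \<sigma> u' v' r (\<lambda>i. g (cis (a i))) x =
        strand_weight n f k \<sigma> u' v' r (\<lambda>i. g' (cis (a i))) x" if "x \<in> crossing_pairs k r" for x
      using that eq by (auto simp: crossing_pairs_def strand_weight_def strand_level_def)
    then show "(\<Sum>c\<in>real_crossings D \<inter> strands \<times> strands. crossing_weight n f D g c) =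
        (\<Sum>c\<in>real_crossings D' \<inter> strands \<times> strands. crossing_weight n f D' g' c)"
      unfolding strands' crossing_picture.inside_sum[OF cp(1) g]
        crossing_picture.inside_sum[OF cp(2) g'] weights
      by (rule sum.cong[OF refl])
  qed (rule n)
qed


section \<open>The triple point picture\<close>

text \<open>The abscissa at which the third strand of \<^term>\<open>triple_picture 1\<close> meets the first diameter.\<close>

definition triple_height :: real
  where "triple_height = (SOME h. 0 < h \<and> h < 3 / 5 \<and> (1 - h\<^sup>2)\<^sup>2 / 4 = 4 / 3 * h)"

text \<open>The diameter has slope 4/3, the third strand is a graph over the abscissa: at 0 the
  graph is higher, at 3/5 lower. Since 3/5 is the abscissa at which the diameter ends, the meeting
  is interior.\<close>

lemma triple_height:
  "0 < triple_height" "triple_height < 3 / 5"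
  "(1 - triple_height\<^sup>2)\<^sup>2 / 4 = 4 / 3 * triple_height"
proof -
  let ?F = "\<lambda>h::real. (1 - h\<^sup>2)\<^sup>2 / 4 - 4 / 3 * h"
  have "\<exists>h. 0 \<le> h \<and> h \<le> 3 / 5 \<and> ?F h = 0"
    by (rule IVT2') (auto simp: power2_eq_square intro!: continuous_intros)
  then obtain h where h: "0 \<le> h" "h \<le> 3 / 5" "?F h = 0"
    by blast
  have "h \<noteq> 0"
    using h(3) by auto
  moreover have "h \<noteq> 3 / 5"
  proof
    assume "h = 3 / 5"
    with h(3) show False
      by (simp add: power2_eq_square field_simps)
  qed
  ultimately have "\<exists>h::real. 0 < h \<and> h < 3 / 5 \<and> (1 - h\<^sup>2)\<^sup>2 / 4 = 4 / 3 * h"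
    using h by (intro exI[of _ h]) auto
  from someI_ex[OF this, folded triple_height_def]
  show "0 < triple_height" "triple_height < 3 / 5"
    "(1 - triple_height\<^sup>2)\<^sup>2 / 4 = 4 / 3 * triple_height"
    by auto
qed

text \<open>For abscissas from 0 to 1 the graph falls while the line rises, and negative ones are
  excluded because a square is nonnegative. The substitution \<open>x = s * t\<close> reduces both
  pictures to the upper one.\<close>

lemma triple_height_unique:
  assumes s: "s \<in> {1, - 1}" and t: "t \<in> {- 1..1}"
  shows "s * (1 - t\<^sup>2)\<^sup>2 / 4 = 4 / 3 * t \<longleftrightarrow> t = s * triple_height"
proof
  have s2: "s * s = 1" "s\<^sup>2 = 1"
    using s by auto
  show "s * (1 - t\<^sup>2)\<^sup>2 / 4 = 4 / 3 * t" if "t = s * triple_height"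
    using triple_height(3) s by (auto simp: that)
  assume eq: "s * (1 - t\<^sup>2)\<^sup>2 / 4 = 4 / 3 * t"
  define x where "x = s * t"
  have x2: "x\<^sup>2 = t\<^sup>2"
    by (simp add: x_def power_mult_distrib s2)
  have x: "(1 - x\<^sup>2)\<^sup>2 / 4 = 4 / 3 * x"
    using eq s unfolding x2 by (auto simp: x_def)
  then have "0 \<le> 4 / 3 * x"
    by (metis zero_le_power2 divide_nonneg_pos zero_less_numeral)
  then have x0: "0 \<le> x"
    by simp
  have x1: "x\<^sup>2 \<le> 1"
    unfolding x2 using square_le_1[OF t] .
  let ?h = triple_height
  have h1: "?h\<^sup>2 \<le> 1"
    using triple_height by (intro square_le_1) auto
  have "x = ?h"
  proof (rule linorder_cases[of x ?h])
    assume less: "x < ?h"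
    then have "x\<^sup>2 \<le> ?h\<^sup>2"
      using x0 by (intro power_mono) auto
    then have "(1 - ?h\<^sup>2)\<^sup>2 \<le> (1 - x\<^sup>2)\<^sup>2"
      using h1 by (intro power_mono) auto
    then show ?thesis
      using x triple_height(3) less by linarith
  next
    assume less: "?h < x"
    then have "?h\<^sup>2 \<le> x\<^sup>2"
      using triple_height(1) by (intro power_mono) auto
    then have "(1 - x\<^sup>2)\<^sup>2 \<le> (1 - ?h\<^sup>2)\<^sup>2"
      using x1 by (intro power_mono) auto
    then show ?thesis
      using x triple_height(3) less by linarith
  qed
  then have "s * x = s * ?h"
    by simp
  then show "t = s * ?h"
    by (simp add: x_def s2 flip: mult.assoc)
qed

text \<open>A half-turn of the plane carries the picture for \<open>s = 1\<close> to that for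
  \<open>s = -1\<close> with every parameter negated, so one table suffices. The factor 5/3 converts
  an abscissa into a parameter of a diameter.\<close>

definition triple_param :: "nat \<Rightarrow> nat \<Rightarrow> real"
  where "triple_param i j =
    (if i = 2 then (if j = 0 then triple_height else - triple_height)
     else if j = 2 then (if i = 0 then 5 / 3 * triple_height else - (5 / 3 * triple_height))
     else 0)"

text \<open>A half-turn combined with negation of the parameter preserves velocities, so this table
  serves both pictures, and corresponding crossings have equal signs.\<close>

definition triple_velocity :: "nat \<Rightarrow> nat \<Rightarrow> complex"
  where "triple_velocity i j =
    (if i = 0 then Complex (3 / 5) (4 / 5)
     else if i = 1 then Complex (3 / 5) (- 4 / 5)
     else Complex 1 (- triple_param i j * (1 - (triple_param i j)\<^sup>2)))"

lemma less_3_cases: "i < 3 \<longleftrightarrow> i = 0 \<or> i = 1 \<or> i = (2::nat)"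
  by auto

lemma triple_picture_cross:
  assumes s: "s \<in> {1, - 1}" and ij: "i < 3" "j < 3" "i \<noteq> j" and xy: "x \<in> {- 1..1}" "y \<in> {- 1..1}"
  shows "(triple_picture s ! i) x = (triple_picture s ! j) y \<longleftrightarrow>
    x = s * triple_param i j \<and> y = s * triple_param j i"
proof -
  have 02: "3 / 5 * x = t \<and> 4 / 5 * x = s * (1 - t\<^sup>2)\<^sup>2 / 4 \<longleftrightarrow>
      x = s * (5 / 3 * triple_height) \<and> t = s * triple_height" if "t \<in> {- 1..1}" for x t :: real
  proof -
    have eqv: "3 / 5 * x = t \<and> 4 / 5 * x = z \<longleftrightarrow> x = 5 / 3 * t \<and> z = 4 / 3 * t" for z
      by auto
    show ?thesis
      unfolding eqv triple_height_unique[OF s that] by auto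
  qed
  \<comment> \<open>The second diameter is the mirror image of the first, so the equation for the
    ordinates is the previous one at \<open>- t\<close>.\<close>
  have 12: "3 / 5 * x = t \<and> - 4 / 5 * x = s * (1 - t\<^sup>2)\<^sup>2 / 4 \<longleftrightarrow>
      x = s * - (5 / 3 * triple_height) \<and> t = s * - triple_height" if t: "t \<in> {- 1..1}" for x t :: real
  proof -
    have eqv: "3 / 5 * x = t \<and> - 4 / 5 * x = z \<longleftrightarrow> x = 5 / 3 * t \<and> z = 4 / 3 * - t" for z
      by auto
    have sol: "s * (1 - t\<^sup>2)\<^sup>2 / 4 = 4 / 3 * - t \<longleftrightarrow> t = s * - triple_height"
      using triple_height_unique[OF s, of "- t"] t by auto
    show ?thesis
      unfolding eqv sol by auto
  qed
  have strand: "(triple_picture s ! 0) x = Complex (3 / 5 * x) (4 / 5 * x)"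
    "(triple_picture s ! 1) x = Complex (3 / 5 * x) (- 4 / 5 * x)"
    "(triple_picture s ! 2) x = Complex x (s * (1 - x\<^sup>2)\<^sup>2 / 4)" for x
    by (simp_all add: triple_picture_def)
  have cross01: "(triple_picture s ! 0) x = (triple_picture s ! 1) y \<longleftrightarrow>
      x = s * triple_param 0 1 \<and> y = s * triple_param 1 0" for x y
    unfolding strand by (auto simp: triple_param_def)
  have cross02: "(triple_picture s ! 0) x = (triple_picture s ! 2) y \<longleftrightarrow>
      x = s * triple_param 0 2 \<and> y = s * triple_param 2 0" if "y \<in> {- 1..1}" for x y
    unfolding strand complex.inject 02[OF that] by (simp add: triple_param_def)
  have cross12: "(triple_picture s ! 1) x = (triple_picture s ! 2) y \<longleftrightarrow>
      x = s * triple_param 1 2 \<and> y = s * triple_param 2 1" if "y \<in> {- 1..1}" for x y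
    unfolding strand complex.inject 12[OF that] by (simp add: triple_param_def)
  consider "i = 0" "j = 1" | "i = 1" "j = 0" | "i = 0" "j = 2" | "i = 2" "j = 0"
    | "i = 1" "j = 2" | "i = 2" "j = 1"
    using ij by (auto simp: less_3_cases)
  then show ?thesis
  proof cases
    case 1
    then show ?thesis
      using cross01[of x y] by simp
  next
    case 2
    then show ?thesis
      using cross01[of y x] by metis
  next
    case 3
    then show ?thesis
      using cross02[OF xy(2), of x] by simp
  next
    case 4
    then show ?thesis
      using cross02[OF xy(1), of y] by metis
  next
    case 5
    then show ?thesis
      using cross12[OF xy(2), of x] by simp
  next
    case 6
    then show ?thesis
      using cross12[OF xy(1), of y] by metis
  qed
qed

lemma triple_picture_velocity:
  assumes s: "s \<in> {1, - 1}" and i: "i < 3"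
  shows "(triple_picture s ! i has_vector_derivative triple_velocity i j) (at (s * triple_param i j))"
proof -
  consider "i = 0" | "i = 1" | "i = 2"
    using i by (auto simp: less_3_cases)
  then show ?thesis
  proof cases
    case 3
    define p where "p = triple_param i j"
    \<comment> \<open>The sign of the picture and the sign of the parameter cancel, which makes the
      velocity independent of \<open>s\<close>.\<close>
    have p: "- s * (s * p) * (1 - (s * p)\<^sup>2) = - p * (1 - p\<^sup>2)"
      using s by auto
    have "((\<lambda>t. s * (1 - t\<^sup>2)\<^sup>2 / 4) has_real_derivative - s * (s * p) * (1 - (s * p)\<^sup>2)) (at (s * p))"
      by (auto intro!: derivative_eq_intros simp: field_simps power2_eq_square)
    then show ?thesis
      unfolding p p_def[symmetric] triple_velocity_def
      by (simp add: 3 triple_picture_def has_vector_derivative_complex_iff)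
  qed (auto simp: triple_picture_def triple_velocity_def has_vector_derivative_complex_iff
      intro!: derivative_eq_intros)
qed

lemma triple_crossing_picture:
  assumes s: "s \<in> {1, - 1}"
    and pic: "picture D ((!) (triple_picture s)) a b \<sigma> 3"
    and cr: "crosses_as r 3 D (\<lambda>i. cis ` {a i..b i})"
    and asym: "\<And>i j. r i j \<Longrightarrow> \<not> r j i"
  shows "crossing_picture D ((!) (triple_picture s)) a b \<sigma> 3 (\<lambda>i j. s * triple_param i j) triple_velocity r"
proof (intro crossing_picture.intro crossing_picture_axioms.intro pic)
  have h: "0 < triple_height" "triple_height < 3 / 5"
    by (rule triple_height)+
  show "s * triple_param i j \<in> {- 1<..<1}" for i j
    using s h by (auto simp: triple_param_def)
  show "s * triple_param i j \<noteq> s * triple_param i l"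
    if "i < 3" "j < 3" "l < 3" "i \<noteq> j" "i \<noteq> l" "j \<noteq> l" for i j l
    using s h that by (auto simp: triple_param_def less_3_cases)
qed (use s cr asym triple_picture_cross triple_picture_velocity in
    \<open>auto intro: inj_on_subset[OF inj_triple_picture]\<close>)

text \<open>Passing to the other picture keeps all signs and reverses on each strand the order of
  its two crossings, so only the levels at the crossings can change.\<close>

lemma Phi_triple:
  assumes lc: "local_change (triple_picture 1) (triple_picture (-1)) (crosses_as r 3) D D'"
    and asym: "\<And>i j. r i j \<Longrightarrow> \<not> r j i" and n: "0 < n"
    and weights: "\<And>\<sigma> c. (\<And>i. i < 3 \<Longrightarrow> \<sigma> i \<in> {1, - 1}) \<Longrightarrow>
      (\<Sum>x\<in>crossing_pairs 3 r. strand_weight n f 3 \<sigma> triple_param triple_velocity r c x) =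
      (\<Sum>x\<in>crossing_pairs 3 r. strand_weight n f 3 \<sigma> (\<lambda>i j. - triple_param i j) triple_velocity r c x)"
  shows "Phi n f D = Phi n f D'"
proof (rule local_change_picturesE[OF lc])
  have len: "length (triple_picture s) = 3" for s
    by (simp add: triple_picture_def)
  show "triple_picture 1 \<noteq> []"
    by (simp add: triple_picture_def)
  show "norm ((triple_picture 1 ! i) t) \<le> 1" "norm ((triple_picture (-1) ! i) t) \<le> 1"
    if "i < length (triple_picture 1)" "t \<in> {- 1..1}" for i t
    using that norm_triple_picture by (auto simp: len)
  fix a b \<sigma>
  assume dc: "diagram_change D D' a b (length (triple_picture 1))"
    and pic: "picture D ((!) (triple_picture 1)) a b \<sigma> (length (triple_picture 1))"
      "picture D' ((!) (triple_picture (-1))) a b \<sigma> (length (triple_picture 1))"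
    and Q: "crosses_as r 3 D (\<lambda>i. cis ` {a i..b i})" "crosses_as r 3 D' (\<lambda>i. cis ` {a i..b i})"
  have "crossing_picture D ((!) (triple_picture 1)) a b \<sigma> 3 (\<lambda>i j. 1 * triple_param i j) triple_velocity r"
    using pic Q asym by (intro triple_crossing_picture) (auto simp: len)
  moreover have
    "crossing_picture D' ((!) (triple_picture (-1))) a b \<sigma> 3 (\<lambda>i j. - 1 * triple_param i j) triple_velocity r"
    using pic Q asym by (intro triple_crossing_picture) (auto simp: len)
  moreover have "\<sigma> i \<in> {1, - 1}" if "i < 3" for i
    using picture.\<sigma>[OF pic(1)] that by (simp add: len)
  ultimately show ?thesis
    using Phi_crossing_pictures[of D D' a b 3 _ \<sigma> triple_param triple_velocity r _ "\<lambda>i j. - triple_param i j" triple_velocity n f]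
      dc weights[of \<sigma>] n by (simp add: len)
qed

text \<open>Besides \<open>j\<close> there is a single strand, \<open>l\<close>, that
  \<open>i\<close> can have met earlier.\<close>

lemma triple_strand_level:
  assumes "i < 3" "j < 3" "l < 3" "i \<noteq> j" "i \<noteq> l" "j \<noteq> l"
  shows "strand_level 3 \<sigma> u r c i j =
    c i + (if \<sigma> i * u i l < \<sigma> i * u i j then of_bool (r i l) - of_bool (r l i) else 0)"
proof -
  have "{m. m < 3 \<and> m \<noteq> i \<and> \<sigma> i * u i m < \<sigma> i * u i j} =
      (if \<sigma> i * u i l < \<sigma> i * u i j then {l} else {})"
  proof -
    have "m < 3 \<and> m \<noteq> i \<longleftrightarrow> m = j \<or> m = l" for m
      using assms by presburger
    then have "{m. m < 3 \<and> m \<noteq> i \<and> \<sigma> i * u i m < \<sigma> i * u i j} =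
        {m. (m = j \<or> m = l) \<and> \<sigma> i * u i m < \<sigma> i * u i j}"
      by (metis (no_types, lifting))
    also have "\<dots> = (if \<sigma> i * u i l < \<sigma> i * u i j then {l} else {})"
      by auto
    finally show ?thesis .
  qed
  then show ?thesis
    by (simp add: strand_level_def)
qed

section \<open>The eight cocycle equations and the third move\<close>

text \<open>The cocycle condition speaks of residues, whereas levels are integers; reducing the
  arguments modulo \<open>n\<close> extends the equations to all integers.\<close>

lemma cocycle_equations:
  assumes "up_down_cocycle n f" "0 < n"
  defines "F \<equiv> \<lambda>a b \<epsilon>. f (a mod int n) (b mod int n) \<epsilon>"
  shows
    "F (a-1) b Neg + F (b+1) (c+1) Pos + F (a-1) (c+2) Pos
      = F (a-2) (b-1) Neg + F b (c+2) Pos + F a (c+1) Pos"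
    "F (a-1) b Neg + F b (c+1) Neg + F (a-2) c Neg
      = F (a-2) (b-1) Neg + F (b-1) c Neg + F (a-1) (c+1) Neg"
    "F (a-1) (b+1) Pos + F (b+1) (c+1) Pos + F (a-1) (c+1) Neg
      = F a b Pos + F b (c+2) Pos + F (a-2) c Neg"
    "F (a-1) (b+1) Pos + F b (c+1) Neg + F a (c+1) Pos
      = F a b Pos + F (b-1) c Neg + F (a-1) (c+2) Pos"
    "F a (b+1) Pos + F (b+1) (c+2) Pos + F (a-1) (c+1) Pos
      = F (a-1) b Pos + F b (c+1) Pos + F a (c+2) Pos"
    "F a (b+1) Pos + F b c Neg + F (a-2) (c+1) Neg
      = F (a-1) b Pos + F (b-1) (c+1) Neg + F (a-1) c Neg"
    "F (a-2) b Neg + F (b+1) (c+2) Pos + F (a-1) c Neg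
      = F (a-1) (b-1) Neg + F b (c+1) Pos + F (a-2) (c+1) Neg"
    "F (a-2) b Neg + F b c Neg + F a (c+2) Pos
      = F (a-1) (b-1) Neg + F (b-1) (c+1) Neg + F (a-1) (c+1) Pos"
proof -
  have mem: "x mod int n \<in> {0..<int n}" for x
    using assms(2) by simp
  note cocycle = assms(1)[unfolded up_down_cocycle_def Let_def, THEN conjunct2, rule_format,
      OF mem mem mem, of a b c, unfolded mod_simps mod_mod_trivial]
  show
    "F (a-1) b Neg + F (b+1) (c+1) Pos + F (a-1) (c+2) Pos
      = F (a-2) (b-1) Neg + F b (c+2) Pos + F a (c+1) Pos"
    "F (a-1) b Neg + F b (c+1) Neg + F (a-2) c Neg
      = F (a-2) (b-1) Neg + F (b-1) c Neg + F (a-1) (c+1) Neg"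
    "F (a-1) (b+1) Pos + F (b+1) (c+1) Pos + F (a-1) (c+1) Neg
      = F a b Pos + F b (c+2) Pos + F (a-2) c Neg"
    "F (a-1) (b+1) Pos + F b (c+1) Neg + F a (c+1) Pos
      = F a b Pos + F (b-1) c Neg + F (a-1) (c+2) Pos"
    "F a (b+1) Pos + F (b+1) (c+2) Pos + F (a-1) (c+1) Pos
      = F (a-1) b Pos + F b (c+1) Pos + F a (c+2) Pos"
    "F a (b+1) Pos + F b c Neg + F (a-2) (c+1) Neg
      = F (a-1) b Pos + F (b-1) (c+1) Neg + F (a-1) c Neg"
    "F (a-2) b Neg + F (b+1) (c+2) Pos + F (a-1) c Neg
      = F (a-1) (b-1) Neg + F b (c+1) Pos + F (a-2) (c+1) Neg"
    "F (a-2) b Neg + F b c Neg + F a (c+2) Pos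
      = F (a-1) (b-1) Neg + F (b-1) (c+1) Neg + F (a-1) (c+1) Pos"
    using cocycle unfolding F_def by - (elim conjE, assumption)+
qed

text \<open>
  The bottom, middle and top strand enter the disk at the levels \<open>a\<close>, \<open>b\<close>, \<open>c\<close>.  The bottom strand
  meets the middle strand first iff \<open>x\<close>; the middle strand meets the bottom strand first iff \<open>y\<close>; the
  top strand meets the bottom strand first iff \<open>w\<close>.  The cyclic order of the strands is \<open>\<kappa>\<close>; it
  determines the crossing signs from \<open>x\<close>, \<open>y\<close>, \<open>w\<close>.  The sixteen cases are the eight cocycle
  equations, each read in both directions.
\<close>

lemma third_move_identity:
  fixes a b c :: int and \<kappa> :: bool
  assumes "up_down_cocycle n f" "0 < n"
  defines "W \<equiv> \<lambda>p u v. if p then f (u mod int n) ((v + 1) mod int n) Pos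
      else f ((u - 1) mod int n) (v mod int n) Neg"
  defines "T \<equiv> \<lambda>x y w.
      W ((x = y) = \<kappa>) (a - of_bool (\<not> x)) (b - of_bool (\<not> y)) +
      W ((x = w) = \<kappa>) (a - of_bool x) (c + of_bool (\<not> w)) +
      W ((w = y) = \<kappa>) (b + of_bool y) (c + of_bool w)"
  shows "T x y w = T (\<not> x) (\<not> y) (\<not> w)"
proof -
  \<comment> \<open>For instance, \<open>\<kappa>\<close>, \<open>x\<close>, \<open>y\<close>,
    \<open>w\<close> all true gives the equation in which every sign is \<open>Pos\<close>, and
    \<open>\<kappa>\<close> false with \<open>x\<close>, \<open>y\<close>, \<open>w\<close> true the
    one in which every sign is \<open>Neg\<close>.\<close>
  note e = cocycle_equations[OF assms(1,2), of a b c]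
  show ?thesis
    unfolding T_def W_def
    by (cases x; cases y; cases w; cases \<kappa>)
      (simp_all, (use e(1) in \<open>simp add: ac_simps; fail\<close> | use e(2) in \<open>simp add: ac_simps; fail\<close>
       | use e(3) in \<open>simp add: ac_simps; fail\<close> | use e(4) in \<open>simp add: ac_simps; fail\<close>
       | use e(5) in \<open>simp add: ac_simps; fail\<close> | use e(6) in \<open>simp add: ac_simps; fail\<close>
       | use e(7) in \<open>simp add: ac_simps; fail\<close> | use e(8) in \<open>simp add: ac_simps; fail\<close>)+)
qed


section \<open>Invariance\<close>

text \<open>The only real crossing is that of the two diameters. Nothing real is met before it, so
  both strands reach it at their entry levels, and its sign is the same in both pictures.\<close>

lemma Phi_VRIV:
  assumes "directed_move VRIV D D'" and n: "0 < n"
  shows "Phi n f D = Phi n f D'"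
proof -
  obtain m :: nat where m: "m < 2" and
    lc: "local_change (triple_picture 1) (triple_picture (-1)) (crosses_as (\<lambda>i j. i = m \<and> j = 1 - m) 3) D D'"
    using assms(1) by auto
  show ?thesis
  proof (rule Phi_triple[OF lc _ n])
    show "\<not> (j = m \<and> i = 1 - m)" if "i = m \<and> j = 1 - m" for i j
      using that m by presburger
    fix \<sigma> :: "nat \<Rightarrow> real" and c
    let ?r = "\<lambda>i j. i = m \<and> j = 1 - m"
    have "m \<noteq> 1 - m"
      using m by presburger
    then have pairs: "crossing_pairs 3 ?r = {(m, 1 - m)}"
      using m by (auto simp: crossing_pairs_def)
    have "strand_level 3 \<sigma> u ?r c m (1 - m) = c m" "strand_level 3 \<sigma> u ?r c (1 - m) m = c (1 - m)" for u
      using triple_strand_level[of m "1 - m" 2 \<sigma> u ?r c] triple_strand_level[of "1 - m" m 2 \<sigma> u ?r c]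
        m \<open>m \<noteq> 1 - m\<close> by auto
    then show "(\<Sum>x\<in>crossing_pairs 3 ?r. strand_weight n f 3 \<sigma> triple_param triple_velocity ?r c x) =
        (\<Sum>x\<in>crossing_pairs 3 ?r.
          strand_weight n f 3 \<sigma> (\<lambda>i j. - triple_param i j) triple_velocity ?r c x)"
      unfolding pairs by (simp add: strand_weight_def)
  qed
qed

text \<open>Reversing one strand flips the order of the crossings on it and the signs of exactly
  these two crossings, so all three relations persist with the same \<open>\<kappa>\<close>.\<close>

lemma triple_signs:
  assumes \<sigma>: "\<And>i. i < 3 \<Longrightarrow> \<sigma> i \<in> {1, - 1 :: real}"
    and bmt: "b < 3" "m < 3" "t < 3" "b \<noteq> m" "b \<noteq> t" "m \<noteq> t"
  defines "pos \<equiv> \<lambda>i j. 0 < \<sigma> i * \<sigma> j * det2 (triple_velocity i j) (triple_velocity j i)"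
    and "before \<equiv> \<lambda>i l j. \<sigma> i * triple_param i l < \<sigma> i * triple_param i j"
  shows "\<exists>\<kappa>. pos m b = ((before b m t = before m b t) = \<kappa>) \<and>
    pos t b = ((before b m t = before t b m) = \<kappa>) \<and>
    pos t m = ((before t b m = before m b t) = \<kappa>)"
proof -
  have h: "0 < triple_height" "triple_height < 3 / 5"
    by (rule triple_height)+
  \<comment> \<open>The slope of the third strand is \<open>- q\<close> at the first diameter and
    \<open>q\<close> at the second; \<open>q > 0\<close> fixes the signs of its determinants with
    the diameters.\<close>
  define q where "q = triple_height * (1 - triple_height\<^sup>2)"
  have "triple_height\<^sup>2 < 1"
    using h by (simp add: abs_square_less_1)
  then have q: "0 < q"
    using h by (simp add: q_def)
  have v: "triple_velocity 0 j = Complex (3 / 5) (4 / 5)" "triple_velocity 1 j = Complex (3 / 5) (- 4 / 5)"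
    "triple_velocity 2 0 = Complex 1 (- q)" "triple_velocity 2 1 = Complex 1 q" for j
    by (simp_all add: triple_velocity_def triple_param_def q_def)
  have \<sigma>_cases: "\<sigma> 0 = 1 \<or> \<sigma> 0 = - 1" "\<sigma> 1 = 1 \<or> \<sigma> 1 = - 1" "\<sigma> 2 = 1 \<or> \<sigma> 2 = - 1"
    using \<sigma>[of 0] \<sigma>[of 1] \<sigma>[of 2] by auto
  have pos: "pos 0 1 \<longleftrightarrow> \<sigma> 0 \<noteq> \<sigma> 1" "pos 1 0 \<longleftrightarrow> \<sigma> 0 = \<sigma> 1"
    "pos 0 2 \<longleftrightarrow> \<sigma> 0 \<noteq> \<sigma> 2" "pos 2 0 \<longleftrightarrow> \<sigma> 0 = \<sigma> 2"
    "pos 1 2 \<longleftrightarrow> \<sigma> 1 = \<sigma> 2" "pos 2 1 \<longleftrightarrow> \<sigma> 1 \<noteq> \<sigma> 2"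
    using \<sigma>_cases q unfolding pos_def v det2_def by auto
  have before: "before 0 1 2 \<longleftrightarrow> \<sigma> 0 = 1" "before 0 2 1 \<longleftrightarrow> \<sigma> 0 \<noteq> 1"
    "before 1 0 2 \<longleftrightarrow> \<sigma> 1 \<noteq> 1" "before 1 2 0 \<longleftrightarrow> \<sigma> 1 = 1"
    "before 2 0 1 \<longleftrightarrow> \<sigma> 2 \<noteq> 1" "before 2 1 0 \<longleftrightarrow> \<sigma> 2 = 1"
    using \<sigma>_cases h unfolding before_def triple_param_def by auto
  have "(b, m, t) \<in> {(0,1,2), (0,2,1), (1,0,2), (1,2,0), (2,0,1), (2,1,0)}"
    using bmt by (auto simp: less_3_cases)
  \<comment> \<open>\<open>\<kappa>\<close> is read off the first relation; the other two are
    checked for every assignment of the three roles and every choice of directions.\<close>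
  then have "pos m b = ((before b m t = before m b t) = (pos m b = (before b m t = before m b t))) \<and>
      pos t b = ((before b m t = before t b m) = (pos m b = (before b m t = before m b t))) \<and>
      pos t m = ((before t b m = before m b t) = (pos m b = (before b m t = before m b t)))"
    using \<sigma>_cases by (elim insertE disjE emptyE; simp del: One_nat_def add: pos before)
  then show ?thesis
    by (rule exI)
qed

text \<open>With the strands named bottom, middle and top by height, exchanging the pictures negates
  \<open>x\<close>, \<open>y\<close>, \<open>w\<close> and keeps \<open>\<kappa>\<close>, which is
  the symmetry of \<open>third_move_identity\<close>.\<close>

lemma Phi_RIII:
  assumes "directed_move RIII D D'" and n: "0 < n" and f: "up_down_cocycle n f"
  shows "Phi n f D = Phi n f D'"
proof -
  obtain h :: "nat \<Rightarrow> nat" where inj: "inj_on h {..<3}" and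
    lc: "local_change (triple_picture 1) (triple_picture (-1)) (crosses_as (\<lambda>i j. h j < h i) 3) D D'"
    using assms(1) by auto
  have distinct: "h 0 \<noteq> h 1" "h 0 \<noteq> h 2" "h 1 \<noteq> h 2"
    using inj_onD[OF inj, of 0 1] inj_onD[OF inj, of 0 2] inj_onD[OF inj, of 1 2] by auto
  obtain b m t where bmt: "b < 3" "m < 3" "t < 3" "h b < h m" "h m < h t"
  proof -
    have "\<exists>b m t. b < 3 \<and> m < 3 \<and> t < 3 \<and> h b < h m \<and> h m < h t"
      using distinct unfolding less_3_cases by (metis linorder_less_linear)
    then show ?thesis
      using that by blast
  qed
  then have neq: "b \<noteq> m" "b \<noteq> t" "m \<noteq> t"
    by auto
  have lt3: "i < 3 \<longleftrightarrow> i = b \<or> i = m \<or> i = t" for i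
    using bmt neq by presburger
  let ?r = "\<lambda>i j. h j < h i"
  have pairs: "crossing_pairs 3 ?r = {(m, b), (t, b), (t, m)}"
    using bmt unfolding crossing_pairs_def lt3 by auto
  show ?thesis
  proof (rule Phi_triple[OF lc _ n])
    fix \<sigma> :: "nat \<Rightarrow> real" and c
    assume \<sigma>: "\<And>i. i < 3 \<Longrightarrow> \<sigma> i \<in> {1, - 1}"
    define pos where "pos = (\<lambda>i j. 0 < \<sigma> i * \<sigma> j * det2 (triple_velocity i j) (triple_velocity j i))"
    define before where "before = (\<lambda>(u :: nat \<Rightarrow> nat \<Rightarrow> real) i l j. \<sigma> i * u i l < \<sigma> i * u i j)"
    define W where "W = (\<lambda>p u v. if p then f (u mod int n) ((v + 1) mod int n) Pos
      else f ((u - 1) mod int n) (v mod int n) Neg)"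
    \<comment> \<open>Each level is the entry level corrected by the one crossing that may come
      earlier: the bottom strand falls, the top strand rises, and the middle strand rises after the
      bottom one and falls after the top one.\<close>
    have sum: "(\<Sum>x\<in>crossing_pairs 3 ?r. strand_weight n f 3 \<sigma> u triple_velocity ?r c x) =
        W (pos m b) (c b - of_bool (before u b t m)) (c m - of_bool (before u m t b)) +
        W (pos t b) (c b - of_bool (before u b m t)) (c t + of_bool (before u t m b)) +
        W (pos t m) (c m + of_bool (before u m b t)) (c t + of_bool (before u t b m))" for u
    proof -
      have level: "strand_level 3 \<sigma> u ?r c i j =
          c i + (if before u i l j then of_bool (h l < h i) - of_bool (h i < h l) else 0)"
        if "i < 3" "j < 3" "l < 3" "i \<noteq> j" "i \<noteq> l" "j \<noteq> l" for i j l
        using triple_strand_level[OF that] by (simp add: before_def)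
      have "(\<Sum>x\<in>crossing_pairs 3 ?r. strand_weight n f 3 \<sigma> u triple_velocity ?r c x) =
          strand_weight n f 3 \<sigma> u triple_velocity ?r c (m, b) +
          strand_weight n f 3 \<sigma> u triple_velocity ?r c (t, b) +
          strand_weight n f 3 \<sigma> u triple_velocity ?r c (t, m)"
        using neq by (simp add: pairs add.assoc)
      moreover have "strand_level 3 \<sigma> u ?r c b m = c b - of_bool (before u b t m)"
        "strand_level 3 \<sigma> u ?r c m b = c m - of_bool (before u m t b)"
        "strand_level 3 \<sigma> u ?r c b t = c b - of_bool (before u b m t)"
        "strand_level 3 \<sigma> u ?r c t b = c t + of_bool (before u t m b)"
        "strand_level 3 \<sigma> u ?r c m t = c m + of_bool (before u m b t)"
        "strand_level 3 \<sigma> u ?r c t m = c t + of_bool (before u t b m)"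
        using level[of b m t] level[of m b t] level[of b t m] level[of t b m] level[of m t b] level[of t m b]
          bmt neq by auto
      ultimately show ?thesis
        by (simp only: strand_weight_def prod.case W_def pos_def)
    qed
    \<comment> \<open>The two meeting parameters on a strand are distinct, so exchanging them or
      negating both reverses the comparison.\<close>
    have flip: "before triple_param i l j \<longleftrightarrow> \<not> before triple_param i j l"
      "before (\<lambda>i j. - triple_param i j) i l j \<longleftrightarrow> \<not> before triple_param i l j"
      if "i < 3" "j < 3" "l < 3" "i \<noteq> j" "i \<noteq> l" "j \<noteq> l" for i j l
    proof -
      have "triple_param i l \<noteq> triple_param i j"
        using that triple_height(1) by (auto simp: triple_param_def less_3_cases)
      then show "before triple_param i l j \<longleftrightarrow> \<not> before triple_param i j l"
        "before (\<lambda>i j. - triple_param i j) i l j \<longleftrightarrow> \<not> before triple_param i l j"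
        using \<sigma>[OF that(1)] by (auto simp: before_def)
    qed
    define x y w where "x = before triple_param b m t" and "y = before triple_param m b t"
      and "w = before triple_param t b m"
    have "\<exists>\<kappa>. pos m b = ((x = y) = \<kappa>) \<and> pos t b = ((x = w) = \<kappa>) \<and> pos t m = ((w = y) = \<kappa>)"
      unfolding pos_def before_def x_def y_def w_def by (rule triple_signs[OF \<sigma> bmt(1-3) neq])
    then obtain \<kappa> where \<kappa>: "pos m b = ((x = y) = \<kappa>)" "pos t b = ((x = w) = \<kappa>)" "pos t m = ((w = y) = \<kappa>)"
      by (elim exE conjE)
    have before: "before triple_param b m t = x" "before triple_param b t m = (\<not> x)"
      "before triple_param m b t = y" "before triple_param m t b = (\<not> y)"
      "before triple_param t b m = w" "before triple_param t m b = (\<not> w)"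
      using flip(1)[of b m t] flip(1)[of m b t] flip(1)[of t b m] bmt(1-3) neq
      by (auto simp: x_def y_def w_def)
    have before': "before (\<lambda>i j. - triple_param i j) b m t = (\<not> x)"
      "before (\<lambda>i j. - triple_param i j) b t m = (\<not> \<not> x)"
      "before (\<lambda>i j. - triple_param i j) m b t = (\<not> y)"
      "before (\<lambda>i j. - triple_param i j) m t b = (\<not> \<not> y)"
      "before (\<lambda>i j. - triple_param i j) t b m = (\<not> w)"
      "before (\<lambda>i j. - triple_param i j) t m b = (\<not> \<not> w)"
      using flip(2) bmt(1-3) neq before by metis+
    \<comment> \<open>Each sign depends on whether two of the orders agree, and that survives
      negating both.\<close>
    have negate: "((\<not> p) = (\<not> q)) = (p = q)" for p q
      by blast
    show "(\<Sum>x\<in>crossing_pairs 3 ?r. strand_weight n f 3 \<sigma> triple_param triple_velocity ?r c x) =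
        (\<Sum>x\<in>crossing_pairs 3 ?r.
          strand_weight n f 3 \<sigma> (\<lambda>i j. - triple_param i j) triple_velocity ?r c x)"
      using third_move_identity[OF f n, where a = "c b" and b = "c m" and c = "c t" and \<kappa> = \<kappa>
          and x = x and y = y and w = w]
      unfolding sum before before' \<kappa> W_def negate .
  qed simp
qed

text \<open>The conclusion is symmetric in the two diagrams, so one direction of each move
  suffices.\<close>

lemma Phi_reidemeister_move:
  assumes "reidemeister_move m D D'" "m \<noteq> RII" and n: "0 < n" and f: "up_down_cocycle n f"
  shows "Phi n f D = Phi n f D'"
proof -
  have "Phi n f D = Phi n f D'" if "directed_move m D D'" for D D'
    using that assms(2) Phi_RI[OF _ n f] Phi_RIII[OF _ n f] Phi_VRI[OF _ n]
      Phi_VRII[OF _ n] Phi_VRIII[OF _ n] Phi_VRIV[OF _ n]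
    by (cases m) blast+
  then show ?thesis
    using assms(1) unfolding reidemeister_move_def by metis
qed

lemma Phi_move_sequence:
  assumes "move_sequence ms D D'" "RII \<notin> set ms" "0 < n" "up_down_cocycle n f"
  shows "Phi n f D = Phi n f D'"
  using assms
proof (induction rule: move_sequence.induct)
  case (Nil D D')
  then show ?case
    using Phi_isotopic by blast
next
  case (Cons D E m F ms D')
  have "Phi n f D = Phi n f E"
    using Cons by (intro Phi_isotopic)
  also have "\<dots> = Phi n f F"
    using Cons by (intro Phi_reidemeister_move[of m]) auto
  also have "\<dots> = Phi n f D'"
    using Cons by simp
  finally show ?case .
qed

theorem theorem1p3:
  fixes n :: nat
    and f :: "int \<Rightarrow> int \<Rightarrow> sign \<Rightarrow> 'a::ab_group_add"
    and D D' :: vdiagram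
  assumes "0 < n"
    and "up_down_cocycle n f"
    and "virtual_knot_diagram D" and "virtual_knot_diagram D'"
    and "same_virtual_knot D D'"
    and "Phi n f D \<noteq> Phi n f D'"
  shows "\<forall>ms. move_sequence ms D D' \<longrightarrow> RII \<in> set ms"
  using assms Phi_move_sequence by blast

end
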